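(* Let $n\ge 2$ and let $\mathbf{k}$ be an algebraically closed field. If the complements $\mathbb{P}^n_{\mathbf{k}}\setminus H$ and $\mathbb{P}^n_{\mathbf{k}}\setminus H'$ of two irreducible quadric hypersurfaces $H,H'$ in $\mathbb{P}^n_{\mathbf{k}}$ are isomorphic, then there exists an automorphism of $\mathbb{P}^n_{\mathbf{k}}$ that sends $H$ onto $H'$.
   Context: An irreducible quadric hypersurface in $\mathbb{P}^n_{\mathbf{k}}$ is the zero locus of an irreducible homogeneous polynomial of degree $2$ in $\mathbf{k}[x_0,\ldots,x_n]$. Isomorphisms and automorphisms are over $\mathbf{k}$. *)

theory Defs
  imports "HOL-Analysis.Analysis" "HOL-Library.Poly_Mapping"
begin

section \<open>Polynomials in finitely many variables\<close>

text \<open>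
  The polynomial ring over \<open>'k\<close> in one variable for each element of the finite type \<open>'n\<close> is
  the ring of finitely supported functions from exponent vectors to coefficients, with the
  convolution product of \<^theory>\<open>HOL-Library.Poly_Mapping\<close>.
\<close>

type_synonym ('n, 'k) mpoly = "('n \<Rightarrow>\<^sub>0 nat) \<Rightarrow>\<^sub>0 'k"

definition eval_monomial :: "('n::finite \<Rightarrow>\<^sub>0 nat) \<Rightarrow> 'k::comm_semiring_1 ^ 'n \<Rightarrow> 'k" where
  "eval_monomial m x = (\<Prod>i\<in>UNIV. (x $ i) ^ Poly_Mapping.lookup m i)"

definition eval_mpoly :: "('n::finite, 'k::comm_semiring_1) mpoly \<Rightarrow> 'k ^ 'n \<Rightarrow> 'k" where
  "eval_mpoly p x = (\<Sum>m\<in>Poly_Mapping.keys p. Poly_Mapping.lookup p m * eval_monomial m x)"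

definition monomial_degree :: "('n::finite \<Rightarrow>\<^sub>0 nat) \<Rightarrow> nat" where
  "monomial_degree m = (\<Sum>i\<in>UNIV. Poly_Mapping.lookup m i)"

text \<open>The zero polynomial is homogeneous of every degree.\<close>

definition homogeneous :: "nat \<Rightarrow> ('n::finite, 'k::zero) mpoly \<Rightarrow> bool" where
  "homogeneous d p \<longleftrightarrow> (\<forall>m\<in>Poly_Mapping.keys p. monomial_degree m = d)"

lemma eval_monomial_add: "eval_monomial (l + m) x = eval_monomial l x * eval_monomial m x"
  by (simp add: eval_monomial_def lookup_add power_add prod.distrib)

lemma monomial_degree_add: "monomial_degree (l + m) = monomial_degree l + monomial_degree m"
  by (simp add: monomial_degree_def lookup_add sum.distrib)

lemma eval_mpoly_superset:
  assumes "finite A" "Poly_Mapping.keys p \<subseteq> A"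
  shows "eval_mpoly p x = (\<Sum>m\<in>A. Poly_Mapping.lookup p m * eval_monomial m x)"
  unfolding eval_mpoly_def using assms
  by (intro sum.mono_neutral_left) (auto simp: in_keys_iff)

lemma eval_mpoly_zero [simp]: "eval_mpoly 0 x = 0"
  by (simp add: eval_mpoly_def)

lemma eval_mpoly_single [simp]:
  "eval_mpoly (Poly_Mapping.single m c) x = c * eval_monomial m x"
  by (simp add: eval_mpoly_def)

lemma eval_mpoly_one [simp]: "eval_mpoly 1 x = 1"
  using eval_mpoly_single[of 0 1 x] by (simp add: eval_monomial_def)

lemma eval_mpoly_add: "eval_mpoly (p + q) x = eval_mpoly p x + eval_mpoly q x"
proof -
  let ?A = "Poly_Mapping.keys p \<union> Poly_Mapping.keys q"
  have "Poly_Mapping.keys (p + q) \<subseteq> ?A" by (rule Poly_Mapping.keys_add)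
  then show ?thesis
    by (simp add: eval_mpoly_superset[of ?A] lookup_add distrib_right sum.distrib)
qed

lemma mpoly_sum_singles:
  "p = (\<Sum>m\<in>Poly_Mapping.keys p. Poly_Mapping.single m (Poly_Mapping.lookup p m))"
  by (rule poly_mapping_eqI)
    (auto simp: lookup_sum lookup_single when_def sum.delta in_keys_iff)

lemma eval_mpoly_sum: "eval_mpoly (\<Sum>i\<in>A. f i) x = (\<Sum>i\<in>A. eval_mpoly (f i) x)"
  by (induction A rule: infinite_finite_induct) (auto simp: eval_mpoly_add)

lemma eval_mpoly_mult: "eval_mpoly (p * q) x = eval_mpoly p x * eval_mpoly q x"
proof -
  let ?s = "\<lambda>p m. Poly_Mapping.single m (Poly_Mapping.lookup p m)"
  have "p * q = (\<Sum>l\<in>Poly_Mapping.keys p. \<Sum>m\<in>Poly_Mapping.keys q. ?s p l * ?s q m)"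
    unfolding sum_product[symmetric] mpoly_sum_singles[symmetric] ..
  then have "eval_mpoly (p * q) x =
      (\<Sum>l\<in>Poly_Mapping.keys p. \<Sum>m\<in>Poly_Mapping.keys q. eval_mpoly (?s p l * ?s q m) x)"
    by (simp only: eval_mpoly_sum)
  also have "\<dots> = eval_mpoly p x * eval_mpoly q x"
    unfolding mult_single eval_mpoly_single eval_mpoly_def[of p] eval_mpoly_def[of q]
      eval_monomial_add sum_product
    by (simp add: mult_ac)
  finally show ?thesis .
qed

lemma homogeneous_zero [simp]: "homogeneous d 0"
  by (simp add: homogeneous_def)

lemma homogeneous_one [simp]: "homogeneous 0 (1 :: ('n::finite, 'k::zero_neq_one) mpoly)"
proof -
  have "homogeneous 0 (Poly_Mapping.single 0 1 :: ('n, 'k) mpoly)"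
    by (auto simp: homogeneous_def monomial_degree_def)
  then show ?thesis by simp
qed

lemma homogeneous_mult:
  assumes "homogeneous d p" "homogeneous e q"
  shows "homogeneous (d + e) (p * q)"
  unfolding homogeneous_def
proof
  fix m assume "m \<in> Poly_Mapping.keys (p * q)"
  then obtain a b where "m = a + b" "a \<in> Poly_Mapping.keys p" "b \<in> Poly_Mapping.keys q"
    using Poly_Mapping.keys_mult[of p q] by blast
  then show "monomial_degree m = d + e"
    using assms by (simp add: homogeneous_def monomial_degree_add)
qed


section \<open>Projective space and its Zariski topology\<close>

text \<open>
  A point of the projective space with homogeneous coordinates indexed by \<open>'n\<close> is a
  one-dimensional linear subspace of \<open>'k ^ 'n\<close>, that is, the set of all multiples of a nonzero
  vector. The dimension of the projective space is \<open>CARD('n) - 1\<close>.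
\<close>

type_synonym ('k, 'n) point = "('k ^ 'n) set"

definition proj_space :: "('k::field, 'n::finite) point set" where
  "proj_space = {vec.span {v} | v. v \<noteq> 0}"

definition zero_locus :: "('n::finite, 'k::field) mpoly set \<Rightarrow> ('k, 'n) point set" where
  "zero_locus S = {L \<in> proj_space. \<forall>p\<in>S. \<forall>v\<in>L. eval_mpoly p v = 0}"

definition proj_closed :: "('k::field, 'n::finite) point set \<Rightarrow> bool" where
  "proj_closed Z \<longleftrightarrow> (\<exists>S. (\<forall>p\<in>S. \<exists>d. homogeneous d p) \<and> Z = zero_locus S)"

definition zariski :: "('k::field, 'n::finite) point topology" where
  "zariski = topology (\<lambda>U. U \<subseteq> proj_space \<and> proj_closed (proj_space - U))"

lemma eval_monomial_scale:
  "eval_monomial m (c *s v) = c ^ monomial_degree m * eval_monomial m v"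
  by (simp add: eval_monomial_def monomial_degree_def power_mult_distrib prod.distrib power_sum)

lemma eval_mpoly_scale:
  assumes "homogeneous d p"
  shows "eval_mpoly p (c *s v) = c ^ d * eval_mpoly p v"
  using assms unfolding eval_mpoly_def homogeneous_def
  by (auto simp: eval_monomial_scale sum_distrib_left mult_ac intro!: sum.cong)

lemma proj_space_scale:
  assumes "L \<in> proj_space" "v \<in> L" "v \<noteq> 0" "w \<in> L"
  obtains c where "w = c *s v"
proof -
  obtain u where L: "L = vec.span {u}" using assms(1) by (auto simp: proj_space_def)
  obtain a b where ab: "v = a *s u" "w = b *s u"
    using assms(2,4) by (auto simp: L vec.span_singleton)
  with assms(3) have "a \<noteq> 0" by auto
  then have "w = (b / a) *s v" by (simp add: ab)
  then show thesis by (rule that)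
qed

lemma proj_space_nonzero:
  assumes "L \<in> proj_space"
  obtains v where "v \<in> L" "v \<noteq> 0"
  using assms by (auto simp: proj_space_def intro: vec.span_base)

lemma proj_closed_Un:
  fixes Y Z :: "('k::field, 'n::finite) point set"
  assumes "proj_closed Y" "proj_closed Z"
  shows "proj_closed (Y \<union> Z)"
proof -
  obtain S T where
      S: "\<forall>p\<in>S. \<exists>d. homogeneous d p" "Y = zero_locus S" and
      T: "\<forall>p\<in>T. \<exists>d. homogeneous d p" "Z = zero_locus T"
    using assms unfolding proj_closed_def by blast
  let ?ST = "{p * q | p q. p \<in> S \<and> q \<in> T}"
  have hom: "\<forall>p\<in>?ST. \<exists>d. homogeneous d p"
    using S(1) T(1) homogeneous_mult by blast
  have "Y \<union> Z = zero_locus ?ST"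
  proof (intro equalityI subsetI)
    fix L assume "L \<in> Y \<union> Z"
    then show "L \<in> zero_locus ?ST"
      by (auto simp: S(2) T(2) zero_locus_def eval_mpoly_mult)
  next
    fix L assume L: "L \<in> zero_locus ?ST"
    then have Lp: "L \<in> proj_space" by (simp add: zero_locus_def)
    obtain v where v: "v \<in> L" "v \<noteq> 0" using Lp by (rule proj_space_nonzero)
    have vanish: "\<forall>w\<in>L. eval_mpoly p w = 0"
      if hp: "\<exists>d. homogeneous d p" and "eval_mpoly p v = 0" for p :: "('n, 'k) mpoly"
    proof
      fix w assume "w \<in> L"
      obtain c where "w = c *s v" using proj_space_scale[OF Lp v \<open>w \<in> L\<close>] .
      then show "eval_mpoly p w = 0" using that eval_mpoly_scale by fastforce
    qed
    have "(\<forall>p\<in>S. eval_mpoly p v = 0) \<or> (\<forall>q\<in>T. eval_mpoly q v = 0)"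
    proof (rule ccontr)
      assume "\<not> ?thesis"
      then obtain p q where pq: "p \<in> S" "q \<in> T" "eval_mpoly p v \<noteq> 0" "eval_mpoly q v \<noteq> 0"
        by blast
      then have "p * q \<in> ?ST" by blast
      then have "eval_mpoly (p * q) v = 0" using L v by (simp add: zero_locus_def)
      then show False using pq by (simp add: eval_mpoly_mult)
    qed
    then show "L \<in> Y \<union> Z"
    proof
      assume "\<forall>p\<in>S. eval_mpoly p v = 0"
      then have "L \<in> Y" using vanish S Lp by (simp add: zero_locus_def)
      then show ?thesis ..
    next
      assume "\<forall>q\<in>T. eval_mpoly q v = 0"
      then have "L \<in> Z" using vanish T Lp by (simp add: zero_locus_def)
      then show ?thesis ..
    qed
  qed
  with hom show ?thesis unfolding proj_closed_def by (intro exI conjI)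
qed

lemma proj_closed_INT:
  assumes "\<And>Z. Z \<in> \<Z> \<Longrightarrow> proj_closed Z"
  shows "proj_closed (proj_space \<inter> \<Inter>\<Z>)"
proof -
  obtain S where S: "\<And>Z. Z \<in> \<Z> \<Longrightarrow> (\<forall>p\<in>S Z. \<exists>d. homogeneous d p) \<and> Z = zero_locus (S Z)"
    using assms unfolding proj_closed_def by metis
  have "L \<in> proj_space \<inter> \<Inter>\<Z> \<longleftrightarrow> L \<in> zero_locus (\<Union>(S ` \<Z>))" for L
  proof -
    have "L \<in> proj_space \<inter> \<Inter>\<Z> \<longleftrightarrow> L \<in> proj_space \<and> (\<forall>Z\<in>\<Z>. L \<in> zero_locus (S Z))"
      using S by blast
    also have "\<dots> \<longleftrightarrow> L \<in> zero_locus (\<Union>(S ` \<Z>))"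
      by (auto simp: zero_locus_def)
    finally show ?thesis .
  qed
  then have "proj_space \<inter> \<Inter>\<Z> = zero_locus (\<Union>(S ` \<Z>))" by blast
  moreover have "\<forall>p\<in>\<Union>(S ` \<Z>). \<exists>d. homogeneous d p" using S by blast
  ultimately show ?thesis unfolding proj_closed_def by blast
qed

lemma istopology_zariski:
  "istopology (\<lambda>U :: ('k::field, 'n::finite) point set.
     U \<subseteq> proj_space \<and> proj_closed (proj_space - U))"
  unfolding istopology_def
proof (intro conjI allI impI)
  fix U V :: "('k, 'n) point set"
  assume U: "U \<subseteq> proj_space \<and> proj_closed (proj_space - U)"
    and V: "V \<subseteq> proj_space \<and> proj_closed (proj_space - V)"
  from U show "U \<inter> V \<subseteq> proj_space" by blast
  show "proj_closed (proj_space - U \<inter> V)"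
    unfolding Diff_Int using U V by (intro proj_closed_Un) simp_all
next
  fix \<U> :: "('k, 'n) point set set"
  assume *: "\<forall>U\<in>\<U>. U \<subseteq> proj_space \<and> proj_closed (proj_space - U)"
  then show "\<Union>\<U> \<subseteq> proj_space" by blast
  have "proj_space - \<Union>\<U> = proj_space \<inter> \<Inter>((\<lambda>U. proj_space - U) ` \<U>)" by auto
  moreover have "proj_closed (proj_space \<inter> \<Inter>((\<lambda>U. proj_space - U) ` \<U>))"
    by (rule proj_closed_INT) (use * in blast)
  ultimately show "proj_closed (proj_space - \<Union>\<U>)" by (simp only:)
qed

lemma openin_zariski:
  "openin zariski U \<longleftrightarrow> U \<subseteq> proj_space \<and> proj_closed (proj_space - U)"
  by (simp add: zariski_def topology_inverse'[OF istopology_zariski])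

lemma topspace_zariski:
  "topspace (zariski :: ('k::field, 'n::finite) point topology) = proj_space"
proof -
  have "L \<notin> zero_locus {1}" for L :: "('k, 'n) point"
    unfolding zero_locus_def using proj_space_nonzero by force
  then have "({} :: ('k, 'n) point set) = zero_locus {1}" by blast
  moreover have "\<forall>p\<in>{1 :: ('n, 'k) mpoly}. \<exists>d. homogeneous d p"
    using homogeneous_one by blast
  ultimately have "proj_closed ({} :: ('k, 'n) point set)"
    unfolding proj_closed_def by blast
  then have "openin zariski (proj_space :: ('k, 'n) point set)" by (simp add: openin_zariski)
  then have "proj_space \<subseteq> topspace (zariski :: ('k, 'n) point topology)" by (rule openin_subset)
  moreover have "topspace zariski \<subseteq> (proj_space :: ('k, 'n) point set)"
    using openin_topspace[of "zariski :: ('k, 'n) point topology"] unfolding openin_zariski ..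
  ultimately show ?thesis by blast
qed

lemma closedin_zariski: "closedin zariski Z \<longleftrightarrow> proj_closed Z"
proof -
  have "Z \<subseteq> proj_space" if "proj_closed Z"
    using that unfolding proj_closed_def zero_locus_def by blast
  moreover have "closedin zariski Z \<longleftrightarrow> Z \<subseteq> proj_space \<and> proj_closed (proj_space - (proj_space - Z))"
    unfolding closedin_def topspace_zariski openin_zariski by blast
  moreover have "proj_space - (proj_space - Z) = Z" if "Z \<subseteq> proj_space"
    using that by blast
  ultimately show ?thesis by metis
qed


section \<open>Regular functions and morphisms\<close>

text \<open>
  These are the classical notions for varieties over an algebraically closed field. They are
  meant for locally closed subsets \<open>X\<close> and \<open>Y\<close> of projective spaces, with the induced topology;
  values of the functions outside these sets are irrelevant.
\<close>

definition regular_on :: "('k::field, 'n::finite) point set \<Rightarrow> (('k, 'n) point \<Rightarrow> 'k) \<Rightarrow> bool" where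
  "regular_on X \<phi> \<longleftrightarrow>
     (\<forall>P\<in>X. \<exists>U d g h. openin (subtopology zariski X) U \<and> P \<in> U \<and>
        homogeneous d g \<and> homogeneous d h \<and>
        (\<forall>L\<in>U. \<forall>v\<in>L - {0}. eval_mpoly h v \<noteq> 0 \<and> \<phi> L = eval_mpoly g v / eval_mpoly h v))"

definition variety_morphism ::
  "('k::field, 'n::finite) point set \<Rightarrow> ('k, 'm::finite) point set \<Rightarrow>
    (('k, 'n) point \<Rightarrow> ('k, 'm) point) \<Rightarrow> bool" where
  "variety_morphism X Y f \<longleftrightarrow>
     continuous_map (subtopology zariski X) (subtopology zariski Y) f \<and>
     (\<forall>V \<phi>. openin (subtopology zariski Y) V \<and> regular_on V \<phi> \<longrightarrow>
        regular_on {x \<in> X. f x \<in> V} (\<phi> \<circ> f))"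

definition variety_isomorphism ::
  "('k::field, 'n::finite) point set \<Rightarrow> ('k, 'm::finite) point set \<Rightarrow>
    (('k, 'n) point \<Rightarrow> ('k, 'm) point) \<Rightarrow> bool" where
  "variety_isomorphism X Y f \<longleftrightarrow>
     variety_morphism X Y f \<and>
     (\<exists>g. variety_morphism Y X g \<and> (\<forall>x\<in>X. g (f x) = x) \<and> (\<forall>y\<in>Y. f (g y) = y))"

definition isomorphic_varieties ::
  "('k::field, 'n::finite) point set \<Rightarrow> ('k, 'm::finite) point set \<Rightarrow> bool" where
  "isomorphic_varieties X Y \<longleftrightarrow> (\<exists>f. variety_isomorphism X Y f)"


section \<open>Irreducible quadric hypersurfaces\<close>

definition irreducible_quadric :: "('k::field, 'n::finite) point set \<Rightarrow> bool" where
  "irreducible_quadric H \<longleftrightarrow>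
     (\<exists>q :: ('n, 'k) mpoly. irreducible q \<and> homogeneous 2 q \<and> H = zero_locus {q})"

end

theory Submission
  imports Defs
begin

text \<open>
  Over an algebraically closed field every irreducible quadric is, in suitable coordinates, the zero
  locus of \<open>q\<^sub>r = x\<^sub>0 x\<^sub>1 + x\<^sub>2 x\<^sub>3 + \<dots>\<close>, ending in a square if \<open>r\<close> is odd, with
  \<open>r \<ge> 3\<close> variables, so it suffices to recover \<open>r\<close> from the complement. Polynomial rings are
  factorial, hence an isomorphism of the complements of \<open>q\<^sub>r\<close> and \<open>q\<^sub>s\<close> and its inverse are given by
  tuples of polynomials \<open>F\<close>, \<open>G\<close> without common zeros there. A polynomial without zeros off
  \<open>q\<^sub>r = 0\<close> is a multiple of a power of \<open>q\<^sub>r\<close>; after scaling, \<open>q\<^sub>s (F x) = q\<^sub>r x ^ D\<close> and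
  \<open>G (F x) = l q\<^sub>r x ^ m x\<close>. So \<open>F\<close> and \<open>G\<close> identify the affine quadrics \<open>q\<^sub>r = 1\<close> and \<open>q\<^sub>s = 1\<close>.
  All this involves finitely many coefficients, which can be specialized to a finite field, and
  there the number of points of \<open>q\<^sub>r = 1\<close> determines \<open>r\<close>, except for odd \<open>r\<close> in characteristic 2,
  where points over the dual numbers, sensitive to the singular points of \<open>q\<^sub>r = 1\<close>, are counted.
\<close>


section \<open>Unique factorization is inherited by polynomial rings\<close>

text \<open>Write \<open>Q\<close> for the order of the residue field and \<open>N\<close> for
  \<open>n + 1\<close>. The equation \<open>q = 1\<close> of rank \<open>r\<close> has Q^(N-1) + e
  Q^(N-1 - r div 2) solutions, where e = -1 for even \<open>r\<close>, and e + 1 is the number of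
  square roots of 1 for odd \<open>r\<close>. So the sign of e reveals the parity and the exponent
  reveals the rank, except that e = 0 for odd rank in characteristic 2. This is the characteristic
  of the residue field, which can be 2 although that of \<open>k\<close> is 0. Identities between
  polynomials never have to be reduced modulo an ideal: points over the residue field are
  represented by tuples from a finitely generated subring \<open>R\<close> of \<open>k\<close>,
  where the identities hold, and only the resulting values are reduced. For dual numbers the
  representatives lie in \<open>R[X]\<close>, and the identities pass from \<open>k\<close> to
  \<open>k[X]\<close> by evaluation. The scalar \<open>l\<close> has to stay invertible, and this
  dictates the element that the specialization must not kill. Each direction of the isomorphism
  yields only an injection of point sets; two injections give equal counts.\<close>

definition ring_set :: "'a::comm_ring_1 set \<Rightarrow> bool" where
  "ring_set A \<longleftrightarrow> 1 \<in> A \<and> (\<forall>a\<in>A. \<forall>b\<in>A. a - b \<in> A \<and> a * b \<in> A)"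

lemma ring_setD:
  assumes "ring_set A"
  shows "0 \<in> A" "1 \<in> A" "a \<in> A \<Longrightarrow> b \<in> A \<Longrightarrow> a - b \<in> A" "a \<in> A \<Longrightarrow> b \<in> A \<Longrightarrow> a * b \<in> A"
    "a \<in> A \<Longrightarrow> - a \<in> A" "a \<in> A \<Longrightarrow> b \<in> A \<Longrightarrow> a + b \<in> A"
proof -
  have *: "1 \<in> A" "\<And>a b. a \<in> A \<Longrightarrow> b \<in> A \<Longrightarrow> a - b \<in> A" "\<And>a b. a \<in> A \<Longrightarrow> b \<in> A \<Longrightarrow> a * b \<in> A"
    using assms by (auto simp: ring_set_def)
  show 0: "0 \<in> A" using *(2)[OF *(1) *(1)] by simp
  show neg: "- a \<in> A" if "a \<in> A" for a using *(2)[OF 0 that] by simp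
  show "a + b \<in> A" if "a \<in> A" "b \<in> A" using *(2)[OF that(1) neg[OF that(2)]] by simp
qed (use assms in \<open>auto simp: ring_set_def\<close>)

lemma ring_set_sum:
  assumes "ring_set A" "\<And>i. i \<in> I \<Longrightarrow> f i \<in> A"
  shows "(\<Sum>i\<in>I. f i) \<in> A"
  using assms(2) by (induction I rule: infinite_finite_induct) (auto intro: ring_setD[OF assms(1)])

lemma ring_set_power:
  assumes "ring_set A" "a \<in> A"
  shows "a ^ n \<in> A"
  using assms(2) by (induction n) (auto intro: ring_setD[OF assms(1)])

definition polys :: "'a::comm_ring_1 set \<Rightarrow> 'a poly set" where
  "polys A = {p. \<forall>i. coeff p i \<in> A}"

lemma polys_coeff: "p \<in> polys A \<Longrightarrow> coeff p i \<in> A"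
  by (simp add: polys_def)

lemma ring_set_polys:
  assumes "ring_set A"
  shows "ring_set (polys A)"
  unfolding ring_set_def polys_def
  by (auto simp: coeff_1 coeff_mult intro!: ring_set_sum[OF assms] ring_setD[OF assms])

lemma pCons_polys [simp]:
  "pCons c p \<in> polys A \<longleftrightarrow> c \<in> A \<and> p \<in> polys A"
  by (auto simp: polys_def coeff_pCons split: nat.splits)

lemma zero_polys: "ring_set A \<Longrightarrow> 0 \<in> polys A"
  by (simp add: polys_def ring_setD)

lemma smult_polys: "ring_set A \<Longrightarrow> c \<in> A \<Longrightarrow> p \<in> polys A \<Longrightarrow> smult c p \<in> polys A"
  by (simp add: polys_def ring_setD)

lemma monom_polys: "ring_set A \<Longrightarrow> c \<in> A \<Longrightarrow> monom c n \<in> polys A"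
  by (simp add: polys_def ring_setD)

text \<open>Over a ring without inverses a leading term is cancelled after multiplying by the
  leading coefficient of \<open>G\<close>. The exponent \<open>j\<close> counts these
  multiplications, and everything stays in \<open>A\<close>.\<close>

lemma pseudo_division:
  fixes G P :: "'a::idom poly"
  assumes A: "ring_set A" and G: "G \<in> polys A" "G \<noteq> 0" and P: "P \<in> polys A"
  obtains j W T where "W \<in> polys A" "T \<in> polys A" "smult (lead_coeff G ^ j) P = G * W + T"
    "T = 0 \<or> degree T < degree G"
proof -
  note pA = ring_set_polys[OF A]
  have "\<exists>j W T. W \<in> polys A \<and> T \<in> polys A \<and> smult (lead_coeff G ^ j) P = G * W + T \<and>
    (T = 0 \<or> degree T < degree G)"
    using P
  proof (induction "degree P" arbitrary: P rule: less_induct)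
    case less
    show ?case
    proof (cases "P = 0 \<or> degree P < degree G")
      case True
      then show ?thesis
        by (intro exI[of _ 0] exI[of _ P]) (auto simp: less.prems zero_polys A)
    next
      case False
      let ?M = "monom (lead_coeff P) (degree P - degree G)"
      define P' where "P' = smult (lead_coeff G) P - G * ?M"
      have M: "?M \<in> polys A" by (intro monom_polys A polys_coeff less.prems)
      have P'A: "P' \<in> polys A" unfolding P'_def
        by (intro ring_setD[OF pA] smult_polys[OF A] less.prems G M polys_coeff)
      show ?thesis
      proof (cases "P' = 0")
        case True
        then have "smult (lead_coeff G ^ 1) P = G * ?M + 0" by (simp add: P'_def)
        then show ?thesis using M zero_polys[OF A] by blast
      next
        case nz: False
        have "degree ?M = degree P - degree G" using False by (simp add: degree_monom_eq)
        moreover have "?M \<noteq> 0" using False by simp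
        ultimately have dM: "degree (G * ?M) = degree P"
          using False G by (simp add: degree_mult_eq)
        have "degree P' \<le> degree P" unfolding P'_def
          by (rule order.trans[OF degree_diff_le_max]) (use dM in auto)
        moreover have "coeff P' (degree P) = 0"
        proof -
          have "coeff (G * ?M) (degree P) = lead_coeff (G * ?M)" using dM by simp
          also have "\<dots> = lead_coeff G * lead_coeff P"
            unfolding lead_coeff_mult using False by (simp add: degree_monom_eq)
          finally show ?thesis by (simp add: P'_def)
        qed
        ultimately have "degree P' < degree P"
          using nz by (metis leading_coeff_0_iff le_neq_implies_less)
        from less.hyps[OF this P'A] obtain j W T where
          *: "W \<in> polys A" "T \<in> polys A" "smult (lead_coeff G ^ j) P' = G * W + T"
             "T = 0 \<or> degree T < degree G" by blast
        have "smult (lead_coeff G ^ Suc j) P = smult (lead_coeff G ^ j) (P' + G * ?M)"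
          by (simp add: P'_def mult.commute)
        also have "\<dots> = G * (W + smult (lead_coeff G ^ j) ?M) + T"
          by (simp add: smult_add_right *(3) algebra_simps)
        finally have "smult (lead_coeff G ^ Suc j) P = G * (W + smult (lead_coeff G ^ j) ?M) + T" .
        moreover have "W + smult (lead_coeff G ^ j) ?M \<in> polys A"
          by (intro ring_setD[OF pA] * smult_polys[OF A] M ring_set_power[OF A] polys_coeff G)
        ultimately show ?thesis using * by blast
      qed
    qed
  qed
  then show thesis using that by blast
qed

section \<open>Divisibility and prime factorization inside a subring\<close>

definition dvd_in :: "'a::comm_ring_1 set \<Rightarrow> 'a \<Rightarrow> 'a \<Rightarrow> bool" where
  "dvd_in A a b \<longleftrightarrow> (\<exists>c\<in>A. b = a * c)"

text \<open>Divisibility and primality are relative to a subset of an ambient type because the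
  induction over the number of variables runs through a chain of subrings of one type, and an
  element can be prime in one ring and not in another.\<close>

definition prime_in :: "'a::comm_ring_1 set \<Rightarrow> 'a \<Rightarrow> bool" where
  "prime_in A p \<longleftrightarrow> p \<in> A \<and> p \<noteq> 0 \<and> \<not> dvd_in A p 1 \<and>
     (\<forall>a\<in>A. \<forall>b\<in>A. dvd_in A p (a * b) \<longrightarrow> dvd_in A p a \<or> dvd_in A p b)"

text \<open>The factors are prime rather than merely irreducible, so uniqueness of factorization is
  built in. The number of factors, counted with multiplicity, serves as a measure for descent, both
  for contents and for the minimal representative of a morphism.\<close>

inductive prime_product :: "'a::comm_ring_1 set \<Rightarrow> nat \<Rightarrow> 'a \<Rightarrow> bool" for A where
  unit: "u \<in> A \<Longrightarrow> dvd_in A u 1 \<Longrightarrow> prime_product A 0 u"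
| prime: "prime_in A p \<Longrightarrow> prime_product A n a \<Longrightarrow> prime_product A (Suc n) (p * a)"

definition ufd_set :: "'a::comm_ring_1 set \<Rightarrow> bool" where
  "ufd_set A \<longleftrightarrow> ring_set A \<and> (\<forall>a\<in>A. a \<noteq> 0 \<longrightarrow> (\<exists>n. prime_product A n a))"

lemma prime_product_in: "ring_set A \<Longrightarrow> prime_product A n a \<Longrightarrow> a \<in> A"
  by (rotate_tac 1, induction rule: prime_product.induct) (auto simp: prime_in_def intro: ring_setD)

lemma prime_product_unit_mult:
  assumes A: "ring_set A" and "prime_product A n a" "u \<in> A" "dvd_in A u 1"
  shows "prime_product A n (u * a)"
  using assms(2)
proof induction
  case (unit v)
  from unit assms obtain u' v' where
    uv: "u' \<in> A" "1 = u * u'" "v' \<in> A" "1 = v * v'" by (auto simp: dvd_in_def)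
  have "1 = (u * v) * (u' * v')"
    using uv by (metis mult.assoc mult.commute mult.right_neutral)
  then have "dvd_in A (u * v) 1"
    unfolding dvd_in_def using ring_setD(4)[OF A uv(1,3)] by blast
  then show ?case
    using unit assms by (intro prime_product.unit ring_setD[OF A]) auto
next
  case (prime p n a)
  then show ?case using prime_product.prime[of A p n "u * a"] by (simp add: mult.left_commute)
qed

lemma prime_product_mult:
  assumes "ring_set A" "prime_product A m a" "prime_product A n b"
  shows "prime_product A (m + n) (a * b)"
  using assms(2)
  by induction (auto simp: mult.assoc intro: prime_product.prime prime_product_unit_mult assms)

lemma prime_product_nonzero:
  fixes a :: "'a::idom"
  shows "prime_product A n a \<Longrightarrow> a \<noteq> 0"
  by (induction rule: prime_product.induct) (auto simp: dvd_in_def prime_in_def)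

text \<open>A prime \<open>p\<close> dividing a product of primes is associated to one of the
  factors; cancelling it removes that factor and leaves the others up to a unit.\<close>

lemma prime_product_divide:
  fixes a :: "'a::idom"
  assumes A: "ring_set A" and "prime_product A n a" "prime_in A p" "b \<in> A" "a = p * b"
  obtains n' where "n = Suc n'" "prime_product A n' b"
proof -
  have "\<exists>n'. n = Suc n' \<and> prime_product A n' b"
    using assms(2-)
  proof (induction arbitrary: b rule: prime_product.induct)
    case (unit u)
    then have "dvd_in A p 1" using ring_setD(4)[OF A] unfolding dvd_in_def by (metis mult.assoc)
    then show ?case using unit by (simp add: prime_in_def)
  next
    case (prime q n a)
    have q: "q \<in> A" "q \<noteq> 0" and p: "p \<in> A" "p \<noteq> 0" using prime by (auto simp: prime_in_def)
    have aA: "a \<in> A" using prime_product_in[OF A] prime by blast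
    have "dvd_in A p (q * a)" using prime by (auto simp: dvd_in_def)
    then consider "dvd_in A p a" | "dvd_in A p q"
      using prime.prems(1) q aA unfolding prime_in_def by blast
    then show ?case
    proof cases
      case 1
      then obtain c where c: "c \<in> A" "a = p * c" by (auto simp: dvd_in_def)
      with prime.IH prime.prems obtain n' where n': "n = Suc n'" "prime_product A n' c" by blast
      have "p * (q * c) = p * b" using prime.prems c by (simp add: mult.left_commute)
      then have "b = q * c" using p by simp
      then show ?thesis using n' prime_product.prime[OF prime.hyps(1) n'(2)] by auto
    next
      \<comment> \<open>Here \<open>q = p * v\<close>. If \<open>q\<close> divided \<open>v\<close>,
        then \<open>p\<close> would be a unit; hence \<open>q\<close> divides \<open>p\<close>, and
        \<open>v\<close> is a unit that is absorbed into the remaining factors.\<close>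
      case 2
      then obtain v where v: "v \<in> A" "q = p * v" by (auto simp: dvd_in_def)
      then have "dvd_in A q (p * v)"
        unfolding dvd_in_def using ring_setD(2)[OF A] by (intro bexI[of _ 1]) auto
      moreover have "\<not> dvd_in A q v"
      proof
        assume "dvd_in A q v"
        then obtain w where w: "w \<in> A" "v = q * w" by (auto simp: dvd_in_def)
        then have "q * 1 = q * (p * w)" using v(2) by (simp add: mult.left_commute)
        then have "1 = p * w" using q by (metis mult_left_cancel)
        then have "dvd_in A p 1" using w by (auto simp: dvd_in_def)
        then show False using prime by (simp add: prime_in_def)
      qed
      ultimately have "dvd_in A q p" using prime.hyps(1) p v unfolding prime_in_def by blast
      then obtain w where w: "w \<in> A" "p = q * w" by (auto simp: dvd_in_def)
      then have "q * 1 = q * (v * w)" using v(2) by (metis mult.assoc mult.commute mult.right_neutral)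
      then have "1 = v * w" using q by (metis mult_left_cancel)
      then have "dvd_in A v 1" using w by (auto simp: dvd_in_def)
      then have "prime_product A n (v * a)" by (rule prime_product_unit_mult[OF A prime.hyps(2) v(1)])
      moreover have "p * (v * a) = p * b" using prime.prems v by (simp add: mult.assoc)
      then have "b = v * a" using p by simp
      ultimately show ?thesis by blast
    qed
  qed
  then show thesis using that by blast
qed

section \<open>Gauss's lemma and primitive polynomials\<close>

lemma dvd_in_const_polys:
  fixes p :: "'a::idom"
  assumes "ring_set A" "p \<noteq> 0"
  shows "dvd_in (polys A) [:p:] f \<longleftrightarrow> (\<forall>i. dvd_in A p (coeff f i))"
proof
  assume "dvd_in (polys A) [:p:] f"
  then show "\<forall>i. dvd_in A p (coeff f i)"
    by (auto simp: dvd_in_def polys_def)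
next
  assume "\<forall>i. dvd_in A p (coeff f i)"
  then show "dvd_in (polys A) [:p:] f"
  proof (induction f)
    case 0
    then show ?case by (auto simp: dvd_in_def intro: zero_polys[OF assms(1)] bexI[of _ 0])
  next
    case (pCons a f)
    have "dvd_in A p (coeff f i)" for i using pCons.prems[rule_format, of "Suc i"] by simp
    with pCons.IH obtain g where g: "g \<in> polys A" "f = [:p:] * g" by (auto simp: dvd_in_def)
    from pCons.prems[rule_format, of 0] obtain c where "c \<in> A" "a = p * c"
      by (auto simp: dvd_in_def)
    with g show ?case unfolding dvd_in_def by (intro bexI[of _ "pCons c g"]) auto
  qed
qed

text \<open>Gauss's lemma: look at the lowest coefficients not divisible by \<open>p\<close>.\<close>

lemma prime_in_polys:
  fixes p :: "'a::idom"
  assumes A: "ring_set A" and p: "prime_in A p"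
  shows "prime_in (polys A) [:p:]"
proof -
  have pA: "p \<in> A" "p \<noteq> 0" "\<not> dvd_in A p 1" using p by (auto simp: prime_in_def)
  have dvd0: "dvd_in A p 0"
    unfolding dvd_in_def using ring_setD(1)[OF A] by (intro bexI[of _ 0]) auto
  have dvd_add: "dvd_in A p (a + b)" if "dvd_in A p a" "dvd_in A p b" for a b
    using that ring_setD(6)[OF A] unfolding dvd_in_def by (metis distrib_left)
  have dvd_diff: "dvd_in A p (a - b)" if "dvd_in A p a" "dvd_in A p b" for a b
    using that ring_setD(3)[OF A] unfolding dvd_in_def by (metis right_diff_distrib)
  have dvd_mult: "dvd_in A p (a * b)" if "dvd_in A p a" "b \<in> A" for a b
    using that ring_setD(4)[OF A] unfolding dvd_in_def by (metis mult.assoc)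
  have dvd_sum: "dvd_in A p (sum f I)" if "\<And>i. i \<in> I \<Longrightarrow> dvd_in A p (f i)" for f and I :: "nat set"
    using that by (induction I rule: infinite_finite_induct) (auto intro: dvd_add dvd0)
  show ?thesis
    unfolding prime_in_def
  proof (intro conjI ballI impI)
    show "[:p:] \<in> polys A" using pA by (simp add: zero_polys[OF A])
    show "[:p:] \<noteq> 0" using pA by simp
    show "\<not> dvd_in (polys A) [:p:] 1"
      unfolding dvd_in_const_polys[OF A pA(2)]
    proof
      assume "\<forall>i. dvd_in A p (coeff 1 i)"
      from spec[OF this, of 0] show False using pA by simp
    qed
    fix f g assume fg: "f \<in> polys A" "g \<in> polys A" and d: "dvd_in (polys A) [:p:] (f * g)"
    show "dvd_in (polys A) [:p:] f \<or> dvd_in (polys A) [:p:] g"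
    proof (rule ccontr)
      assume "\<not> ?thesis"
      then have ex: "\<exists>i. \<not> dvd_in A p (coeff f i)" "\<exists>i. \<not> dvd_in A p (coeff g i)"
        by (auto simp: dvd_in_const_polys[OF A pA(2)])
      define i where "i = (LEAST i. \<not> dvd_in A p (coeff f i))"
      define j where "j = (LEAST i. \<not> dvd_in A p (coeff g i))"
      have i: "\<not> dvd_in A p (coeff f i)" "\<And>l. l < i \<Longrightarrow> dvd_in A p (coeff f l)"
        unfolding i_def using LeastI_ex[OF ex(1)] not_less_Least by blast+
      have j: "\<not> dvd_in A p (coeff g j)" "\<And>l. l < j \<Longrightarrow> dvd_in A p (coeff g l)"
        unfolding j_def using LeastI_ex[OF ex(2)] not_less_Least by blast+
      have "coeff (f * g) (i + j) = (\<Sum>l\<le>i + j. coeff f l * coeff g (i + j - l))"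
        by (rule coeff_mult)
      also have "\<dots> = coeff f i * coeff g j + (\<Sum>l\<in>{..i + j} - {i}. coeff f l * coeff g (i + j - l))"
        by (subst sum.remove[of _ i]) auto
      finally have "coeff f i * coeff g j = coeff (f * g) (i + j) -
          (\<Sum>l\<in>{..i + j} - {i}. coeff f l * coeff g (i + j - l))" by simp
      moreover have "dvd_in A p (coeff (f * g) (i + j))"
        using d by (simp add: dvd_in_const_polys[OF A pA(2)])
      moreover have "dvd_in A p (\<Sum>l\<in>{..i + j} - {i}. coeff f l * coeff g (i + j - l))"
      proof (rule dvd_sum)
        fix l assume "l \<in> {..i + j} - {i}"
        then consider "l < i" | "i + j - l < j" by fastforce
        then show "dvd_in A p (coeff f l * coeff g (i + j - l))"
        proof cases
          case 1
          then show ?thesis by (intro dvd_mult i polys_coeff fg)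
        next
          case 2
          then show ?thesis by (subst mult.commute) (intro dvd_mult j polys_coeff fg)
        qed
      qed
      ultimately have "dvd_in A p (coeff f i * coeff g j)" using dvd_diff by metis
      with p i(1) j(1) fg show False unfolding prime_in_def by (blast intro: polys_coeff)
    qed
  qed
qed

text \<open>In a factorial ring a nonzero polynomial has unit content exactly if no prime constant
  divides it. This form fits Gauss's lemma directly and avoids greatest common divisors of
  coefficients.\<close>

definition primitive_in :: "'a::comm_ring_1 set \<Rightarrow> 'a poly \<Rightarrow> bool" where
  "primitive_in A f \<longleftrightarrow> (\<forall>p. prime_in A p \<longrightarrow> \<not> dvd_in (polys A) [:p:] f)"

text \<open>Divisibility by a primitive \<open>f\<close> descends from the fraction field to
  \<open>A\<close>: the prime factors of the denominator \<open>c\<close> are removed one by one,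
  since each of them divides \<open>f * t\<close> and hence, by Gauss's lemma,
  \<open>t\<close>.\<close>

lemma primitive_cancel:
  fixes c :: "'a::idom"
  assumes A: "ring_set A" and c: "prime_product A n c" and f: "primitive_in A f" "f \<in> polys A"
    and "b \<in> polys A" "t \<in> polys A" "smult c b = f * t"
  shows "dvd_in (polys A) f b"
  using c assms(5-)
proof (induction arbitrary: b t rule: prime_product.induct)
  case (unit u)
  then obtain u' where u': "u' \<in> A" "u * u' = 1" by (auto simp: dvd_in_def)
  have "smult u' (smult u b) = smult u' (f * t)" by (simp only: unit.prems)
  then have "b = f * smult u' t" using u' by (simp add: mult.commute)
  then show ?case using smult_polys[OF A u'(1) unit.prems(2)] unfolding dvd_in_def by blast
next
  case (prime p n a)
  have "prime_in (polys A) [:p:]" by (rule prime_in_polys[OF A prime.hyps(1)])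
  moreover have aA: "a \<in> A" using prime_product_in[OF A] prime by blast
  have "f * t = [:p:] * smult a b" using prime.prems(3) by (simp add: mult.commute[of a p])
  then have "dvd_in (polys A) [:p:] (f * t)"
    unfolding dvd_in_def using smult_polys[OF A aA prime.prems(1)] by blast
  ultimately have "dvd_in (polys A) [:p:] t"
    using f prime.hyps(1) prime.prems unfolding prime_in_def primitive_in_def by blast
  then obtain t' where t': "t' \<in> polys A" "t = smult p t'" by (auto simp: dvd_in_def)
  have "p \<noteq> 0" using prime.hyps by (simp add: prime_in_def)
  moreover have "smult p (smult a b) = smult p (f * t')" using prime.prems t' by simp
  ultimately have "smult a b = f * t'" using smult_cancel by metis
  then show ?case using prime.IH prime.prems t' by blast
qed

text \<open>Prime constants are split off as long as one divides. Each of them removes a prime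
  factor from the leading coefficient, whose number of factors bounds the process.\<close>

lemma primitive_part:
  fixes f :: "'a::idom poly"
  assumes A: "ufd_set A" and f: "f \<in> polys A" "f \<noteq> 0"
  obtains c n g where "prime_product A n c" "g \<in> polys A" "primitive_in A g" "f = smult c g"
proof -
  have R: "ring_set A" using A by (simp add: ufd_set_def)
  have one: "prime_product A 0 1" by (rule prime_product.unit)
    (auto simp: dvd_in_def intro: ring_setD[OF R] bexI[of _ 1])
  obtain n where "prime_product A n (lead_coeff f)"
    using A f unfolding ufd_set_def by (meson leading_coeff_0_iff polys_coeff)
  then have "\<exists>c m g. prime_product A m c \<and> g \<in> polys A \<and> primitive_in A g \<and> f = smult c g"
    using f
  proof (induction n arbitrary: f rule: less_induct)
    case (less n)
    show ?case
    proof (cases "primitive_in A f")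
      case True
      then show ?thesis using one less by (intro exI[of _ 1] exI[of _ 0] exI[of _ f]) auto
    next
      case False
      then obtain p where p: "prime_in A p" "dvd_in (polys A) [:p:] f"
        by (auto simp: primitive_in_def)
      then obtain g where g: "g \<in> polys A" "f = smult p g" by (auto simp: dvd_in_def)
      have "lead_coeff f = p * lead_coeff g" by (simp add: g)
      then obtain n' where n': "n = Suc n'" "prime_product A n' (lead_coeff g)"
        using prime_product_divide[OF R less.prems(1) p(1) polys_coeff[OF g(1)]] by blast
      with less.IH[of n' g] g less.prems obtain c m g' where
        "prime_product A m c" "g' \<in> polys A" "primitive_in A g'" "g = smult c g'" by auto
      then show ?thesis using prime_product.prime[OF p(1)] g
        by (intro exI[of _ "p * c"] exI[of _ "Suc m"] exI[of _ g']) auto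
    qed
  qed
  then show thesis using that by blast
qed

lemma const_prime_product_polys:
  fixes a :: "'a::idom"
  assumes A: "ring_set A" and "prime_product A n a"
  shows "prime_product (polys A) n [:a:]"
  using assms(2)
proof induction
  case (unit u)
  then obtain v where "v \<in> A" "1 = u * v" by (auto simp: dvd_in_def)
  then have "1 = [:u:] * [:v:]" "[:v:] \<in> polys A" by (auto simp: zero_polys[OF A] one_pCons mult.commute)
  then have "dvd_in (polys A) [:u:] 1" unfolding dvd_in_def by blast
  then show ?case using unit by (intro prime_product.unit) (auto simp: zero_polys[OF A])
next
  case (prime p n a)
  then show ?case using prime_product.prime[OF prime_in_polys[OF A prime.hyps(1)] prime.IH]
    by (simp add: mult.commute)
qed

text \<open>The generator \<open>G\<close> of the ideal \<open>(P, a)\<close> over the fraction field is either constant or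
  associated to \<open>P\<close>.\<close>

lemma irreducible_primitive_prime:
  fixes P :: "'a::idom poly"
  assumes U: "ufd_set A" and P: "P \<in> polys A" "degree P > 0" "primitive_in A P"
    and irr: "\<And>S T. S \<in> polys A \<Longrightarrow> T \<in> polys A \<Longrightarrow> P = S * T \<Longrightarrow> degree S = 0 \<or> degree T = 0"
  shows "prime_in (polys A) P"
proof -
  have A: "ring_set A" using U by (simp add: ufd_set_def)
  note pA = ring_set_polys[OF A]
  have P0: "P \<noteq> 0" using P by auto
  have nonunit: "\<not> dvd_in (polys A) P 1"
  proof
    assume "dvd_in (polys A) P 1"
    then obtain c where c: "1 = P * c" by (auto simp: dvd_in_def)
    then have "c \<noteq> 0" by auto
    then have "degree (P * c) = degree P + degree c" using P0 by (simp add: degree_mult_eq)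
    then show False using c P(2) by (metis add_is_0 degree_1 less_numeral_extra(3))
  qed
  have "dvd_in (polys A) P b" if ab: "a \<in> polys A" "b \<in> polys A" "dvd_in (polys A) P (a * b)"
    and na: "\<not> dvd_in (polys A) P a" for a b
  proof -
    define I where "I = {S * a + T * P | S T. S \<in> polys A \<and> T \<in> polys A}"
    have IA: "I \<subseteq> polys A" unfolding I_def
      by (auto intro!: ring_setD[OF pA] ab P)
    have aI: "a \<in> I" "P \<in> I"
      unfolding I_def using ring_setD(1,2)[OF pA] by force+
    have comb: "smult c x - y * w \<in> I" if "x \<in> I" "y \<in> I" "c \<in> A" "w \<in> polys A" for x y c w
    proof -
      obtain S T S' T' where ST: "x = S * a + T * P" "y = S' * a + T' * P"
        "S \<in> polys A" "T \<in> polys A" "S' \<in> polys A" "T' \<in> polys A"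
        using \<open>x \<in> I\<close> \<open>y \<in> I\<close> unfolding I_def by blast
      have "smult c x - y * w = (smult c S - S' * w) * a + (smult c T - T' * w) * P"
        by (simp add: ST algebra_simps smult_add_right)
      moreover have "smult c S - S' * w \<in> polys A" "smult c T - T' * w \<in> polys A"
        using ST that by (auto intro!: ring_setD[OF pA] smult_polys[OF A])
      ultimately show ?thesis unfolding I_def by blast
    qed
    define d where "d = (LEAST d. \<exists>G\<in>I. G \<noteq> 0 \<and> degree G = d)"
    have "\<exists>d. \<exists>G\<in>I. G \<noteq> 0 \<and> degree G = d" using aI(2) P0 by blast
    from LeastI_ex[OF this] obtain G where G: "G \<in> I" "G \<noteq> 0" "degree G = d"
      unfolding d_def by blast
    have dmin: "d \<le> degree x" if "x \<in> I" "x \<noteq> 0" for x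
      unfolding d_def using that by (intro Least_le) auto
    have GA: "G \<in> polys A" using G IA by blast
    have div: "\<exists>j W. W \<in> polys A \<and> smult (lead_coeff G ^ j) x = G * W" if "x \<in> I" for x
    proof -
      have x: "x \<in> polys A" using that IA by blast
      obtain j W T where W: "W \<in> polys A" "T \<in> polys A"
        "smult (lead_coeff G ^ j) x = G * W + T" "T = 0 \<or> degree T < degree G"
        using pseudo_division[OF A GA G(2) x] .
      have "smult (lead_coeff G ^ j) x - G * W \<in> I"
        by (intro comb that G W ring_set_power[OF A] polys_coeff GA)
      then have "T \<in> I" using W(3) by simp
      then have "T = 0" using W(4) dmin G(3) by fastforce
      then show ?thesis using W by auto
    qed
    obtain c n G0 where G0: "prime_product A n c" "G0 \<in> polys A" "primitive_in A G0" "G = smult c G0"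
      using primitive_part[OF U GA G(2)] .
    have G0dvd: "dvd_in (polys A) G0 x" if xI: "x \<in> I" for x
    proof -
      obtain j W where W: "W \<in> polys A" "smult (lead_coeff G ^ j) x = G * W" using div[OF xI] by blast
      have "lead_coeff G ^ j \<in> A" by (intro ring_set_power[OF A] polys_coeff GA)
      moreover have "lead_coeff G ^ j \<noteq> 0"
        using G(2) by (metis leading_coeff_0_iff power_not_zero)
      ultimately obtain k where "prime_product A k (lead_coeff G ^ j)"
        using U by (auto simp: ufd_set_def)
      moreover have "smult (lead_coeff G ^ j) x = G0 * smult c W" using W G0 by simp
      moreover have "smult c W \<in> polys A"
        by (intro smult_polys[OF A] W prime_product_in[OF A G0(1)])
      ultimately show ?thesis using primitive_cancel[OF A _ G0(3,2)] xI IA by blast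
    qed
    obtain W where W: "W \<in> polys A" "P = G0 * W" using G0dvd[OF aI(2)] by (auto simp: dvd_in_def)
    from irr[OF G0(2) W] show ?thesis
    proof
      assume "degree W = 0"
      then obtain w where w: "W = [:w:]" by (metis degree_eq_zeroE)
      have wA: "w \<in> A" "w \<noteq> 0" using W P0 w by auto
      then obtain k where k: "prime_product A k w" using U by (auto simp: ufd_set_def)
      \<comment> \<open>\<open>W\<close> is the constant \<open>w\<close>. A prime factor of
        \<open>w\<close> would be a prime constant dividing the primitive polynomial
        \<open>P\<close>, so \<open>w\<close> is a unit and \<open>G0\<close> is associated to
        \<open>P\<close>.\<close>
      have "dvd_in A w 1" using k
      proof cases
        case (prime p n b)
        then have "dvd_in (polys A) [:p:] P"
          unfolding dvd_in_def using W w prime_product_in[OF A prime(4)]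
          by (intro bexI[of _ "smult b G0"]) (auto intro: smult_polys[OF A] G0 simp: mult.commute)
        then show ?thesis using P(3) prime by (auto simp: primitive_in_def)
      qed
      then obtain w' where w': "w' \<in> A" "w * w' = 1" by (auto simp: dvd_in_def)
      have GP: "G0 = P * [:w':]" using W w w' by (simp add: mult.commute)
      obtain W' where W': "W' \<in> polys A" "a = G0 * W'" using G0dvd[OF aI(1)] by (auto simp: dvd_in_def)
      have "a = P * ([:w':] * W')" using W' GP by (metis mult.assoc)
      moreover have "[:w':] * W' \<in> polys A" using W' w' by (auto intro: smult_polys[OF A])
      ultimately have "dvd_in (polys A) P a" unfolding dvd_in_def by blast
      then show ?thesis using na by simp
    next
      assume "degree G0 = 0"
      then obtain g where g: "G = [:g:]" using G0 by (metis degree_eq_zeroE degree_smult_eq)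
      have gA: "g \<in> A" "g \<noteq> 0" using GA G g by auto
      then obtain k where k: "prime_product A k g" using U by (auto simp: ufd_set_def)
      obtain S T where ST: "S \<in> polys A" "T \<in> polys A" "G = S * a + T * P"
        using G unfolding I_def by blast
      obtain e where e: "e \<in> polys A" "a * b = P * e" using ab by (auto simp: dvd_in_def)
      \<comment> \<open>Multiplying the representation of the constant \<open>G\<close> in the ideal
        by \<open>b\<close> shows that \<open>P\<close> divides \<open>smult g b\<close>;
        primitivity of \<open>P\<close> removes \<open>g\<close>.\<close>
      have "smult g b = G * b" using g by simp
      also have "\<dots> = S * (a * b) + T * P * b" using ST by (simp add: algebra_simps)
      also have "\<dots> = P * (S * e + T * b)" by (simp add: e algebra_simps)
      finally have "smult g b = P * (S * e + T * b)" .
      moreover have "S * e + T * b \<in> polys A" by (intro ring_setD[OF pA] ST e ab)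
      ultimately show ?thesis using primitive_cancel[OF A k P(3,1)] ab by blast
    qed
  qed
  then show ?thesis using P P0 nonunit unfolding prime_in_def by blast
qed

text \<open>The content is a product of constant primes. A primitive polynomial of positive degree
  is either prime or splits into two factors of smaller positive degree, to which the induction on
  the degree applies.\<close>

theorem ufd_set_polys:
  fixes A :: "'a::idom set"
  assumes U: "ufd_set A"
  shows "ufd_set (polys A)"
proof -
  have A: "ring_set A" using U by (simp add: ufd_set_def)
  note pA = ring_set_polys[OF A]
  have "\<exists>n. prime_product (polys A) n f" if "f \<in> polys A" "f \<noteq> 0" for f
    using that
  proof (induction "degree f" arbitrary: f rule: less_induct)
    case less
    obtain c n g where g: "prime_product A n c" "g \<in> polys A" "primitive_in A g" "f = smult c g"
      using primitive_part[OF U less.prems] .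
    have c: "prime_product (polys A) n [:c:]" by (rule const_prime_product_polys[OF A g(1)])
    have fc: "f = [:c:] * g" using g by simp
    have c0: "c \<noteq> 0" using prime_product_nonzero[OF g(1)] .
    have "\<exists>m. prime_product (polys A) m g"
    proof (cases "degree g = 0")
      case True
      then obtain a where a: "g = [:a:]" by (metis degree_eq_zeroE)
      then have "a \<in> A" "a \<noteq> 0" using g less.prems by auto
      then show ?thesis using U const_prime_product_polys[OF A] a unfolding ufd_set_def by blast
    next
      case False
      show ?thesis
      proof (cases "\<exists>S T. S \<in> polys A \<and> T \<in> polys A \<and> g = S * T \<and> degree S > 0 \<and> degree T > 0")
        case True
        then obtain S T where ST: "S \<in> polys A" "T \<in> polys A" "g = S * T" "degree S > 0" "degree T > 0"
          by blast
        then have "S \<noteq> 0" "T \<noteq> 0" by auto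
        then have "degree S < degree f" "degree T < degree f"
          using ST g(4) c0 by (auto simp: degree_mult_eq)
        with less.hyps ST \<open>S \<noteq> 0\<close> \<open>T \<noteq> 0\<close> obtain k l where
          "prime_product (polys A) k S" "prime_product (polys A) l T" by blast
        then show ?thesis using prime_product_mult[OF pA] ST(3) by blast
      next
        case irr: False
        have "prime_in (polys A) g"
          by (rule irreducible_primitive_prime[OF U g(2) _ g(3)]) (use irr False in auto)
        moreover have "prime_product (polys A) 0 1"
          by (rule prime_product.unit) (auto simp: dvd_in_def intro: ring_setD[OF pA] bexI[of _ 1])
        ultimately show ?thesis using prime_product.prime by fastforce
      qed
    qed
    then show ?case using prime_product_mult[OF pA c] fc by blast
  qed
  then show ?thesis using pA by (simp add: ufd_set_def)
qed


section \<open>Finite residue fields of finitely generated rings\<close>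

definition ideal_in :: "'a::comm_ring_1 set \<Rightarrow> 'a set \<Rightarrow> bool" where
  "ideal_in R I \<longleftrightarrow> I \<subseteq> R \<and> 0 \<in> I \<and> (\<forall>a\<in>I. \<forall>b\<in>I. a - b \<in> I) \<and> (\<forall>a\<in>I. \<forall>r\<in>R. r * a \<in> I)"

lemma ideal_inD:
  assumes "ideal_in R I"
  shows "a \<in> I \<Longrightarrow> a \<in> R" "0 \<in> I" "a \<in> I \<Longrightarrow> b \<in> I \<Longrightarrow> a - b \<in> I"
    "a \<in> I \<Longrightarrow> r \<in> R \<Longrightarrow> r * a \<in> I" "a \<in> I \<Longrightarrow> r \<in> R \<Longrightarrow> a * r \<in> I"
    "a \<in> I \<Longrightarrow> - a \<in> I" "a \<in> I \<Longrightarrow> b \<in> I \<Longrightarrow> a + b \<in> I"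
proof -
  show 0: "0 \<in> I" and diff: "a \<in> I \<Longrightarrow> b \<in> I \<Longrightarrow> a - b \<in> I" for a b
    using assms by (auto simp: ideal_in_def)
  show neg: "- a \<in> I" if "a \<in> I" for a using diff[OF 0 that] by simp
  show "a + b \<in> I" if "a \<in> I" "b \<in> I" using diff[OF that(1) neg[OF that(2)]] by simp
  show "a \<in> I \<Longrightarrow> a \<in> R" "a \<in> I \<Longrightarrow> r \<in> R \<Longrightarrow> r * a \<in> I" "a \<in> I \<Longrightarrow> r \<in> R \<Longrightarrow> a * r \<in> I"
    using assms by (auto simp: ideal_in_def mult.commute)
qed

lemma ideal_in_sum:
  assumes "ideal_in A M" "\<And>i. i \<in> I \<Longrightarrow> f i \<in> M"
  shows "(\<Sum>i\<in>I. f i) \<in> M"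
  using assms(2) by (induction I rule: infinite_finite_induct) (auto intro: ideal_inD[OF assms(1)])

definition finite_index :: "'a::comm_ring_1 set \<Rightarrow> 'a set \<Rightarrow> bool" where
  "finite_index R I \<longleftrightarrow> (\<exists>T. finite T \<and> T \<subseteq> R \<and> (\<forall>x\<in>R. \<exists>t\<in>T. x - t \<in> I))"

text \<open>\<open>R / M\<close> is a finite field. Working with \<open>M\<close> instead of a
  quotient keeps all computations inside the ambient ring, so that identities valid there can be
  used before they are reduced.\<close>

definition finite_residue_field :: "'a::comm_ring_1 set \<Rightarrow> 'a set \<Rightarrow> bool" where
  "finite_residue_field R M \<longleftrightarrow> ideal_in R M \<and> finite_index R M \<and> 1 \<notin> M \<and>
     (\<forall>x\<in>R. x \<notin> M \<longrightarrow> (\<exists>y\<in>R. x * y - 1 \<in> M))"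

lemma finite_residue_field_prime:
  assumes R: "ring_set R" and M: "finite_residue_field R M"
    and "x \<in> R" "y \<in> R" "x * y \<in> M" "x \<notin> M"
  shows "y \<in> M"
proof -
  have I: "ideal_in R M" using M by (simp add: finite_residue_field_def)
  obtain z where z: "z \<in> R" "x * z - 1 \<in> M" using M assms by (auto simp: finite_residue_field_def)
  have "z * (x * y) - (x * z - 1) * y \<in> M"
    by (intro ideal_inD[OF I] z assms)
  then show ?thesis by (simp add: algebra_simps)
qed

text \<open>An ideal containing \<open>J\<close> is determined by the elements of \<open>T\<close>
  that it contains. As \<open>T\<close> is finite, a proper one containing the largest number of
  them is maximal, and maximality provides the inverses.\<close>

lemma maximal_ideal_exists:
  assumes R: "ring_set R" and J: "ideal_in R J" "finite_index R J" "1 \<notin> J"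
  obtains M where "finite_residue_field R M" "J \<subseteq> M"
proof -
  obtain T where T: "finite T" "T \<subseteq> R" "\<And>x. x \<in> R \<Longrightarrow> \<exists>t\<in>T. x - t \<in> J"
    using J(2) unfolding finite_index_def by blast
  let ?P = "\<lambda>I. ideal_in R I \<and> J \<subseteq> I \<and> 1 \<notin> I"
  have "\<exists>M. ?P M \<and> (\<forall>I. ?P I \<longrightarrow> card (I \<inter> T) \<le> card (M \<inter> T))"
  proof (rule ex_has_greatest_nat[of ?P J _ "Suc (card T)"])
    show "?P J" using J by simp
    show "\<forall>I. ?P I \<longrightarrow> card (I \<inter> T) < Suc (card T)"
      using T(1) by (auto intro: card_mono simp: less_Suc_eq_le)
  qed
  then obtain M where M: "ideal_in R M" "J \<subseteq> M" "1 \<notin> M"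
    and max: "\<And>I. ideal_in R I \<Longrightarrow> J \<subseteq> I \<Longrightarrow> 1 \<notin> I \<Longrightarrow> card (I \<inter> T) \<le> card (M \<inter> T)" by blast
  have "\<exists>y\<in>R. x * y - 1 \<in> M" if x: "x \<in> R" "x \<notin> M" for x
  proof -
    define I where "I = {m + x * r | m r. m \<in> M \<and> r \<in> R}"
    have iI: "m + x * r \<in> I" if "m \<in> M" "r \<in> R" for m r using that unfolding I_def by blast
    have "ideal_in R I"
      unfolding ideal_in_def
    proof (intro conjI ballI subsetI)
      show "a \<in> R" if "a \<in> I" for a
        using that x unfolding I_def by (auto intro!: ring_setD(4,6)[OF R] dest: ideal_inD(1)[OF M(1)])
      show "0 \<in> I" using iI[OF ideal_inD(2)[OF M(1)] ring_setD(1)[OF R]] by simp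
      fix a assume "a \<in> I"
      then obtain m r where a: "a = m + x * r" "m \<in> M" "r \<in> R" unfolding I_def by blast
      show "a - b \<in> I" if "b \<in> I" for b
      proof -
        obtain m' r' where b: "b = m' + x * r'" "m' \<in> M" "r' \<in> R" using \<open>b \<in> I\<close> unfolding I_def by blast
        have "a - b = (m - m') + x * (r - r')" by (simp add: a b algebra_simps)
        then show ?thesis using iI[of "m - m'" "r - r'"] a b ideal_inD[OF M(1)] ring_setD[OF R] by metis
      qed
      show "s * a \<in> I" if "s \<in> R" for s
      proof -
        have "s * a = s * m + x * (s * r)" by (simp add: a algebra_simps)
        then show ?thesis using iI[of "s * m" "s * r"] a that ideal_inD[OF M(1)] ring_setD[OF R] by metis
      qed
    qed
    moreover have MI: "M \<subseteq> I" using iI[OF _ ring_setD(1)[OF R]] by auto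
    moreover have "card (M \<inter> T) < card (I \<inter> T)"
    proof (rule psubset_card_mono)
      show "finite (I \<inter> T)" using T by simp
      obtain t where t: "t \<in> T" "x - t \<in> J" using T(3)[OF x(1)] by blast
      have "x \<in> I" using iI[OF ideal_inD(2)[OF M(1)] ring_setD(2)[OF R]] by simp
      moreover have "x - t \<in> I" using t M(2) MI by blast
      ultimately have "x - (x - t) \<in> I" by (rule ideal_inD(3)[OF \<open>ideal_in R I\<close>])
      then have "t \<in> I" by simp
      moreover have "t \<notin> M" using ideal_inD(7)[OF M(1), of "x - t" t] t M(2) x by auto
      ultimately show "M \<inter> T \<subset> I \<inter> T" using MI t by auto
    qed
    ultimately have "1 \<in> I" using max[of I] M(2) by fastforce
    then obtain m r where m: "1 = m + x * r" "m \<in> M" "r \<in> R" unfolding I_def by blast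
    have "x * r - 1 = - m" using m(1) by (simp add: algebra_simps)
    then have "x * r - 1 \<in> M" using ideal_inD(6)[OF M(1) m(2)] by simp
    then show ?thesis by (rule bexI[OF _ m(3)])
  qed
  moreover have "finite_index R M"
    unfolding finite_index_def using T(1,2) subsetD[OF M(2)] T(3) by (intro exI[of _ T]) meson
  ultimately have "finite_residue_field R M" using M by (simp add: finite_residue_field_def)
  then show thesis using M(2) by (rule that)
qed

section \<open>Finite residue fields of simple ring extensions\<close>

definition adjoin :: "'a::comm_ring_1 set \<Rightarrow> 'a \<Rightarrow> 'a set" where
  "adjoin R a = (\<lambda>p. poly p a) ` polys R"

lemma ring_set_adjoin:
  assumes "ring_set R"
  shows "ring_set (adjoin R a)"
  unfolding ring_set_def adjoin_def
proof (intro conjI ballI)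
  note pR = ring_set_polys[OF assms]
  show "1 \<in> (\<lambda>p. poly p a) ` polys R" using ring_setD(2)[OF pR] by (intro image_eqI[of _ _ 1]) auto
  fix x y assume "x \<in> (\<lambda>p. poly p a) ` polys R" "y \<in> (\<lambda>p. poly p a) ` polys R"
  then obtain p q where pq: "p \<in> polys R" "q \<in> polys R" "x = poly p a" "y = poly q a" by blast
  show "x - y \<in> (\<lambda>p. poly p a) ` polys R"
    using ring_setD(3)[OF pR pq(1,2)] pq by (intro image_eqI[of _ _ "p - q"]) auto
  show "x * y \<in> (\<lambda>p. poly p a) ` polys R"
    using ring_setD(4)[OF pR pq(1,2)] pq by (intro image_eqI[of _ _ "p * q"]) auto
qed

lemma adjoin_superset: "ring_set R \<Longrightarrow> R \<subseteq> adjoin R a"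
  unfolding adjoin_def by (auto intro!: image_eqI[of _ _ "[:_:]"] zero_polys)

lemma adjoin_gen: "ring_set R \<Longrightarrow> a \<in> adjoin R a"
  unfolding adjoin_def by (rule image_eqI[of _ _ "[:0, 1:]"]) (auto intro: zero_polys ring_setD)

lemma finite_polys_bounded:
  assumes "finite (T :: 'a::zero set)"
  shows "finite {P. degree P < d \<and> (\<forall>i. coeff P i \<in> T)}"
proof (rule finite_imageD)
  let ?f = "\<lambda>P :: 'a poly. map (coeff P) [0..<d]"
  have "?f ` {P. degree P < d \<and> (\<forall>i. coeff P i \<in> T)} \<subseteq> {xs. set xs \<subseteq> T \<and> length xs = d}" by auto
  then show "finite (?f ` {P. degree P < d \<and> (\<forall>i. coeff P i \<in> T)})"
    using finite_lists_length_eq[OF assms] finite_subset by blast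
  show "inj_on ?f {P. degree P < d \<and> (\<forall>i. coeff P i \<in> T)}"
  proof (rule inj_onI)
    fix P Q assume "P \<in> {P. degree P < d \<and> (\<forall>i. coeff P i \<in> T)}"
      "Q \<in> {P. degree P < d \<and> (\<forall>i. coeff P i \<in> T)}" "?f P = ?f Q"
    then have "coeff P i = coeff Q i" for i
      by (cases "i < d") (auto simp: coeff_eq_0)
    then show "P = Q" by (rule poly_eqI)
  qed
qed

text \<open>Over the field \<open>R / M\<close> a polynomial of positive degree divides no nonzero
  constant. Inside \<open>R\<close>: the product of the leading coefficient of \<open>T\<close> with
  the highest coefficient of \<open>V\<close> outside \<open>M\<close> would have to lie in
  \<open>M\<close>, against primality.\<close>

lemma polys_ideal_const:
  assumes R: "ring_set R" and M: "finite_residue_field R M"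
    and T: "T \<in> polys R" "degree T > 0" "lead_coeff T \<notin> M"
    and V: "V \<in> polys R" "[:e:] - T * V \<in> polys M"
  shows "e \<in> M"
proof (cases "\<forall>i. coeff V i \<in> M")
  case True
  have I: "ideal_in R M" using M by (simp add: finite_residue_field_def)
  have "coeff ([:e:] - T * V) 0 \<in> M" by (rule polys_coeff[OF V(2)])
  then have "e - coeff T 0 * coeff V 0 \<in> M" by (simp add: coeff_mult)
  moreover have "coeff T 0 * coeff V 0 \<in> M"
    using True polys_coeff[OF T(1)] by (intro ideal_inD(4)[OF I]) auto
  ultimately show ?thesis using ideal_inD(7)[OF I] by fastforce
next
  case False
  have I: "ideal_in R M" using M by (simp add: finite_residue_field_def)
  let ?d = "degree T"
  have fin: "finite {i. coeff V i \<notin> M}"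
    by (rule finite_subset[of _ "{..degree V}"]) (use ideal_inD(2)[OF I] in \<open>auto intro: le_degree\<close>)
  define m where "m = Max {i. coeff V i \<notin> M}"
  have m: "coeff V m \<notin> M" using Max_in[OF fin] False by (auto simp: m_def)
  have gt: "coeff V i \<in> M" if "i > m" for i
    using that Max_ge[OF fin, of i] by (auto simp: m_def)
  have "coeff (T * V) (m + ?d) = (\<Sum>l\<le>m + ?d. coeff T l * coeff V (m + ?d - l))"
    by (rule coeff_mult)
  also have "\<dots> = lead_coeff T * coeff V m +
      (\<Sum>l\<in>{..m + ?d} - {?d}. coeff T l * coeff V (m + ?d - l))"
    by (subst sum.remove[of _ ?d]) auto
  finally have eq: "lead_coeff T * coeff V m = coeff (T * V) (m + ?d) -
      (\<Sum>l\<in>{..m + ?d} - {?d}. coeff T l * coeff V (m + ?d - l))" by simp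
  have "coeff ([:e:] - T * V) (m + ?d) \<in> M" by (rule polys_coeff[OF V(2)])
  moreover have "coeff [:e:] (m + ?d) = 0" using T by (cases "m + ?d") auto
  ultimately have "- coeff (T * V) (m + ?d) \<in> M" by simp
  then have "coeff (T * V) (m + ?d) \<in> M" using ideal_inD(6)[OF I] by fastforce
  moreover have "(\<Sum>l\<in>{..m + ?d} - {?d}. coeff T l * coeff V (m + ?d - l)) \<in> M"
  proof (rule ideal_in_sum[OF I])
    fix l assume "l \<in> {..m + ?d} - {?d}"
    then consider "l < ?d" | "l > ?d" by fastforce
    then show "coeff T l * coeff V (m + ?d - l) \<in> M"
    proof cases
      case 1
      then show ?thesis using polys_coeff[OF T(1)] by (intro ideal_inD(4)[OF I] gt) auto
    qed (simp add: coeff_eq_0 ideal_inD[OF I])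
  qed
  ultimately have "lead_coeff T * coeff V m \<in> M" unfolding eq by (rule ideal_inD[OF I])
  then show ?thesis
    using finite_residue_field_prime[OF R M _ _ _ T(3)] m T V by (meson polys_coeff)
qed

text \<open>The maximal ideal is taken above the ideal \<open>J\<close> generated by
  \<open>M\<close> and \<open>poly T a\<close>. Division by \<open>T\<close>, whose leading
  coefficient is invertible modulo \<open>M\<close>, leaves finitely many cosets;
  \<open>proper\<close> says that \<open>J\<close> does not contain 1; and \<open>s\<close> stays
  outside because \<open>s * t\<close> is congruent modulo \<open>J\<close> to \<open>d\<close>,
  which is invertible modulo \<open>M\<close>.\<close>

lemma adjoin_residue_field:
  assumes R: "ring_set R" and M: "finite_residue_field R M"
    and T: "T \<in> polys R" "degree T > 0" "lead_coeff T \<notin> M"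
    and proper: "\<And>U V. U \<in> polys M \<Longrightarrow> V \<in> polys R \<Longrightarrow> 1 \<noteq> poly U a + poly T a * poly V a"
    and s: "s \<in> adjoin R a" "t \<in> adjoin R a" "V0 \<in> polys R" "d \<in> R" "d \<notin> M"
      "s * t - d = poly T a * poly V0 a"
  obtains M' where "finite_residue_field (adjoin R a) M'" "s \<notin> M'"
proof -
  let ?S = "adjoin R a"
  have I: "ideal_in R M" using M by (simp add: finite_residue_field_def)
  note RS = ring_set_adjoin[OF R, of a] and pR = ring_set_polys[OF R]
  have polysM: "p - q \<in> polys M" if "p \<in> polys M" "q \<in> polys M" for p q
    using that by (auto simp: polys_def intro: ideal_inD[OF I])
  have polysM': "p * q \<in> polys M" if "p \<in> polys R" "q \<in> polys M" for p q
    using that by (auto simp: polys_def coeff_mult intro!: ideal_in_sum[OF I] ideal_inD(4)[OF I])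
  have MR: "polys M \<subseteq> polys R" using ideal_inD(1)[OF I] by (auto simp: polys_def)
  have M0: "0 \<in> polys M" using ideal_inD(2)[OF I] by (auto simp: polys_def)
  define J where "J = {poly U a + poly T a * poly V a | U V. U \<in> polys M \<and> V \<in> polys R}"
  have iJ: "poly U a + poly T a * poly V a \<in> J" if "U \<in> polys M" "V \<in> polys R" for U V
    using that unfolding J_def by blast
  have J: "ideal_in ?S J"
    unfolding ideal_in_def
  proof (intro conjI ballI subsetI)
    show "x \<in> ?S" if "x \<in> J" for x
    proof -
      obtain U V where UV: "x = poly U a + poly T a * poly V a" "U \<in> polys M" "V \<in> polys R"
        using \<open>x \<in> J\<close> unfolding J_def by blast
      have "x = poly (U + T * V) a" by (simp add: UV)
      moreover have "U + T * V \<in> polys R" using UV MR T by (auto intro!: ring_setD[OF pR])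
      ultimately show ?thesis unfolding adjoin_def by blast
    qed
    show "0 \<in> J" using iJ[OF M0 ring_setD(1)[OF pR]] by simp
    fix x assume "x \<in> J"
    then obtain U V where UV: "x = poly U a + poly T a * poly V a" "U \<in> polys M" "V \<in> polys R"
      unfolding J_def by blast
    show "x - y \<in> J" if "y \<in> J" for y
    proof -
      obtain U' V' where UV': "y = poly U' a + poly T a * poly V' a" "U' \<in> polys M" "V' \<in> polys R"
        using \<open>y \<in> J\<close> unfolding J_def by blast
      have "x - y = poly (U - U') a + poly T a * poly (V - V') a"
        by (simp add: UV UV' algebra_simps)
      then show ?thesis using iJ[OF polysM[OF UV(2) UV'(2)] ring_setD(3)[OF pR UV(3) UV'(3)]] by simp
    qed
    show "r * x \<in> J" if "r \<in> ?S" for r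
    proof -
      obtain P where P: "P \<in> polys R" "r = poly P a" using \<open>r \<in> ?S\<close> unfolding adjoin_def by blast
      have "r * x = poly (P * U) a + poly T a * poly (P * V) a"
        by (simp add: UV P algebra_simps)
      then show ?thesis using iJ[OF polysM'[OF P(1) UV(2)] ring_setD(4)[OF pR P(1) UV(3)]] by simp
    qed
  qed
  have MJ: "poly U a \<in> J" if "U \<in> polys M" for U using iJ[OF that ring_setD(1)[OF pR]] by simp
  have TJ: "poly T a * poly V a \<in> J" if "V \<in> polys R" for V using iJ[OF M0 that] by simp
  have "1 \<notin> J" using proper unfolding J_def by blast
  obtain c' where c': "c' \<in> R" "lead_coeff T * c' - 1 \<in> M"
    using M T unfolding finite_residue_field_def by (meson polys_coeff)
  have reduce: "\<exists>P'\<in>polys R. degree P' < degree T \<and> poly P a - poly P' a \<in> J"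
    if "P \<in> polys R" for P
    using that
  proof (induction "degree P" arbitrary: P rule: less_induct)
    case less
    show ?case
    proof (cases "degree P < degree T")
      case True
      then show ?thesis using less.prems ideal_inD(2)[OF J] by (intro bexI[of _ P]) auto
    next
      case False
      let ?k = "degree P - degree T"
      let ?W = "monom (c' * lead_coeff P) ?k"
      \<comment> \<open>\<open>c'\<close> inverts the leading coefficient of \<open>T\<close> only
        modulo \<open>M\<close>. The error \<open>?e\<close> of the cancellation lies in
        \<open>M\<close>, so the monomial with this coefficient may be subtracted as well.\<close>
      let ?e = "lead_coeff P - lead_coeff T * (c' * lead_coeff P)"
      let ?E = "monom ?e (degree P)"
      define P' where "P' = P - T * ?W - ?E"
      have WR: "?W \<in> polys R" by (intro monom_polys[OF R] ring_setD[OF R] c' polys_coeff less.prems)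
      have "?e = - ((lead_coeff T * c' - 1) * lead_coeff P)" by (simp add: algebra_simps)
      also have "\<dots> \<in> M" by (intro ideal_inD(5,6)[OF I] c' polys_coeff less.prems)
      finally have EM: "?E \<in> polys M" using ideal_inD(2)[OF I] by (auto simp: polys_def)
      have P'R: "P' \<in> polys R"
        unfolding P'_def using EM MR by (intro ring_setD(3,4)[OF pR] less.prems T WR) auto
      have eq: "poly P a - poly P' a = poly ?E a + poly T a * poly ?W a"
        by (simp add: P'_def)
      have dTW: "degree (T * ?W) \<le> degree P"
        using degree_mult_le[of T ?W] degree_monom_le[of "c' * lead_coeff P" ?k] False by simp
      have "degree P' \<le> degree P"
        unfolding P'_def by (intro degree_diff_le dTW degree_monom_le) simp
      moreover have "coeff P' (degree P) = 0"
      proof -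
        have "coeff (T * ?W) (degree P) = lead_coeff T * (c' * lead_coeff P)"
          using False coeff_monom_mult[of "c' * lead_coeff P" ?k T "degree P"]
          by (simp only: mult.commute[of T]) (simp add: mult_ac)
        then show ?thesis by (simp add: P'_def)
      qed
      ultimately have lt: "degree P' < degree P \<or> P' = 0"
        by (metis leading_coeff_0_iff le_neq_implies_less)
      have "\<exists>P''\<in>polys R. degree P'' < degree T \<and> poly P' a - poly P'' a \<in> J"
      proof (cases "P' = 0")
        case True
        then show ?thesis using T(2) ideal_inD(2)[OF J] ring_setD(1)[OF pR] by (intro bexI[of _ 0]) auto
      next
        case False
        then show ?thesis using less.hyps[OF _ P'R] lt by blast
      qed
      then obtain P'' where P'': "P'' \<in> polys R" "degree P'' < degree T" "poly P' a - poly P'' a \<in> J"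
        by blast
      have "(poly P a - poly P' a) + (poly P' a - poly P'' a) \<in> J"
        unfolding eq by (rule ideal_inD(7)[OF J iJ[OF EM WR] P''(3)])
      then show ?thesis using P'' by (intro bexI[of _ P'']) auto
    qed
  qed
  obtain T0 where T0: "finite T0" "T0 \<subseteq> R" "\<And>x. x \<in> R \<Longrightarrow> \<exists>t\<in>T0. x - t \<in> M"
    using M unfolding finite_residue_field_def finite_index_def by blast
  have "finite_index ?S J"
    unfolding finite_index_def
  proof (intro exI conjI ballI)
    let ?Q = "{P. degree P < degree T \<and> (\<forall>i. coeff P i \<in> insert 0 T0)}"
    show "finite ((\<lambda>P. poly P a) ` ?Q)" using T0(1) by (intro finite_imageI finite_polys_bounded) simp
    show "(\<lambda>P. poly P a) ` ?Q \<subseteq> ?S"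
      unfolding adjoin_def using T0(2) ring_setD(1)[OF R] by (intro image_mono) (force simp: polys_def)
    fix x assume "x \<in> ?S"
    then obtain P0 where "P0 \<in> polys R" "x = poly P0 a" unfolding adjoin_def by blast
    with reduce obtain P where P: "P \<in> polys R" "degree P < degree T" "x - poly P a \<in> J" by blast
    obtain r where r: "\<And>y. y \<in> R \<Longrightarrow> r y \<in> T0 \<and> y - r y \<in> M" using T0(3) by metis
    define P' where "P' = (\<Sum>i<degree T. monom (r (coeff P i)) i)"
    have cf: "coeff P' i = (if i < degree T then r (coeff P i) else 0)" for i
      unfolding P'_def by (auto simp: coeff_sum)
    have "degree P' < degree T"
      using T(2) degree_le[of "degree T - 1" P'] cf by fastforce
    then have P'Q: "P' \<in> ?Q" using cf r polys_coeff[OF P(1)] by auto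
    have "P - P' \<in> polys M"
      unfolding polys_def using cf r[OF polys_coeff[OF P(1)]] P(2) ideal_inD(2)[OF I]
      by (auto simp: coeff_eq_0)
    from ideal_inD(7)[OF J P(3) MJ[OF this]] have "x - poly P' a \<in> J" by simp
    then show "\<exists>t\<in>(\<lambda>P. poly P a) ` ?Q. x - t \<in> J" using P'Q by blast
  qed
  from maximal_ideal_exists[OF RS J this \<open>1 \<notin> J\<close>]
  obtain M' where M': "finite_residue_field ?S M'" "J \<subseteq> M'" .
  have I': "ideal_in ?S M'" "1 \<notin> M'" using M' by (auto simp: finite_residue_field_def)
  have "s \<notin> M'"
  proof
    assume "s \<in> M'"
    have "s * t - d \<in> M'" using s(6) TJ[OF s(3)] M'(2) by auto
    then have "s * t - (s * t - d) \<in> M'"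
      by (rule ideal_inD(3)[OF I'(1) ideal_inD(5)[OF I'(1) \<open>s \<in> M'\<close> s(2)]])
    then have "d \<in> M'" by simp
    obtain d' where d': "d' \<in> R" "d * d' - 1 \<in> M"
      using M s unfolding finite_residue_field_def by blast
    have "[:d * d' - 1:] \<in> polys M" using d' M0 by simp
    from MJ[OF this] have "d * d' - 1 \<in> M'" using M'(2) by auto
    moreover have "d' \<in> ?S" using d' adjoin_superset[OF R] by blast
    then have "d * d' \<in> M'" by (rule ideal_inD(5)[OF I'(1) \<open>d \<in> M'\<close>])
    ultimately have "d * d' - (d * d' - 1) \<in> M'" by (metis ideal_inD(3)[OF I'(1)])
    then show False using I' by simp
  qed
  with M' show thesis using that by blast
qed

text \<open>The quantifier over all nonzero \<open>s\<close> is what carries the induction over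
  adjoined elements: leading coefficients of auxiliary polynomials must stay nonzero modulo
  \<open>M\<close>.\<close>

definition has_residue_fields :: "'a::comm_ring_1 set \<Rightarrow> bool" where
  "has_residue_fields R \<longleftrightarrow> ring_set R \<and> (\<forall>s\<in>R. s \<noteq> 0 \<longrightarrow> (\<exists>M. finite_residue_field R M \<and> s \<notin> M))"

text \<open>If \<open>a\<close> is transcendental over \<open>R\<close>, a relation is imposed on it
  that makes \<open>s\<close> invertible. If \<open>a\<close> is algebraic, a polynomial of minimal
  degree vanishing at \<open>a\<close> takes the place of this relation, and \<open>s\<close> has a
  nonzero multiple \<open>d\<close> in \<open>R\<close>, in the role of a norm. In both cases it
  suffices that \<open>M\<close> avoids one nonzero element of \<open>R\<close>.\<close>

lemma has_residue_fields_adjoin: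
  fixes R :: "'a::idom set"
  assumes F: "has_residue_fields R"
  shows "has_residue_fields (adjoin R a)"
  unfolding has_residue_fields_def
proof (intro conjI ballI impI)
  have R: "ring_set R" using F by (simp add: has_residue_fields_def)
  note pR = ring_set_polys[OF R]
  show "ring_set (adjoin R a)" by (rule ring_set_adjoin[OF R])
  fix s assume s: "s \<in> adjoin R a" "s \<noteq> 0"
  then obtain S where S: "S \<in> polys R" "s = poly S a" unfolding adjoin_def by blast
  show "\<exists>M. finite_residue_field (adjoin R a) M \<and> s \<notin> M"
  proof (cases "\<exists>P\<in>polys R. P \<noteq> 0 \<and> poly P a = 0")
    case False
    have S0: "S \<noteq> 0" using S s by auto
    then have "lead_coeff S \<noteq> 0" by simp
    then obtain M where M: "finite_residue_field R M" "lead_coeff S \<notin> M"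
      using F polys_coeff[OF S(1)] unfolding has_residue_fields_def by blast
    have I: "ideal_in R M" "1 \<notin> M" using M by (auto simp: finite_residue_field_def)
    have MR: "polys M \<subseteq> polys R" using ideal_inD(1)[OF I(1)] by (auto simp: polys_def)
    \<comment> \<open>The value at \<open>a\<close> is \<open>s * a - 1\<close>, so that
      \<open>a\<close> becomes an inverse of \<open>s\<close> modulo this value; the leading
      coefficient is that of \<open>S\<close>.\<close>
    define T where "T = pCons 0 S - 1"
    have TR: "T \<in> polys R" unfolding T_def using S by (intro ring_setD[OF pR]) (auto intro: ring_setD[OF R])
    have dT: "degree T = Suc (degree S)" unfolding T_def using S0
      by (metis degree_1 degree_add_eq_left degree_minus degree_pCons_eq diff_conv_add_uminus zero_less_Suc)
    have lT: "lead_coeff T = lead_coeff S" unfolding dT by (simp add: T_def)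
    have proper: "1 \<noteq> poly U a + poly T a * poly V a" if UV: "U \<in> polys M" "V \<in> polys R" for U V
    proof
      assume "1 = poly U a + poly T a * poly V a"
      then have "poly (1 - U - T * V) a = 0" by (simp add: algebra_simps)
      moreover have "1 - U - T * V \<in> polys R" using UV MR TR by (intro ring_setD[OF pR]) auto
      ultimately have "1 - U - T * V = 0" using False by blast
      then have "[:1:] - T * V = U" by (simp add: one_pCons algebra_simps)
      then have "1 \<in> M" using polys_ideal_const[OF R M(1) TR, of V 1] UV dT lT M(2) by auto
      then show False using I by simp
    qed
    have "s * a - 1 = poly T a * poly 1 a" by (simp add: T_def S)
    then show ?thesis
      using adjoin_residue_field[OF R M(1) TR _ _ proper s(1) adjoin_gen[OF R], of 1 1] dT lT M(2) I(2)
        ring_setD(2)[OF R] ring_setD(2)[OF pR] by auto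
  next
    case True
    let ?A = "\<lambda>P. P \<in> polys R \<and> P \<noteq> 0 \<and> poly P a = 0"
    obtain P where P: "P \<in> polys R" "P \<noteq> 0" "poly P a = 0"
      and Pmin: "\<And>Q. Q \<in> polys R \<Longrightarrow> Q \<noteq> 0 \<Longrightarrow> poly Q a = 0 \<Longrightarrow> degree P \<le> degree Q"
      using True ex_has_least_nat[of ?A _ degree] by blast
    have dP: "degree P > 0"
    proof (rule ccontr)
      assume "\<not> ?thesis"
      then obtain c where "P = [:c:]" by (metis degree_eq_zeroE gr0I)
      then show False using P by auto
    qed
    \<comment> \<open>Among the polynomials whose value at \<open>a\<close> is a nonzero multiple of
      \<open>s\<close>, one of least degree turns out to be constant; it is the desired multiple of
      \<open>s\<close> in \<open>R\<close>.\<close>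
    let ?B = "\<lambda>G. G \<in> polys R \<and> poly G a \<noteq> 0 \<and> (\<exists>t\<in>adjoin R a. poly G a = s * t)"
    have "?B S" using S s ring_setD(2)[OF ring_set_adjoin[OF R]] by (auto intro!: bexI[of _ 1])
    then obtain G where G: "?B G" and Gmin: "\<And>Q. ?B Q \<Longrightarrow> degree G \<le> degree Q"
      using ex_has_least_nat[of ?B S degree] by blast
    have GR: "G \<in> polys R" "G \<noteq> 0" using G by auto
    have smaller: False if W: "W \<in> polys R" "x \<in> adjoin R a" "poly W a = x * poly G a" "poly W a \<noteq> 0"
      "degree W < degree G" for W x
    proof -
      obtain t where t: "t \<in> adjoin R a" "poly G a = s * t" using G by blast
      then have "poly W a = s * (x * t)" using W by simp
      then have "?B W" using W ring_setD(4)[OF ring_set_adjoin[OF R] W(2) t(1)] by blast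
      then show False using Gmin W(5) by fastforce
    qed
    have val: "poly W a \<in> adjoin R a" if "W \<in> polys R" for W using that unfolding adjoin_def by blast
    have lc: "lead_coeff Q ^ j \<in> adjoin R a" "lead_coeff Q ^ j \<in> R" if "Q \<in> polys R" for Q j
      using ring_set_power[OF R polys_coeff[OF that]] adjoin_superset[OF R] by blast+
    have GP: "degree G < degree P"
    proof (rule ccontr)
      assume ge: "\<not> ?thesis"
      obtain j W T where W: "W \<in> polys R" "T \<in> polys R" "smult (lead_coeff P ^ j) G = P * W + T"
        "T = 0 \<or> degree T < degree P"
        using pseudo_division[OF R P(1,2) GR(1)] .
      have "poly (smult (lead_coeff P ^ j) G) a = poly (P * W + T) a" by (simp only: W(3))
      then have T: "poly T a = lead_coeff P ^ j * poly G a" using P by simp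
      then have "poly T a \<noteq> 0" using G P by simp
      moreover from this have "T \<noteq> 0" by auto
      ultimately show False using smaller[OF W(2) lc(1)[OF P(1)] T] W(4) ge by simp
    qed
    have dG: "degree G = 0"
    proof (rule ccontr)
      assume dG: "degree G \<noteq> 0"
      \<comment> \<open>Since \<open>P\<close> vanishes at \<open>a\<close>, the remainder of
        \<open>P\<close> by \<open>G\<close> has the value \<open>- poly W a * poly G a\<close>. It
        is nonzero because \<open>W\<close> has smaller degree than \<open>P\<close>, which
        contradicts the minimality of \<open>G\<close>.\<close>
      obtain j W T where W: "W \<in> polys R" "T \<in> polys R" "smult (lead_coeff G ^ j) P = G * W + T"
        "T = 0 \<or> degree T < degree G"
        using pseudo_division[OF R GR P(1)] .
      have cP: "smult (lead_coeff G ^ j) P \<noteq> 0" "degree (smult (lead_coeff G ^ j) P) = degree P"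
        using P GR by auto
      have "W \<noteq> 0"
      proof
        assume "W = 0"
        then show False using W cP GP by auto
      qed
      have "degree (G * W) = degree P"
      proof (cases "T = 0")
        case True
        then show ?thesis using W cP by simp
      next
        case False
        then have "degree T < degree (G * W)" using W(4) GR \<open>W \<noteq> 0\<close> by (simp add: degree_mult_eq)
        then show ?thesis using degree_add_eq_left[of T "G * W"] W(3) cP(2) by simp
      qed
      then have "degree W < degree P" using dG GR \<open>W \<noteq> 0\<close> by (simp add: degree_mult_eq)
      then have Wa: "poly W a \<noteq> 0" using Pmin[OF W(1) \<open>W \<noteq> 0\<close>] by auto
      have "poly (smult (lead_coeff G ^ j) P) a = poly (G * W + T) a" by (simp only: W(3))
      then have T: "poly T a = (- poly W a) * poly G a"
        using P by (simp add: add_eq_0_iff2 mult.commute)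
      then have "poly T a \<noteq> 0" using G Wa by simp
      moreover from this have "T \<noteq> 0" by auto
      moreover have "- poly W a \<in> adjoin R a" by (intro ring_setD(5)[OF ring_set_adjoin[OF R]] val W)
      ultimately show False using smaller[OF W(2) _ T] W(4) by simp
    qed
    then obtain d where d: "G = [:d:]" by (metis degree_eq_zeroE)
    obtain t where t: "t \<in> adjoin R a" "d = s * t" using G d by auto
    have dR: "d \<in> R" "d \<noteq> 0" using G d by auto
    let ?c = "lead_coeff P"
    have "?c * d \<noteq> 0" "?c * d \<in> R" using P dR by (auto intro: ring_setD[OF R] polys_coeff)
    then obtain M where M: "finite_residue_field R M" "?c * d \<notin> M"
      using F unfolding has_residue_fields_def by blast
    have I: "ideal_in R M" "1 \<notin> M" using M by (auto simp: finite_residue_field_def)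
    have MR: "polys M \<subseteq> polys R" using ideal_inD(1)[OF I(1)] by (auto simp: polys_def)
    have nM: "?c \<notin> M" "d \<notin> M"
      using M(2) ideal_inD(4,5)[OF I(1)] dR polys_coeff[OF P(1)] by blast+
    have cj: "?c ^ j \<notin> M" for j
    proof (induction j)
      case (Suc j)
      then show ?case
        using finite_residue_field_prime[OF R M(1) polys_coeff[OF P(1)] lc(2)[OF P(1)] _ nM(1)] by auto
    qed (use I in simp)
    have proper: "1 \<noteq> poly U a + poly P a * poly V a" if UV: "U \<in> polys M" "V \<in> polys R" for U V
    proof
      assume 1: "1 = poly U a + poly P a * poly V a"
      \<comment> \<open>As \<open>P\<close> vanishes at \<open>a\<close>, so does
        \<open>1 - U\<close>; by minimality \<open>P\<close> divides it up to a power of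
        \<open>?c\<close>. Modulo \<open>M\<close> this power is then a multiple of
        \<open>P\<close>, hence it lies in \<open>M\<close>.\<close>
      have U1: "1 - U \<in> polys R" using UV MR by (intro ring_setD[OF pR]) auto
      obtain j W T where W: "W \<in> polys R" "T \<in> polys R" "smult (?c ^ j) (1 - U) = P * W + T"
        "T = 0 \<or> degree T < degree P"
        using pseudo_division[OF R P(1,2) U1] .
      have "poly (smult (?c ^ j) (1 - U)) a = poly (P * W + T) a" by (simp only: W(3))
      then have "poly T a = 0" using 1 P by simp
      then have "T = 0" using Pmin[OF W(2)] W(4) by fastforce
      have "[:?c ^ j:] - P * W = smult (?c ^ j) U"
        using W(3) \<open>T = 0\<close> by (simp add: smult_diff_right algebra_simps one_pCons)
      moreover have "smult (?c ^ j) U \<in> polys M"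
        using UV lc(2)[OF P(1)] by (auto simp: polys_def intro: ideal_inD(4)[OF I(1)])
      ultimately have "?c ^ j \<in> M" using polys_ideal_const[OF R M(1) P(1) dP nM(1) W(1)] by simp
      then show False using cj by simp
    qed
    show ?thesis
      using adjoin_residue_field[OF R M(1) P(1) dP nM(1) proper s(1) t(1), of 0 d] dR nM t
        ring_setD(1)[OF pR] by auto
  qed
qed

lemma has_residue_fields_of_int: "has_residue_fields (range (of_int :: int \<Rightarrow> 'a::field))"
  unfolding has_residue_fields_def
proof (intro conjI ballI impI)
  show "ring_set (range (of_int :: int \<Rightarrow> 'a))"
    unfolding ring_set_def by (auto simp flip: of_int_diff of_int_mult) (metis of_int_1 rangeI)
  fix s :: 'a assume s: "s \<in> range of_int" "s \<noteq> 0"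
  then obtain m where m: "s = of_int m" "m \<noteq> 0" by (metis imageE of_int_0)
  \<comment> \<open>In positive characteristic the only possible residue characteristic is
    \<open>CHAR('a)\<close>; in characteristic 0 any prime not dividing \<open>m\<close>
    serves.\<close>
  have "\<exists>p. prime p \<and> \<not> p dvd m \<and> (CHAR('a) = 0 \<or> int CHAR('a) = p)"
  proof (cases "CHAR('a) = 0")
    case True
    obtain q :: nat where "prime q" "q > nat \<bar>m\<bar>" using bigger_prime by blast
    then have "prime (int q)" "\<not> int q dvd m" using m(2) zdvd_imp_le[of "int q" "\<bar>m\<bar>"] by auto
    then show ?thesis using True by blast
  next
    case False
    then have "prime (int CHAR('a))" using prime_CHAR_semidom[where 'a = 'a] by auto
    moreover have "\<not> int CHAR('a) dvd m" using s m by (simp add: of_int_eq_0_iff_char_dvd)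
    ultimately show ?thesis by blast
  qed
  then obtain p where p: "prime p" "\<not> p dvd m" "CHAR('a) = 0 \<or> int CHAR('a) = p" by blast
  have p0: "p > 0" using p(1) by (simp add: prime_gt_0_int)
  define M where "M = range (\<lambda>z. of_int (p * z) :: 'a)"
  have mem: "of_int z \<in> M \<longleftrightarrow> p dvd z" for z
  proof
    assume "of_int z \<in> M"
    then obtain w where "(of_int z :: 'a) = of_int (p * w)" unfolding M_def by blast
    then have "of_int (z - p * w) = (0 :: 'a)" by simp
    then have "int CHAR('a) dvd z - p * w" by (simp only: of_int_eq_0_iff_char_dvd)
    then have "p dvd z - p * w" using p(3) by auto
    then show "p dvd z" by (metis dvd_diff_commute dvd_triv_left dvd_diffD1 dvd_minus_iff minus_diff_eq dvd_diff_right_iff)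
  next
    assume "p dvd z"
    then obtain w where "z = p * w" by blast
    then show "of_int z \<in> M" unfolding M_def by blast
  qed
  have "finite_residue_field (range of_int) M"
    unfolding finite_residue_field_def
  proof (intro conjI ballI impI)
    show "ideal_in (range of_int) M"
      unfolding ideal_in_def
    proof (intro conjI ballI subsetI)
      show "0 \<in> M" using mem[of 0] by simp
      fix x assume "x \<in> M"
      then obtain a where a: "x = of_int (p * a)" unfolding M_def by blast
      then show "x \<in> range of_int" by blast
      show "x - y \<in> M" if "y \<in> M" for y
      proof -
        obtain b where b: "y = of_int (p * b)" using \<open>y \<in> M\<close> unfolding M_def by blast
        have "x - y = of_int (p * a - p * b)" using a b by simp
        then show ?thesis by (simp only: mem) simp
      qed
      show "r * x \<in> M" if r: "r \<in> range of_int" for r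
      proof -
        obtain b where b: "r = of_int b" using r by blast
        have "r * x = of_int (b * (p * a))" using a b by simp
        then show ?thesis by (simp only: mem) simp
      qed
    qed
    show "finite_index (range of_int) M"
      unfolding finite_index_def
    proof (intro exI conjI ballI)
      show "finite (of_int ` {0..<p})" by simp
      show "of_int ` {0..<p} \<subseteq> range of_int" by blast
      fix x :: 'a assume "x \<in> range of_int"
      then obtain z where "x = of_int z" by blast
      then have "x - of_int (z mod p) = of_int (z - z mod p)" by simp
      then have "x - of_int (z mod p) \<in> M" by (simp only: mem) (simp add: dvd_minus_mod)
      moreover have "z mod p \<in> {0..<p}" using p0 by simp
      ultimately show "\<exists>t\<in>of_int ` {0..<p}. x - t \<in> M" by blast
    qed
    show "1 \<notin> M" using mem[of 1] p(1) by (metis not_prime_unit of_int_1)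
    fix x :: 'a assume "x \<in> range of_int" "x \<notin> M"
    then obtain z where z: "x = of_int z" "\<not> p dvd z" using mem by auto
    then have "coprime p z" using p(1) prime_imp_coprime by blast
    then obtain u v where uv: "u * p + v * z = 1" by (metis bezout_int coprime_imp_gcd_eq_1)
    have "x * of_int v - 1 = of_int (z * v - 1)" by (simp add: z)
    moreover have "z * v - 1 = p * (- u)" using uv by (simp add: algebra_simps)
    ultimately have "x * of_int v - 1 \<in> M" by (metis M_def rangeI)
    then show "\<exists>y\<in>range of_int. x * y - 1 \<in> M" by blast
  qed
  then show "\<exists>M. finite_residue_field (range of_int) M \<and> s \<notin> M" using mem p(2) m(1) by blast
qed

theorem finite_specialization:
  fixes C :: "'a::field set"
  assumes "finite C" "s \<in> C" "s \<noteq> 0"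
  obtains R M where "ring_set R" "C \<subseteq> R" "finite_residue_field R M" "s \<notin> M"
proof -
  have "\<exists>R. has_residue_fields R \<and> C \<subseteq> R"
    using assms(1)
  proof induction
    case empty
    then show ?case using has_residue_fields_of_int by blast
  next
    case (insert a C)
    then obtain R where R: "has_residue_fields R" "C \<subseteq> R" by blast
    then have "ring_set R" by (simp add: has_residue_fields_def)
    then show ?case using has_residue_fields_adjoin[OF R(1), of a] R(2) adjoin_gen adjoin_superset
      by (intro exI[of _ "adjoin R a"]) blast
  qed
  then show thesis using that assms unfolding has_residue_fields_def by blast
qed


section \<open>Polynomial functions\<close>

text \<open>Polynomial functions suffice for algebra over the infinite field \<open>k\<close>, but a
  function does not show its coefficients. An expression has a finite set of constants, which can be
  placed into a finitely generated ring.\<close>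

datatype 'a pexp = Const 'a | Var nat | Add "'a pexp" "'a pexp" | Mult "'a pexp" "'a pexp"

text \<open>The coefficient map \<open>h\<close> lets an expression over \<open>k\<close> be evaluated over \<open>k[X]\<close> as well.\<close>

primrec peval :: "('b \<Rightarrow> 'a::comm_semiring_1) \<Rightarrow> 'b pexp \<Rightarrow> (nat \<Rightarrow> 'a) \<Rightarrow> 'a" where
  "peval h (Const c) x = h c"
| "peval h (Var i) x = x i"
| "peval h (Add e f) x = peval h e x + peval h f x"
| "peval h (Mult e f) x = peval h e x * peval h f x"

definition polyfun :: "((nat \<Rightarrow> 'a::comm_ring_1) \<Rightarrow> 'a) \<Rightarrow> bool" where
  "polyfun f \<longleftrightarrow> (\<exists>e. f = peval id e)"

lemma polyfun_const [intro, simp]: "polyfun (\<lambda>x. c)"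
  unfolding polyfun_def by (rule exI[of _ "Const c"]) auto

lemma polyfun_var [intro, simp]: "polyfun (\<lambda>x. x i)"
  unfolding polyfun_def by (rule exI[of _ "Var i"]) auto

lemma polyfun_add [intro]: "polyfun f \<Longrightarrow> polyfun g \<Longrightarrow> polyfun (\<lambda>x. f x + g x)"
  unfolding polyfun_def by (elim exE, rule exI[of _ "Add _ _"]) auto

lemma polyfun_mult [intro]: "polyfun f \<Longrightarrow> polyfun g \<Longrightarrow> polyfun (\<lambda>x. f x * g x)"
  unfolding polyfun_def by (elim exE, rule exI[of _ "Mult _ _"]) auto

lemma polyfun_minus [intro]: "polyfun f \<Longrightarrow> polyfun (\<lambda>x. - f x)"
  using polyfun_mult[OF polyfun_const[of "-1"], of f] by simp

lemma polyfun_diff [intro]: "polyfun f \<Longrightarrow> polyfun g \<Longrightarrow> polyfun (\<lambda>x. f x - g x)"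
  using polyfun_add[OF _ polyfun_minus, of f g] by simp

lemma polyfun_sum [intro]: "(\<And>i. i \<in> I \<Longrightarrow> polyfun (f i)) \<Longrightarrow> polyfun (\<lambda>x. \<Sum>i\<in>I. f i x)"
  by (induction I rule: infinite_finite_induct) auto

lemma polyfun_prod [intro]: "(\<And>i. i \<in> I \<Longrightarrow> polyfun (f i)) \<Longrightarrow> polyfun (\<lambda>x. \<Prod>i\<in>I. f i x)"
  by (induction I rule: infinite_finite_induct) auto

lemma polyfun_power [intro]: "polyfun f \<Longrightarrow> polyfun (\<lambda>x. f x ^ n)"
  by (induction n) auto

lemma polyfun_comp:
  assumes "polyfun f" "\<And>i. polyfun (\<lambda>x. g x i)"
  shows "polyfun (\<lambda>x. f (g x))"
proof -
  obtain e where e: "f = peval id e" using assms(1) by (auto simp: polyfun_def)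
  have "polyfun (\<lambda>x. peval id e (g x))"
    by (induction e) (auto intro: assms)
  then show ?thesis by (simp add: e)
qed

lemma polyfun_induct [consumes 1, case_names const var add mult]:
  assumes "polyfun f" "\<And>c. P (\<lambda>x. c)" "\<And>i. P (\<lambda>x. x i)"
    "\<And>f g. polyfun f \<Longrightarrow> polyfun g \<Longrightarrow> P f \<Longrightarrow> P g \<Longrightarrow> P (\<lambda>x. f x + g x)"
    "\<And>f g. polyfun f \<Longrightarrow> polyfun g \<Longrightarrow> P f \<Longrightarrow> P g \<Longrightarrow> P (\<lambda>x. f x * g x)"
  shows "P f"
proof -
  obtain e where e: "f = peval id e" using assms(1) by (auto simp: polyfun_def)
  have pf: "polyfun (peval id e)" for e :: "'a pexp" by (auto simp: polyfun_def)
  have "P (peval id e)"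
  proof (induction e)
    case (Const c)
    have eq: "peval id (Const c) = (\<lambda>x. c)" by auto
    show ?case unfolding eq by (rule assms(2))
  next
    case (Var i)
    have eq: "peval id (Var i) = (\<lambda>x. x i)" by auto
    show ?case unfolding eq by (rule assms(3))
  next
    case (Add e1 e2)
    have eq: "peval id (Add e1 e2) = (\<lambda>x. peval id e1 x + peval id e2 x)" by auto
    show ?case unfolding eq by (rule assms(4)[OF pf pf Add])
  next
    case (Mult e1 e2)
    have eq: "peval id (Mult e1 e2) = (\<lambda>x. peval id e1 x * peval id e2 x)" by auto
    show ?case unfolding eq by (rule assms(5)[OF pf pf Mult])
  qed
  then show ?thesis by (simp add: e)
qed

text \<open>Restriction to a line turns questions on nonvanishing in any number of variables into
  questions on the roots of one polynomial.\<close>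

lemma polyfun_line:
  assumes "polyfun f"
  obtains P where "\<And>t. poly P t = f (\<lambda>i. u i + t * v i)"
proof -
  have "\<exists>P. \<forall>t. poly P t = f (\<lambda>i. u i + t * v i)"
    using assms
  proof (induction rule: polyfun_induct)
    case (const c)
    then show ?case by (auto intro: exI[of _ "[:c:]"])
  next
    case (var i)
    then show ?case by (auto intro: exI[of _ "[:u i, v i:]"])
  next
    case (add f g)
    then obtain P Q where "\<forall>t. poly P t = f (\<lambda>i. u i + t * v i)" "\<forall>t. poly Q t = g (\<lambda>i. u i + t * v i)"
      by blast
    then show ?case by (intro exI[of _ "P + Q"]) simp
  next
    case (mult f g)
    then obtain P Q where "\<forall>t. poly P t = f (\<lambda>i. u i + t * v i)" "\<forall>t. poly Q t = g (\<lambda>i. u i + t * v i)"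
      by blast
    then show ?case by (intro exI[of _ "P * Q"]) simp
  qed
  then show thesis using that by blast
qed

lemma infinite_alg_closed: "infinite (UNIV :: 'k::alg_closed_field set)"
proof
  assume fin: "finite (UNIV :: 'k set)"
  define p where "p = (\<Prod>a\<in>(UNIV :: 'k set). [:-a, 1:]) + 1"
  have "degree (\<Prod>a\<in>(UNIV :: 'k set). [:-a, 1:]) = card (UNIV :: 'k set)"
    by (subst degree_prod_eq_sum_degree) auto
  moreover have "card (UNIV :: 'k set) > 0" using fin by (simp add: card_gt_0_iff)
  ultimately have "degree p > 0" unfolding p_def by (subst degree_add_eq_left) auto
  then obtain x where "poly p x = 0" using alg_closed_imp_poly_has_root by blast
  moreover have "poly (\<Prod>a\<in>(UNIV :: 'k set). [:-a, 1:]) x = 0"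
    using fin by (auto simp: poly_prod)
  ultimately show False by (simp add: p_def)
qed

lemma poly_eq_0_infinite:
  fixes P :: "'k::idom poly"
  assumes "infinite S" "\<And>t. t \<in> S \<Longrightarrow> poly P t = 0"
  shows "P = 0"
proof (rule ccontr)
  assume "P \<noteq> 0"
  then have "finite {t. poly P t = 0}" by (rule poly_roots_finite)
  moreover have "S \<subseteq> {t. poly P t = 0}" using assms(2) by auto
  ultimately show False using assms(1) finite_subset by auto
qed

lemma poly_eq_0_alg_closed:
  fixes P :: "'k::alg_closed_field poly"
  assumes "\<And>t. poly P t = 0"
  shows "P = 0"
  by (rule poly_eq_0_infinite[OF infinite_alg_closed]) (rule assms)

text \<open>On the line through a point with \<open>f \<noteq> 0\<close> and a point with \<open>g \<noteq> 0\<close>, both are nonzero polynomials.\<close>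

lemma polyfun_mult_zero:
  fixes f g :: "(nat \<Rightarrow> 'k::alg_closed_field) \<Rightarrow> 'k"
  assumes "polyfun f" "polyfun g" "\<And>x. f x * g x = 0"
  shows "(\<forall>x. f x = 0) \<or> (\<forall>x. g x = 0)"
proof (rule ccontr)
  assume "\<not> ?thesis"
  then obtain u v where uv: "f u \<noteq> 0" "g v \<noteq> 0" by blast
  obtain P where P: "\<And>t. poly P t = f (\<lambda>i. u i + t * (v i - u i))" 
    using polyfun_line[OF assms(1), of u "\<lambda>i. v i - u i"] by blast
  obtain Q where Q: "\<And>t. poly Q t = g (\<lambda>i. u i + t * (v i - u i))" 
    using polyfun_line[OF assms(2), of u "\<lambda>i. v i - u i"] by blast
  have "P \<noteq> 0" using uv(1) P[of 0] by auto
  moreover have "Q \<noteq> 0" using uv(2) Q[of 1] by auto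
  moreover have "P * Q = 0" by (rule poly_eq_0_alg_closed) (simp add: P Q assms)
  ultimately show False by simp
qed

text \<open>A type, so that the univariate polynomials of the library can be used over it.\<close>

typedef (overloaded) ('k::alg_closed_field) pfun = "{f :: (nat \<Rightarrow> 'k) \<Rightarrow> 'k. polyfun f}"
  morphisms papply Abs_pfun
  by (rule exI[of _ "\<lambda>x. 0"]) auto

lemma polyfun_papply [intro, simp]: "polyfun (papply f)"
  using papply[of f] by simp

lemma papply_Abs [simp]: "polyfun f \<Longrightarrow> papply (Abs_pfun f) = f"
  by (simp add: Abs_pfun_inverse)

lemma pfun_eqI: "(\<And>x. papply f x = papply g x) \<Longrightarrow> f = g"
  by (metis papply_inject ext)

instantiation pfun :: (alg_closed_field) idom
begin

definition "zero_pfun = Abs_pfun (\<lambda>x. 0 :: 'a)"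
definition "one_pfun = Abs_pfun (\<lambda>x. 1 :: 'a)"
definition "plus_pfun f g = Abs_pfun (\<lambda>x :: nat \<Rightarrow> 'a. papply f x + papply g x)"
definition "minus_pfun f g = Abs_pfun (\<lambda>x :: nat \<Rightarrow> 'a. papply f x - papply g x)"
definition "uminus_pfun f = Abs_pfun (\<lambda>x :: nat \<Rightarrow> 'a. - papply f x)"
definition "times_pfun f g = Abs_pfun (\<lambda>x :: nat \<Rightarrow> 'a. papply f x * papply g x)"

lemma papply_simps [simp]:
  "papply 0 = (\<lambda>x. 0 :: 'a)" "papply 1 = (\<lambda>x. 1 :: 'a)"
  "papply (f + g) = (\<lambda>x :: nat \<Rightarrow> 'a. papply f x + papply g x)"
  "papply (f - g) = (\<lambda>x :: nat \<Rightarrow> 'a. papply f x - papply g x)"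
  "papply (- f) = (\<lambda>x :: nat \<Rightarrow> 'a. - papply f x)"
  "papply (f * g) = (\<lambda>x :: nat \<Rightarrow> 'a. papply f x * papply g x)"
  unfolding zero_pfun_def one_pfun_def plus_pfun_def minus_pfun_def uminus_pfun_def times_pfun_def
  by (auto intro!: papply_Abs)

instance
proof
  fix a b c :: "'a pfun"
  show "0 \<noteq> (1 :: 'a pfun)"
  proof
    assume "0 = (1 :: 'a pfun)"
    then have "papply 0 = papply (1 :: 'a pfun)" by simp
    then show False by (simp add: fun_eq_iff)
  qed
  assume ab: "a \<noteq> 0" "b \<noteq> 0"
  show "a * b \<noteq> 0"
  proof
    assume "a * b = 0"
    then have "papply (a * b) x = papply 0 x" for x by simp
    then have "papply a x * papply b x = 0" for x by simp
    then have "(\<forall>x. papply a x = 0) \<or> (\<forall>x. papply b x = 0)" by (intro polyfun_mult_zero) auto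
    then show False using ab pfun_eqI[of a 0] pfun_eqI[of b 0] by auto
  qed
qed (auto intro!: pfun_eqI simp: algebra_simps)

end

section \<open>Factoriality of the ring of polynomial functions\<close>

definition pconst :: "'k::alg_closed_field \<Rightarrow> 'k pfun" where "pconst c = Abs_pfun (\<lambda>x. c)"
definition pvar :: "nat \<Rightarrow> 'k::alg_closed_field pfun" where "pvar i = Abs_pfun (\<lambda>x. x i)"

lemma papply_const [simp]: "papply (pconst c) = (\<lambda>x. c)" by (simp add: pconst_def)
lemma papply_var [simp]: "papply (pvar i) = (\<lambda>x. x i)" by (simp add: pvar_def)

lemma papply_power [simp]: "papply (f ^ n) x = papply f x ^ n"
  by (induction n) auto

lemma papply_sum [simp]: "papply (\<Sum>i\<in>I. f i) x = (\<Sum>i\<in>I. papply (f i) x)"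
  by (induction I rule: infinite_finite_induct) auto

text \<open>Transport along an injective homomorphism. It is applied to the evaluation of
  polynomials over \<open>pvars n\<close> at the next variable, which identifies the abstract
  polynomial ring with \<open>pvars (Suc n)\<close>.\<close>

lemma prime_product_image:
  fixes h :: "'a::comm_ring_1 \<Rightarrow> 'b::comm_ring_1"
  assumes S: "ring_set S" and h: "inj_on h S" "h 1 = 1" "\<And>a b. h (a * b) = h a * h b"
    "\<And>a b. h (a - b) = h a - h b"
  shows "ring_set (h ` S)"
    and "p \<in> S \<Longrightarrow> prime_in (h ` S) (h p) \<longleftrightarrow> prime_in S p"
    and "prime_product S n a \<Longrightarrow> prime_product (h ` S) n (h a)"
proof -
  show "ring_set (h ` S)"
    unfolding ring_set_def
  proof (intro conjI ballI)
    show "1 \<in> h ` S" using imageI[OF ring_setD(2)[OF S], of h] by (simp add: h)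
    fix x y assume "x \<in> h ` S" "y \<in> h ` S"
    then obtain a b where "a \<in> S" "b \<in> S" "x = h a" "y = h b" by blast
    then show "x - y \<in> h ` S" "x * y \<in> h ` S"
      using imageI[of "a - b" S h] imageI[of "a * b" S h] ring_setD[OF S] by (simp_all add: h)
  qed
  have h0: "h 0 = 0" using h(4)[of 0 0] by simp
  have dvd: "dvd_in (h ` S) (h a) (h b) \<longleftrightarrow> dvd_in S a b" if "a \<in> S" "b \<in> S" for a b
  proof -
    have "h b = h a * h c \<longleftrightarrow> b = a * c" if "c \<in> S" for c
      using inj_on_eq_iff[OF h(1) \<open>b \<in> S\<close> ring_setD(4)[OF S \<open>a \<in> S\<close> that]] by (simp add: h)
    then show ?thesis unfolding dvd_in_def by auto
  qed
  have prime_iff: "prime_in (h ` S) (h p) \<longleftrightarrow> prime_in S p" if p: "p \<in> S" for p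
  proof -
    have "h p = 0 \<longleftrightarrow> p = 0" using inj_on_eq_iff[OF h(1) p ring_setD(1)[OF S]] by (simp add: h0)
    moreover have "dvd_in (h ` S) (h p) 1 \<longleftrightarrow> dvd_in S p 1"
      using dvd[OF p ring_setD(2)[OF S]] by (simp add: h)
    moreover have "dvd_in (h ` S) (h p) (h a * h b) \<longleftrightarrow> dvd_in S p (a * b)" if "a \<in> S" "b \<in> S" for a b
      using dvd[OF p ring_setD(4)[OF S that]] by (simp add: h)
    ultimately show ?thesis unfolding prime_in_def using p dvd[OF p] by auto
  qed
  then show "p \<in> S \<Longrightarrow> prime_in (h ` S) (h p) \<longleftrightarrow> prime_in S p" .
  show "prime_product (h ` S) n (h a)" if "prime_product S n a"
    using that
  proof induction
    case (unit u)
    then show ?case using dvd[of u 1] ring_setD(2)[OF S] by (auto simp: h intro: prime_product.unit)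
  next
    case (prime p n a)
    then have "p \<in> S" by (simp add: prime_in_def)
    then show ?case using prime prime_product.prime[of "h ` S" "h p" n "h a"] prime_iff[of p] by (simp add: h)
  qed
qed

primrec pvars :: "nat \<Rightarrow> 'k::alg_closed_field pfun set" where
  "pvars 0 = range pconst"
| "pvars (Suc n) = adjoin (pvars n) (pvar n)"

lemma ring_set_pvars: "ring_set (pvars n)"
proof (induction n)
  case 0
  have "pconst 1 = 1" "pconst a - pconst b = pconst (a - b)" "pconst a * pconst b = pconst (a * b)"
    for a b :: 'a
    by (auto intro!: pfun_eqI)
  then show ?case unfolding ring_set_def by auto
qed (simp add: ring_set_adjoin)

lemma pvars_mono: "m \<le> n \<Longrightarrow> pvars m \<subseteq> pvars n"
  by (induction n rule: dec_induct) (auto dest: adjoin_superset[OF ring_set_pvars, THEN subsetD])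

lemma pvars_indep:
  assumes "f \<in> pvars n" "n \<le> i"
  shows "papply f (x(i := t)) = papply f x"
  using assms
proof (induction n arbitrary: f)
  case (Suc n)
  then obtain P where P: "P \<in> polys (pvars n)" "f = poly P (pvar n)" by (auto simp: adjoin_def)
  have *: "papply (poly P (pvar n)) y = (\<Sum>j\<le>degree P. papply (coeff P j) y * y n ^ j)" for y
    by (simp add: poly_altdef)
  have "papply (coeff P j) (x(i := t)) = papply (coeff P j) x" for j
    using Suc.prems by (intro Suc.IH polys_coeff[OF P(1)]) simp
  then show ?case unfolding P(2) * using Suc.prems by simp
qed auto

text \<open>With the other variables fixed at \<open>x\<close>, the coefficients become numbers,
  because they do not involve the variable of index \<open>n\<close>. The polynomial in one variable
  so obtained vanishes on the whole infinite field.\<close>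

lemma pvar_transcendental:
  assumes "P \<in> polys (pvars n)" "poly P (pvar n) = 0"
  shows "P = 0"
proof (rule poly_eqI, rule pfun_eqI)
  fix j x
  define Q where "Q = (\<Sum>j\<le>degree P. monom (papply (coeff P j) x) j)"
  have "poly Q t = 0" for t
  proof -
    have "poly Q t = (\<Sum>j\<le>degree P. papply (coeff P j) (x(n := t)) * t ^ j)"
      unfolding Q_def by (simp add: poly_sum poly_monom pvars_indep[OF polys_coeff[OF assms(1)]])
    also have "\<dots> = papply (poly P (pvar n)) (x(n := t))"
      by (simp add: poly_altdef)
    finally show ?thesis by (simp add: assms)
  qed
  then have "Q = 0" by (rule poly_eq_0_alg_closed)
  then have "coeff Q j = 0" by simp
  then show "papply (coeff P j) x = papply (coeff 0 j) x"
    by (cases "j \<le> degree P") (auto simp: Q_def coeff_sum coeff_eq_0)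
qed

lemma inj_poly_pvar: "inj_on (\<lambda>P. poly P (pvar n)) (polys (pvars n))"
proof (rule inj_onI)
  fix P Q :: "'a pfun poly" assume "P \<in> polys (pvars n)" "Q \<in> polys (pvars n)" "poly P (pvar n) = poly Q (pvar n)"
  then have "P - Q = 0"
    by (intro pvar_transcendental[of _ n] ring_setD[OF ring_set_polys[OF ring_set_pvars]]) auto
  then show "P = Q" by simp
qed

lemma prime_in_pvars_Suc:
  assumes "prime_in (pvars n) p"
  shows "prime_in (pvars (Suc n)) p"
proof -
  have "prime_in (polys (pvars n)) [:p:]" by (rule prime_in_polys[OF ring_set_pvars assms])
  then show ?thesis
    using prime_product_image(2)[OF ring_set_polys[OF ring_set_pvars[of n]] inj_poly_pvar, where p = "[:p:]"]
    by (simp add: adjoin_def prime_in_def[of "polys _"])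
qed

lemma prime_in_pvars_mono: "m \<le> n \<Longrightarrow> prime_in (pvars m) p \<Longrightarrow> prime_in (pvars n) p"
  by (induction n rule: dec_induct) (auto simp del: pvars.simps intro: prime_in_pvars_Suc)

lemma ufd_set_pvars: "ufd_set (pvars n)"
proof (induction n)
  case 0
  have "\<exists>n. prime_product (pvars 0) n f" if f: "f \<in> pvars 0" "f \<noteq> 0" for f :: "'a pfun"
  proof -
    obtain c where c: "f = pconst c" using f by auto
    then have "c \<noteq> 0" using f(2) by (metis papply_const papply_simps(1) pfun_eqI)
    then have "1 = f * pconst (inverse c)" by (auto intro!: pfun_eqI simp: c)
    then have "dvd_in (pvars 0) f 1" by (auto simp: dvd_in_def)
    then show ?thesis using f(1) prime_product.unit by blast
  qed
  then show ?case using ring_set_pvars[of 0] by (simp add: ufd_set_def)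
next
  case (Suc n)
  have "\<exists>m. prime_product (pvars (Suc n)) m f" if f: "f \<in> pvars (Suc n)" "f \<noteq> 0" for f :: "'a pfun"
  proof -
    obtain P where P: "P \<in> polys (pvars n)" "f = poly P (pvar n)" using f by (auto simp: adjoin_def)
    then have "P \<noteq> 0" using f by auto
    then obtain m where "prime_product (polys (pvars n)) m P"
      using ufd_set_polys[OF Suc] P by (auto simp: ufd_set_def)
    then show ?thesis
      using prime_product_image(3)[OF ring_set_polys[OF ring_set_pvars] inj_poly_pvar, where n = m and a = P] P
      by (auto simp: adjoin_def)
  qed
  then show ?case using ring_set_pvars[of "Suc n"] unfolding ufd_set_def by blast
qed

lemma pvars_exhaust: "\<exists>n. f \<in> pvars n"
proof -
  have "\<exists>n. Abs_pfun g \<in> pvars n" if "polyfun g" for g :: "(nat \<Rightarrow> 'a) \<Rightarrow> 'a"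
    using that
  proof (induction rule: polyfun_induct)
    case (const c)
    have "Abs_pfun (\<lambda>x. c) \<in> pvars 0" by (simp flip: pconst_def)
    then show ?case by blast
  next
    case (var i)
    have "pvar i \<in> pvars (Suc i)" by (simp add: adjoin_gen ring_set_pvars)
    then show ?case unfolding pvar_def by blast
  next
    case (add f g)
    then obtain m n where "Abs_pfun f \<in> pvars m" "Abs_pfun g \<in> pvars n" by blast
    then have "Abs_pfun f + Abs_pfun g \<in> pvars (max m n)"
      using pvars_mono[of m "max m n"] pvars_mono[of n "max m n"]
      by (intro ring_setD[OF ring_set_pvars]) auto
    moreover have "Abs_pfun f + Abs_pfun g = Abs_pfun (\<lambda>x. f x + g x)"
      using add by (simp add: plus_pfun_def)
    ultimately show ?case by auto
  next
    case (mult f g)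
    then obtain m n where "Abs_pfun f \<in> pvars m" "Abs_pfun g \<in> pvars n" by blast
    then have "Abs_pfun f * Abs_pfun g \<in> pvars (max m n)"
      using pvars_mono[of m "max m n"] pvars_mono[of n "max m n"]
      by (intro ring_setD[OF ring_set_pvars]) auto
    moreover have "Abs_pfun f * Abs_pfun g = Abs_pfun (\<lambda>x. f x * g x)"
      using mult by (simp add: times_pfun_def)
    ultimately show ?case by auto
  qed
  then show ?thesis using papply_inverse[of f] polyfun_papply[of f] by metis
qed

lemma pvars_exhaust3: "\<exists>n\<ge>m. f \<in> pvars n \<and> g \<in> pvars n \<and> h \<in> pvars n"
proof -
  obtain a b c where abc: "f \<in> pvars a" "g \<in> pvars b" "h \<in> pvars c"
    using pvars_exhaust[of f] pvars_exhaust[of g] pvars_exhaust[of h] by blast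
  let ?n = "m + a + b + c"
  have "pvars a \<subseteq> pvars ?n" "pvars b \<subseteq> pvars ?n" "pvars c \<subseteq> pvars ?n" by (rule pvars_mono, simp)+
  then show ?thesis using abc by (intro exI[of _ ?n]) (auto simp del: pvars.simps)
qed

text \<open>A divisibility relation involves finitely many elements, all contained in one
  \<open>pvars m\<close>, where \<open>p\<close> is still prime.\<close>

lemma prime_elem_pvars:
  assumes "prime_in (pvars n) p"
  shows "prime_in UNIV p"
  unfolding prime_in_def
proof (intro conjI ballI impI)
  show "p \<noteq> 0" using assms by (simp add: prime_in_def)
  show "\<not> dvd_in UNIV p 1"
  proof
    assume "dvd_in UNIV p 1"
    then obtain c where "1 = p * c" by (auto simp: dvd_in_def)
    moreover obtain m where "m \<ge> n" "c \<in> pvars m" using pvars_exhaust3 by blast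
    ultimately show False using prime_in_pvars_mono[OF _ assms] by (auto simp: prime_in_def dvd_in_def)
  qed
  fix a b assume "dvd_in UNIV p (a * b)"
  then obtain c where "a * b = p * c" by (auto simp: dvd_in_def)
  moreover obtain m where m: "m \<ge> n" "a \<in> pvars m" "b \<in> pvars m" "c \<in> pvars m"
    using pvars_exhaust3[of n a b c] by blast
  ultimately have "dvd_in (pvars m) p (a * b)" by (auto simp: dvd_in_def)
  then have "dvd_in (pvars m) p a \<or> dvd_in (pvars m) p b"
    using prime_in_pvars_mono[OF m(1) assms] m by (auto simp: prime_in_def)
  then show "dvd_in UNIV p a \<or> dvd_in UNIV p b" by (auto simp: dvd_in_def)
qed simp

theorem pfun_prime_product:
  fixes f :: "'k::alg_closed_field pfun"
  assumes "f \<noteq> 0"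
  obtains m where "prime_product UNIV m f"
proof -
  obtain n where "f \<in> pvars n" using pvars_exhaust by blast
  then obtain m where "prime_product (pvars n) m f"
    using ufd_set_pvars[of n] assms by (auto simp: ufd_set_def)
  then have "prime_product UNIV m f"
  proof induction
    case (unit u)
    then show ?case by (intro prime_product.unit) (auto simp: dvd_in_def)
  next
    case (prime p k a)
    then show ?case by (intro prime_product.prime prime_elem_pvars[of n])
  qed
  then show thesis by (rule that)
qed

text \<open>Greatest common divisor by induction on the prime factors of \<open>a\<close>.
  Coprimality of \<open>a'\<close> and \<open>b'\<close> is expressed in the form in which it is
  used, and the condition on \<open>k\<close> ensures that dividing by \<open>a'\<close> lowers the
  number of prime factors unless \<open>a'\<close> is a unit.\<close>

lemma prime_product_gcd:
  fixes a b :: "'a::idom"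
  assumes "prime_product UNIV n a"
  obtains g a' b' k where "a = g * a'" "b = g * b'" "prime_product UNIV k g" "k \<le> n"
    "k = n \<Longrightarrow> a' dvd 1" "\<And>c. a' dvd c * b' \<Longrightarrow> a' dvd c"
proof -
  have "\<exists>g a' b' k. a = g * a' \<and> b = g * b' \<and> prime_product UNIV k g \<and> k \<le> n \<and>
    (k = n \<longrightarrow> a' dvd 1) \<and> (\<forall>c. a' dvd c * b' \<longrightarrow> a' dvd c)"
    using assms
  proof induction
    case (unit u)
    then have u: "u dvd 1" by (metis dvd_in_def dvd_triv_left)
    have "prime_product UNIV 0 (1 :: 'a)" by (rule prime_product.unit) (auto simp: dvd_in_def)
    then show ?case using u by (intro exI[of _ 1] exI[of _ u] exI[of _ b] exI[of _ 0]) (auto intro: dvd_trans)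
  next
    case (prime p n a)
    then obtain g a' b' k where *: "a = g * a'" "b = g * b'" "prime_product UNIV k g" "k \<le> n"
      "k = n \<longrightarrow> a' dvd 1" "\<And>c. a' dvd c * b' \<Longrightarrow> a' dvd c" by blast
    have p: "p \<noteq> 0" using prime by (simp add: prime_in_def)
    show ?case
    proof (cases "p dvd b'")
      case True
      then obtain b'' where b'': "b' = p * b''" by blast
      have "a' dvd c" if d: "a' dvd c * b''" for c
      proof (rule *(6))
        have "c * b' = p * (c * b'')" by (simp add: b'' mult.left_commute)
        then show "a' dvd c * b'" using d by (metis dvd_mult)
      qed
      moreover have "p * a = (p * g) * a'" "b = (p * g) * b''" using *(1,2) b'' by (simp_all add: mult_ac)
      ultimately show ?thesis using *(4,5) prime_product.prime[OF prime.hyps(1) *(3)]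
        by (intro exI[of _ "p * g"] exI[of _ a'] exI[of _ b''] exI[of _ "Suc k"]) blast
    next
      case False
      have "p * a' dvd c" if d: "p * a' dvd c * b'" for c
      proof (cases "a' = 0")
        case True
        then show ?thesis using *(6)[of c] d by auto
      next
        case nz: False
        have "a' dvd c" by (rule *(6)) (use d in \<open>rule dvd_mult_right\<close>)
        then obtain c1 where c1: "c = a' * c1" by blast
        obtain e where "c * b' = p * a' * e" using d by blast
        then have "a' * (c1 * b') = a' * (p * e)" by (simp add: c1 mult_ac)
        then have "c1 * b' = p * e" using nz by simp
        then have "dvd_in UNIV p (c1 * b')" by (auto simp: dvd_in_def)
        then have "dvd_in UNIV p c1 \<or> dvd_in UNIV p b'" using prime.hyps(1) by (auto simp: prime_in_def)
        then have "p dvd c1" using False by (auto simp: dvd_in_def)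
        then show ?thesis by (auto simp: c1 mult.commute)
      qed
      moreover have "p * a = g * (p * a')" using *(1) by (simp add: mult_ac)
      moreover have "k \<le> Suc n" "k \<noteq> Suc n" using *(4) by auto
      ultimately show ?thesis using *(2,3)
        by (intro exI[of _ g] exI[of _ "p * a'"] exI[of _ b'] exI[of _ k]) blast
    qed
  qed
  then show thesis using that by blast
qed


section \<open>Normal forms of quadratic forms\<close>

text \<open>Hyperbolic planes plus at most one square: a normal form for every characteristic,
  whereas a sum of squares degenerates to the square of a linear form in characteristic 2. Variables
  of index at least \<open>r\<close> do not occur, so the same function describes cones.\<close>

definition nquad :: "nat \<Rightarrow> (nat \<Rightarrow> 'a::comm_ring_1) \<Rightarrow> 'a" where
  "nquad r x = (\<Sum>i<r div 2. x (2 * i) * x (2 * i + 1)) + (if odd r then x (r - 1) ^ 2 else 0)"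

lemma nquad_0 [simp]: "nquad 0 x = 0"
  and nquad_1 [simp]: "nquad (Suc 0) x = x 0 ^ 2"
  by (simp_all add: nquad_def)

lemma nquad_Suc_Suc: "nquad (Suc (Suc r)) x = x 0 * x 1 + nquad r (\<lambda>i. x (i + 2))"
  by (cases r) (simp_all add: nquad_def sum.lessThan_Suc_shift add.assoc del: sum.lessThan_Suc)

definition lincomb :: "nat \<Rightarrow> (nat \<Rightarrow> 'k::field ^ 'n) \<Rightarrow> (nat \<Rightarrow> 'k) \<Rightarrow> 'k ^ 'n" where
  "lincomb m b x = (\<Sum>i<m. x i *s b i)"

text \<open>A basis of \<open>W\<close> numbered below \<open>m\<close>. Coordinates are infinite
  sequences of which only the first \<open>m\<close> entries matter, so independence constrains only
  these.\<close>

definition frame :: "('k::field ^ 'n::finite) set \<Rightarrow> nat \<Rightarrow> (nat \<Rightarrow> 'k ^ 'n) \<Rightarrow> bool" where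
  "frame W m b \<longleftrightarrow> (\<forall>x. lincomb m b x \<in> W) \<and> (\<forall>w\<in>W. \<exists>x. w = lincomb m b x) \<and>
     (\<forall>x. lincomb m b x = 0 \<longrightarrow> (\<forall>i<m. x i = 0))"

lemma frame_exists:
  fixes W :: "('k::field ^ 'n::finite) set"
  assumes "vec.subspace W"
  obtains m b where "frame W m b"
proof -
  obtain S where S: "S \<subseteq> W" "vec.independent S" "W \<subseteq> vec.span S" "card S = vec.dim W"
    using vec.basis_exists by blast
  have fin: "finite S" using S(2) vec.finiteI_independent by blast
  have span: "vec.span S = W" using S vec.span_minimal[OF S(1) assms] by blast
  obtain b where b: "bij_betw b {..<card S} S" using ex_bij_betw_nat_finite[OF fin] atLeast0LessThan by metis
  have lin: "lincomb (card S) b x = (\<Sum>v\<in>S. x (the_inv_into {..<card S} b v) *s v)" for x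
    unfolding lincomb_def
    by (subst sum.reindex_bij_betw[OF b, symmetric])
      (auto intro!: sum.cong simp: the_inv_into_f_f[OF bij_betw_imp_inj_on[OF b]])
  have "frame W (card S) b"
    unfolding frame_def
  proof (intro conjI allI ballI impI)
    show "lincomb (card S) b x \<in> W" for x
      unfolding lin span[symmetric] by (intro vec.span_sum vec.span_scale vec.span_base)
    show "\<exists>x. w = lincomb (card S) b x" if wW: "w \<in> W" for w
    proof -
      obtain u where u: "w = (\<Sum>v\<in>S. u v *s v)"
        using wW unfolding span[symmetric] vec.span_finite[OF fin] by blast
      have "w = lincomb (card S) b (\<lambda>i. u (b i))"
        unfolding u lincomb_def by (subst sum.reindex_bij_betw[OF b, symmetric]) simp
      then show ?thesis by blast
    qed
    fix x i assume "lincomb (card S) b x = 0" "i < card S"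
    then have "x (the_inv_into {..<card S} b (b i)) = 0"
      unfolding lin using b by (intro vec.independentD[OF S(2) fin subset_refl]) (auto simp: bij_betw_def)
    then show "x i = 0" using \<open>i < card S\<close> by (simp add: the_inv_into_f_f[OF bij_betw_imp_inj_on[OF b]])
  qed
  then show thesis by (rule that)
qed

text \<open>The polar form \<open>B\<close> determines \<open>q\<close> only if 2 is invertible;
  keeping both makes the arguments independent of the characteristic.\<close>

locale quadratic_form =
  fixes q :: "'k::alg_closed_field ^ 'n::finite \<Rightarrow> 'k" and B :: "'k ^ 'n \<Rightarrow> 'k ^ 'n \<Rightarrow> 'k"
  assumes q_scale: "q (c *s v) = c ^ 2 * q v"
    and q_add: "q (v + w) = q v + q w + B v w"
    and B_add: "B (u + v) w = B u w + B v w"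
    and B_scale: "B (c *s v) w = c * B v w"
begin

lemma B_sym: "B v w = B w v"
  using q_add[of v w] q_add[of w v] by (simp add: add.commute)

lemma B_add2: "B w (u + v) = B w u + B w v" and B_scale2: "B w (c *s v) = c * B w v"
  using B_add B_scale B_sym by metis+

lemma B_0 [simp]: "B 0 w = 0" "B w 0 = 0" and q_0 [simp]: "q 0 = 0"
  using B_scale[of 0 0 w] B_scale2[of w 0 0] q_scale[of 0 0] by simp_all

lemma B_diff: "B (u - v) w = B u w - B v w"
  using B_add[of "u - v" v w] by simp

lemma B_diff2: "B w (u - v) = B w u - B w v"
  using B_diff B_sym by metis

lemma B_self: "B v v = 2 * q v"
  using q_add[of v v] q_scale[of 2 v] by (simp add: vec.scale_left_distrib[of 1 1 v, simplified])

text \<open>A vector \<open>e\<close> with \<open>q e = 0\<close> that is not orthogonal to all of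
  \<open>W\<close> lies in a hyperbolic plane, whose orthogonal complement is treated by induction.
  If there is no such vector, the zeros of \<open>q\<close> in \<open>W\<close> form a subspace
  orthogonal to everything, which is either all of \<open>W\<close> or a hyperplane with a square
  left over.\<close>

theorem normal_form:
  assumes "vec.subspace W"
  obtains m r b where "frame W m b" "r \<le> m" "\<And>x. q (lincomb m b x) = nquad r x"
proof -
  have "\<exists>m r b. frame W m b \<and> r \<le> m \<and> (\<forall>x. q (lincomb m b x) = nquad r x)"
    using assms
  proof (induction "vec.dim W" arbitrary: W rule: less_induct)
    case less
    note W = less.prems
    consider (zero) "\<forall>w\<in>W. q w = 0"
      | (hyperbolic) e w where "e \<in> W" "w \<in> W" "q e = 0" "B e w \<noteq> 0"
      | (square) v where "v \<in> W" "q v \<noteq> 0" "\<And>e w. e \<in> W \<Longrightarrow> w \<in> W \<Longrightarrow> q e = 0 \<Longrightarrow> B e w = 0"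
      by blast
    then show ?case
    proof cases
      case zero
      obtain m b where "frame W m b" using frame_exists[OF W] .
      then show ?thesis using zero by (intro exI[of _ m] exI[of _ 0] exI[of _ b]) (auto simp: frame_def)
    next
      case hyperbolic
      define w' where "w' = (1 / B e w) *s w"
      \<comment> \<open>Subtracting this multiple of \<open>e\<close> makes the partner isotropic,
        since \<open>B e w' = 1\<close>; no division by 2 occurs.\<close>
      define f where "f = w' - q w' *s e"
      have w': "w' \<in> W" "B e w' = 1"
        unfolding w'_def using hyperbolic by (auto simp: B_scale2 intro: vec.subspace_scale[OF W])
      have fW: "f \<in> W"
        unfolding f_def using hyperbolic w' by (intro vec.subspace_diff[OF W] vec.subspace_scale[OF W])
      have ee: "B e e = 0" using B_self hyperbolic by simp
      have ef: "B e f = 1" unfolding f_def by (simp add: B_diff2 B_scale2 w' ee)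
      have "q w' = q (f + q w' *s e)" by (simp add: f_def)
      also have "\<dots> = q f + q w'"
        using ef by (simp add: q_add q_scale hyperbolic B_scale2 B_sym[of f e])
      finally have qf: "q f = 0" by simp
      have ff: "B f f = 0" using B_self qf by simp
      define W' where "W' = {w \<in> W. B e w = 0 \<and> B f w = 0}"
      have W': "vec.subspace W'"
        unfolding W'_def by (rule vec.subspaceI)
          (auto simp: B_add2 B_scale2 intro: vec.subspace_0[OF W] vec.subspace_add[OF W] vec.subspace_scale[OF W])
      have "e \<notin> W'" using ef by (simp add: W'_def B_sym[of f e])
      then have "W' \<subset> W" using hyperbolic by (auto simp: W'_def)
      then have "vec.dim W' < vec.dim W"
        using vec.dim_psubset[of W' W] W W' by (simp add: vec.span_eq_iff[THEN iffD2])
      then obtain m r b where IH: "frame W' m b" "r \<le> m" "\<And>x. q (lincomb m b x) = nquad r x"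
        using less.hyps W' by blast
      define b' where "b' i = (case i of 0 \<Rightarrow> e | Suc 0 \<Rightarrow> f | Suc (Suc i) \<Rightarrow> b i)" for i
      have lin: "lincomb (Suc (Suc m)) b' x = x 0 *s e + x 1 *s f + lincomb m b (\<lambda>i. x (i + 2))" for x
        unfolding lincomb_def by (simp add: sum.lessThan_Suc_shift b'_def add.assoc del: sum.lessThan_Suc)
      have Bz: "B e (lincomb m b x) = 0" "B f (lincomb m b x) = 0" "lincomb m b x \<in> W" for x
        using IH(1) by (auto simp: frame_def W'_def)
      have "frame W (Suc (Suc m)) b'"
        unfolding frame_def
      proof (intro conjI allI ballI impI)
        show "lincomb (Suc (Suc m)) b' x \<in> W" for x
          unfolding lin using hyperbolic fW Bz
          by (intro vec.subspace_add[OF W] vec.subspace_scale[OF W])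
        show "\<exists>x. w = lincomb (Suc (Suc m)) b' x" if "w \<in> W" for w
        proof -
          \<comment> \<open>The component of \<open>w\<close> orthogonal to the plane: as
            \<open>e\<close> and \<open>f\<close> are isotropic with \<open>B e f = 1\<close>, the
            coefficient of \<open>e\<close> is \<open>B f w\<close> and that of \<open>f\<close> is
            \<open>B e w\<close>.\<close>
          let ?z = "w - (B f w *s e + B e w *s f)"
          have "?z \<in> W'"
            unfolding W'_def using that hyperbolic fW ee ef ff
            by (auto simp: B_add2 B_scale2 B_diff2 B_sym[of f e]
                intro!: vec.subspace_add[OF W] vec.subspace_scale[OF W] vec.subspace_diff[OF W])
          then obtain x where "?z = lincomb m b x" using IH(1) unfolding frame_def by blast
          then have "w = lincomb (Suc (Suc m)) b' (case_nat (B f w) (case_nat (B e w) x))"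
            unfolding lin by (simp add: algebra_simps)
          then show ?thesis by blast
        qed
        fix x i assume x: "lincomb (Suc (Suc m)) b' x = 0" "i < Suc (Suc m)"
        have "B f (lincomb (Suc (Suc m)) b' x) = x 0" "B e (lincomb (Suc (Suc m)) b' x) = x 1"
          unfolding lin by (simp_all add: B_add2 B_scale2 ee ef ff B_sym[of f e] Bz)
        then have x01: "x 0 = 0" "x 1 = 0" using x by simp_all
        then have "lincomb m b (\<lambda>i. x (i + 2)) = 0" using x unfolding lin by simp
        then have "\<forall>i<m. x (i + 2) = 0" using IH(1) unfolding frame_def by blast
        then show "x i = 0" using x01 x(2) by (cases i rule: nat.exhaust; cases "i - 1") auto
      qed
      moreover have "q (lincomb (Suc (Suc m)) b' x) = nquad (Suc (Suc r)) x" for x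
        unfolding lin nquad_Suc_Suc
        by (simp add: q_add q_scale B_add B_scale B_scale2 ef Bz qf hyperbolic IH)
      ultimately show ?thesis using IH(2)
        by (intro exI[of _ "Suc (Suc m)"] exI[of _ "Suc (Suc r)"] exI[of _ b']) auto
    next
      case square
      obtain s where s: "s ^ 2 = q v" using nth_root_exists[of 2 "q v"] by auto
      define u where "u = (1 / s) *s v"
      have u: "u \<in> W" "q u = 1"
        using square s by (auto simp: u_def q_scale power_divide intro: vec.subspace_scale[OF W])
      define W0 where "W0 = {w \<in> W. q w = 0}"
      have W0: "vec.subspace W0"
        unfolding W0_def by (rule vec.subspaceI)
          (auto simp: q_add q_scale square(3) intro: vec.subspace_0[OF W] vec.subspace_add[OF W] vec.subspace_scale[OF W])
      obtain m b where b: "frame W0 m b" using frame_exists[OF W0] .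
      have z: "lincomb m b x \<in> W" "q (lincomb m b x) = 0" for x
        using b by (auto simp: frame_def W0_def)
      define b' where "b' i = (case i of 0 \<Rightarrow> u | Suc i \<Rightarrow> b i)" for i
      have lin: "lincomb (Suc m) b' x = x 0 *s u + lincomb m b (\<lambda>i. x (Suc i))" for x
        unfolding lincomb_def by (simp add: sum.lessThan_Suc_shift b'_def del: sum.lessThan_Suc)
      have qlin: "q (lincomb (Suc m) b' x) = x 0 ^ 2" for x
        unfolding lin by (simp add: q_add q_scale u z B_sym[of _ "lincomb m b _"] square(3) vec.subspace_scale[OF W])
      have "frame W (Suc m) b'"
        unfolding frame_def
      proof (intro conjI allI ballI impI)
        show "lincomb (Suc m) b' x \<in> W" for x
          unfolding lin using u z by (intro vec.subspace_add[OF W] vec.subspace_scale[OF W])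
        show "\<exists>x. w = lincomb (Suc m) b' x" if "w \<in> W" for w
        proof -
          \<comment> \<open>\<open>q (w + t *s u)\<close> is a monic quadratic polynomial in
            \<open>t\<close>. A root shows that \<open>u\<close> together with \<open>W0\<close>
            spans \<open>W\<close>.\<close>
          obtain t where "poly [:q w, B w u, 1:] t = 0"
            using alg_closed_imp_poly_has_root[of "[:q w, B w u, 1:]"] by auto
          then have "q (w + t *s u) = 0"
            by (simp add: q_add q_scale B_scale2 u algebra_simps power2_eq_square)
          then have "w + t *s u \<in> W0"
            using that u by (auto simp: W0_def intro: vec.subspace_add[OF W] vec.subspace_scale[OF W])
          then obtain x where "w + t *s u = lincomb m b x" using b unfolding frame_def by blast
          then have "w = lincomb (Suc m) b' (case_nat (- t) x)"
            unfolding lin by (simp add: algebra_simps eq_neg_iff_add_eq_0)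
          then show ?thesis by blast
        qed
        fix x i assume x: "lincomb (Suc m) b' x = 0" "i < Suc m"
        then have x0: "x 0 = 0" using qlin[of x] by simp
        then have "lincomb m b (\<lambda>i. x (Suc i)) = 0" using x unfolding lin by simp
        then have "\<forall>i<m. x (Suc i) = 0" using b unfolding frame_def by blast
        then show "x i = 0" using x0 x(2) by (cases i) auto
      qed
      then show ?thesis using qlin
        by (intro exI[of _ "Suc m"] exI[of _ "Suc 0"] exI[of _ b']) auto
    qed
  qed
  then show thesis using that by blast
qed

end

section \<open>Homogeneous polynomials of degree 2 as quadratic forms\<close>

lemma quadratic_form_monomial: "quadratic_form (\<lambda>v. v $ i * v $ j) (\<lambda>v w. v $ i * w $ j + w $ i * v $ j)"
  by unfold_locales (simp_all add: algebra_simps power2_eq_square)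

lemma quadratic_form_cmult:
  assumes "quadratic_form q B"
  shows "quadratic_form (\<lambda>v. c * q v) (\<lambda>v w. c * B v w)"
proof -
  interpret quadratic_form q B by fact
  show ?thesis by unfold_locales (simp_all add: q_scale q_add B_add B_scale algebra_simps)
qed

lemma quadratic_form_sum:
  assumes "\<And>i. i \<in> I \<Longrightarrow> quadratic_form (q i) (B i)"
  shows "quadratic_form (\<lambda>v. \<Sum>i\<in>I. q i v) (\<lambda>v w. \<Sum>i\<in>I. B i v w)"
  by unfold_locales
    (auto simp: quadratic_form.q_scale[OF assms] quadratic_form.q_add[OF assms] quadratic_form.B_add[OF assms]
      quadratic_form.B_scale[OF assms] sum_distrib_left sum.distrib intro!: sum.cong)

lemma eval_monomial_degree_2:
  fixes m :: "'n::finite \<Rightarrow>\<^sub>0 nat"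
  assumes "monomial_degree m = 2"
  obtains i j where "\<And>v :: 'k::comm_semiring_1 ^ 'n. eval_monomial m v = v $ i * v $ j"
proof -
  let ?l = "Poly_Mapping.lookup m"
  have sum: "(\<Sum>i\<in>UNIV. ?l i) = 2" using assms by (simp add: monomial_degree_def)
  then obtain i where i: "?l i \<noteq> 0" by (metis sum.neutral zero_neq_numeral)
  have sum_i: "?l i + (\<Sum>j\<in>UNIV - {i}. ?l j) = 2" using sum by (simp add: sum.remove[of UNIV i])
  show thesis
  proof (cases "?l i = 1")
    case True
    then have s1: "(\<Sum>j\<in>UNIV - {i}. ?l j) = 1" using sum_i by simp
    then obtain j where j: "j \<noteq> i" "?l j \<noteq> 0" by (metis DiffE insertI1 sum.neutral zero_neq_one)
    have "?l j + (\<Sum>k\<in>UNIV - {i} - {j}. ?l k) = 1" using s1 j by (simp add: sum.remove[of "UNIV - {i}" j])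
    moreover have "?l j \<ge> 1" using j by simp
    ultimately have "?l j = 1" "(\<Sum>k\<in>UNIV - {i} - {j}. ?l k) = 0" by linarith+
    then have l: "?l j = 1" "\<And>k. k \<noteq> i \<Longrightarrow> k \<noteq> j \<Longrightarrow> ?l k = 0" by auto
    have "eval_monomial m v = v $ i * v $ j" for v :: "'k ^ 'n"
    proof -
      have "eval_monomial m v = v $ i ^ ?l i * (v $ j ^ ?l j * (\<Prod>k\<in>UNIV - {i} - {j}. v $ k ^ ?l k))"
        unfolding eval_monomial_def using j by (simp add: prod.remove[of UNIV i] prod.remove[of "UNIV - {i}" j])
      also have "(\<Prod>k\<in>UNIV - {i} - {j}. v $ k ^ ?l k) = 1" by (rule prod.neutral) (auto simp: l)
      finally show ?thesis using True l by simp
    qed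
    then show thesis by (rule that)
  next
    case False
    moreover have "?l i \<ge> 1" using i by simp
    ultimately have "?l i = 2" "(\<Sum>j\<in>UNIV - {i}. ?l j) = 0" using sum_i by linarith+
    then have l: "?l i = 2" "\<And>k. k \<noteq> i \<Longrightarrow> ?l k = 0" by auto
    have "eval_monomial m v = v $ i * v $ i" for v :: "'k ^ 'n"
    proof -
      have "eval_monomial m v = v $ i ^ ?l i * (\<Prod>k\<in>UNIV - {i}. v $ k ^ ?l k)"
        unfolding eval_monomial_def by (simp add: prod.remove[of UNIV i])
      also have "(\<Prod>k\<in>UNIV - {i}. v $ k ^ ?l k) = 1" by (rule prod.neutral) (auto simp: l)
      finally show ?thesis using l by (simp add: power2_eq_square)
    qed
    then show thesis by (rule that)
  qed
qed

lemma homogeneous_2_quadratic_form: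
  fixes p :: "('n::finite, 'k::alg_closed_field) mpoly"
  assumes "homogeneous 2 p"
  obtains B where "quadratic_form (eval_mpoly p) B"
proof -
  have "\<exists>B :: 'k ^ 'n \<Rightarrow> 'k ^ 'n \<Rightarrow> 'k. quadratic_form (\<lambda>v. Poly_Mapping.lookup p m * eval_monomial m v) B"
    if m: "m \<in> Poly_Mapping.keys p" for m
  proof -
    have "monomial_degree m = 2" using assms m by (simp add: homogeneous_def)
    then obtain i j where "\<And>v :: 'k ^ 'n. eval_monomial m v = v $ i * v $ j"
      using eval_monomial_degree_2[of m, where 'k = 'k] by blast
    then have eq: "(\<lambda>v :: 'k ^ 'n. Poly_Mapping.lookup p m * eval_monomial m v) =
        (\<lambda>v. Poly_Mapping.lookup p m * (v $ i * v $ j))" by auto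
    show ?thesis unfolding eq by (rule exI, rule quadratic_form_cmult, rule quadratic_form_monomial)
  qed
  then obtain B :: "_ \<Rightarrow> 'k ^ 'n \<Rightarrow> 'k ^ 'n \<Rightarrow> 'k" where
    "\<And>m. m \<in> Poly_Mapping.keys p \<Longrightarrow> quadratic_form (\<lambda>v. Poly_Mapping.lookup p m * eval_monomial m v) (B m)"
    by metis
  from quadratic_form_sum[OF this] show thesis by (intro that) (simp add: eval_mpoly_def[abs_def])
qed

text \<open>Induction over the variables \<open>S\<close>, separating the powers of one variable at a time.\<close>

lemma monomials_independent:
  fixes c :: "('n \<Rightarrow> nat) \<Rightarrow> 'k::alg_closed_field"
  assumes "finite S" "finite K"
    and "\<And>m m'. m \<in> K \<Longrightarrow> m' \<in> K \<Longrightarrow> (\<And>i. i \<in> S \<Longrightarrow> m i = m' i) \<Longrightarrow> m = m'"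
    and "\<And>x :: 'n \<Rightarrow> 'k. (\<Sum>m\<in>K. c m * (\<Prod>i\<in>S. x i ^ m i)) = 0"
    and "m \<in> K"
  shows "c m = 0"
  using assms
proof (induction S arbitrary: K m rule: finite_induct)
  case empty
  then have "K = {m}" by auto
  then show ?case using empty(3)[of undefined] by simp
next
  case (insert i S)
  define L where "L j = {m \<in> K. m i = j}" for j
  have "(\<Sum>m\<in>L j. c m * (\<Prod>i\<in>S. x i ^ m i)) = 0" for j x
  proof -
    let ?a = "\<lambda>m. c m * (\<Prod>i\<in>S. x i ^ m i)"
    define P where "P = (\<Sum>m\<in>K. monom (?a m) (m i))"
    have "poly P t = 0" for t
    proof -
      have "poly P t = (\<Sum>m\<in>K. c m * (\<Prod>k\<in>insert i S. (x(i := t)) k ^ m k))"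
        unfolding P_def poly_sum poly_monom
      proof (rule sum.cong)
        fix m
        have "(\<Prod>k\<in>S. (x(i := t)) k ^ m k) = (\<Prod>k\<in>S. x k ^ m k)"
          using insert(2) by (intro prod.cong) auto
        then show "?a m * t ^ m i = c m * (\<Prod>k\<in>insert i S. (x(i := t)) k ^ m k)"
          using insert(1,2) by (simp add: mult_ac)
      qed simp
      then show ?thesis using insert.prems(3) by simp
    qed
    then have "P = 0" by (rule poly_eq_0_alg_closed)
    then have "coeff P j = 0" by simp
    moreover have "coeff P j = (\<Sum>m\<in>L j. ?a m)"
      unfolding P_def coeff_sum L_def using insert.prems(1) by (auto simp: sum.inter_filter intro!: sum.cong)
    ultimately show ?thesis by simp
  qed
  moreover have "u = v" if "u \<in> L (m i)" "v \<in> L (m i)" "\<And>k. k \<in> S \<Longrightarrow> u k = v k" for u v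
    using that by (intro insert.prems(2)) (auto simp: L_def)
  ultimately show ?case
    using insert.prems(1,4) by (intro insert.IH[of "L (m i)" m]) (auto simp: L_def)
qed

text \<open>Irreducibility concerns formal polynomials while the normal form is an identity of
  values; over an infinite field the values determine the polynomial.\<close>

lemma eval_mpoly_eq_imp_eq:
  fixes p p' :: "('n::finite, 'k::alg_closed_field) mpoly"
  assumes "\<And>v. eval_mpoly p v = eval_mpoly p' v"
  shows "p = p'"
proof -
  let ?A = "Poly_Mapping.keys p \<union> Poly_Mapping.keys p'"
  let ?c = "\<lambda>m. Poly_Mapping.lookup p m - Poly_Mapping.lookup p' m"
  have "?c m = 0" if m: "m \<in> ?A" for m
  proof -
    have inj: "inj Poly_Mapping.lookup" by (simp add: inj_on_def lookup_inject)
    let ?K = "Poly_Mapping.lookup ` ?A"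
    have "?c (inv Poly_Mapping.lookup (Poly_Mapping.lookup m)) = 0"
    proof (rule monomials_independent[of UNIV ?K "\<lambda>l. ?c (inv Poly_Mapping.lookup l)" "Poly_Mapping.lookup m"])
      fix x :: "'n \<Rightarrow> 'k"
      have "(\<Sum>l\<in>?K. ?c (inv Poly_Mapping.lookup l) * (\<Prod>i\<in>UNIV. x i ^ l i)) =
          (\<Sum>m\<in>?A. ?c m * eval_monomial m (\<chi> i. x i))"
        by (subst sum.reindex[OF inj_on_subset[OF inj subset_UNIV]]) (simp add: inv_f_f[OF inj] eval_monomial_def)
      also have "\<dots> = eval_mpoly p (\<chi> i. x i) - eval_mpoly p' (\<chi> i. x i)"
        by (simp add: eval_mpoly_superset[of ?A] sum_subtractf left_diff_distrib)
      finally show "(\<Sum>l\<in>?K. ?c (inv Poly_Mapping.lookup l) * (\<Prod>i\<in>UNIV. x i ^ l i)) = 0"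
        by (simp add: assms)
    qed (use m in auto)
    then show ?thesis by (simp add: inv_f_f[OF inj])
  qed
  then have "Poly_Mapping.lookup p m = Poly_Mapping.lookup p' m" for m
    by (cases "m \<in> ?A") (auto simp: in_keys_iff)
  then show ?thesis by (rule poly_mapping_eqI)
qed


section \<open>Functions without zeros off a quadric\<close>

text \<open>The coefficient ring for regarding a polynomial function as a polynomial in the single
  variable of index \<open>i\<close>.\<close>

definition indep :: "nat \<Rightarrow> 'k::alg_closed_field pfun set" where
  "indep i = {f. \<forall>x t. papply f (x(i := t)) = papply f x}"

lemma ring_set_indep: "ring_set (indep i)"
  by (auto simp: ring_set_def indep_def)

lemma adjoin_indep: "f \<in> adjoin (indep i) (pvar i)"
proof -
  note R = ring_set_adjoin[OF ring_set_indep[of i], of "pvar i"]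
  have "Abs_pfun g \<in> adjoin (indep i) (pvar i)" if "polyfun g" for g :: "(nat \<Rightarrow> 'a) \<Rightarrow> 'a"
    using that
  proof (induction rule: polyfun_induct)
    case (const c)
    have "pconst c \<in> indep i" by (simp add: indep_def)
    then show ?case using adjoin_superset[OF ring_set_indep] unfolding pconst_def by blast
  next
    case (var j)
    show ?case
    proof (cases "j = i")
      case True
      then show ?thesis using adjoin_gen[OF ring_set_indep, of "pvar i" i] by (simp add: pvar_def)
    next
      case False
      then have "pvar j \<in> indep i" by (simp add: indep_def)
      then show ?thesis using adjoin_superset[OF ring_set_indep] unfolding pvar_def by blast
    qed
  next
    case (add f g)
    have "Abs_pfun f + Abs_pfun g = Abs_pfun (\<lambda>x. f x + g x)"
      using add by (simp add: plus_pfun_def)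
    then show ?case using ring_setD(6)[OF R add(3,4)] by simp
  next
    case (mult f g)
    have "Abs_pfun f * Abs_pfun g = Abs_pfun (\<lambda>x. f x * g x)"
      using mult by (simp add: times_pfun_def)
    then show ?case using ring_setD(4)[OF R mult(3,4)] by simp
  qed
  from this[OF polyfun_papply[of f]] show ?thesis by (simp add: papply_inverse)
qed

lemma single_root:
  fixes p :: "'k::alg_closed_field poly"
  assumes "p \<noteq> 0" "\<And>t. poly p t = 0 \<Longrightarrow> t = a"
  shows "p = smult (lead_coeff p) ([:-a, 1:] ^ degree p)"
  using assms
proof (induction "degree p" arbitrary: p)
  case 0
  then obtain c where "p = [:c:]" by (metis degree_eq_zeroE)
  then show ?case by (simp add: one_pCons)
next
  case (Suc n)
  then obtain t where "poly p t = 0" using alg_closed_imp_poly_has_root[of p] by auto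
  then have "poly p a = 0" using Suc.prems by metis
  then obtain p' where p': "p = [:-a, 1:] * p'" using poly_eq_0_iff_dvd by blast
  have p'0: "p' \<noteq> 0"
  proof
    assume "p' = 0"
    then have "p = 0" using p' by simp
    then show False using Suc.prems(1) by simp
  qed
  have deg: "degree p = Suc (degree p')" unfolding p' using p'0 by (subst degree_mult_eq) auto
  have lc: "lead_coeff p = lead_coeff p'" unfolding p' by (simp only: lead_coeff_mult) simp
  have "p' = smult (lead_coeff p') ([:-a, 1:] ^ degree p')"
  proof (rule Suc.hyps(1))
    show "n = degree p'" using Suc.hyps(2) deg by simp
    show "t = a" if "poly p' t = 0" for t using Suc.prems(2)[of t] that by (simp add: p')
  qed fact
  then have "[:-a, 1:] * p' = smult (lead_coeff p') ([:-a, 1:] ^ Suc (degree p'))"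
    by (metis mult_smult_right power_Suc)
  then show ?case using p' deg lc by metis
qed

lemma polyfun_nquad: "(\<And>i. polyfun (\<lambda>x. g x i)) \<Longrightarrow> polyfun (\<lambda>x. nquad r (g x))"
  unfolding nquad_def by (cases "odd r") (auto intro!: polyfun_add polyfun_sum polyfun_mult polyfun_power)

definition pquad :: "nat \<Rightarrow> 'k::alg_closed_field pfun" where
  "pquad r = Abs_pfun (nquad r)"

lemma papply_pquad [simp]: "papply (pquad r) = nquad r"
  unfolding pquad_def using polyfun_nquad[of "\<lambda>x. x" r] by (intro papply_Abs) auto

text \<open>For \<open>r = 3\<close> the entry of index 2 is the squared variable, for larger
  \<open>r\<close> the indices 2 and 3 form a hyperbolic pair. Besides showing that the form is
  nonzero, the point has \<open>x 1 = 0\<close>, which rules out a factor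
  \<open>x 1\<close>.\<close>

lemma nquad_witness:
  assumes "r \<ge> 3"
  shows "nquad r (\<lambda>i. if i = 2 \<or> i = 3 then 1 else 0) = (1 :: 'a::comm_ring_1)"
proof -
  obtain r' where r': "r = Suc (Suc (Suc r'))" using assms by (metis numeral_3_eq_3 Suc_le_D Suc_le_mono)
  show ?thesis
  proof (cases r')
    case 0
    then show ?thesis unfolding r' nquad_Suc_Suc by simp
  next
    case (Suc r'')
    have "nquad r'' (\<lambda>i. 0 :: 'a) = 0" by (simp add: nquad_def)
    then show ?thesis unfolding r' Suc nquad_Suc_Suc by simp
  qed
qed

text \<open>
  For fixed \<open>x 1 \<noteq> 0\<close> the quadric meets the line in direction \<open>x 0\<close> in a single point, so \<open>h\<close>
  restricted to that line is a multiple of a power of a linear form; comparing leading coefficients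
  gives \<open>x 1 ^ D * h = g * q ^ D\<close> with \<open>g\<close> nonvanishing for \<open>x 1 \<noteq> 0\<close>.
\<close>

theorem nonvanishing_off_quadric:
  fixes h :: "'k::alg_closed_field pfun"
  assumes r: "r \<ge> 3" and nz: "\<And>x. nquad r x \<noteq> 0 \<Longrightarrow> papply h x \<noteq> 0"
  obtains c D where "c \<noteq> 0" "\<And>x. papply h x = c * nquad r x ^ D"
proof -
  obtain r' where r': "r = Suc (Suc r')" "r' > 0"
    using r by (metis add_2_eq_Suc' diff_add less_imp_le_nat numeral_2_eq_2 numeral_3_eq_3 Suc_le_D Suc_le_lessD Suc_le_mono zero_less_Suc)
  define b where "b x = nquad r' (\<lambda>i. x (i + 2))" for x :: "nat \<Rightarrow> 'k"
  have q: "nquad r x = x 0 * x 1 + b x" for x :: "nat \<Rightarrow> 'k" by (simp add: r' nquad_Suc_Suc b_def)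
  have b0: "b (x(0 := t)) = b x" for x t by (simp add: b_def)
  define w :: "nat \<Rightarrow> 'k" where "w i = (if i = 2 \<or> i = 3 then 1 else 0)" for i
  have w: "nquad r w \<noteq> 0" "w 1 = 0" using nquad_witness[OF r, where 'a = 'k] by (simp_all add: w_def[abs_def])
  have h0: "h \<noteq> 0" using nz[OF w(1)] by auto
  obtain P where P: "P \<in> polys (indep 0)" "h = poly P (pvar 0)"
    using adjoin_indep[of h 0] unfolding adjoin_def by blast
  have "P \<noteq> 0" using P h0 by auto
  define D where "D = degree P"
  define g where "g = lead_coeff P"
  have g: "g \<noteq> 0" "papply g (x(0 := t)) = papply g x" for x t
    using \<open>P \<noteq> 0\<close> polys_coeff[OF P(1)] by (simp_all add: g_def indep_def)
  define S where "S x = (\<Sum>j\<le>D. monom (papply (coeff P j) x) j)" for x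
  have S: "poly (S x) t = papply h (x(0 := t))" for x t
  proof -
    have "papply (coeff P j) (x(0 := t)) = papply (coeff P j) x" for j
      using polys_coeff[OF P(1)] by (simp add: indep_def)
    then show ?thesis by (simp add: S_def P(2) poly_altdef[of P] poly_sum poly_monom D_def)
  qed
  have coS: "coeff (S x) j = (if j \<le> D then papply (coeff P j) x else 0)" for x j
    by (auto simp: S_def coeff_sum)
  have root: "t = - b x / x 1" if "x 1 \<noteq> 0" "poly (S x) t = 0" for x t
  proof -
    have "nquad r (x(0 := t)) = 0" using nz[of "x(0 := t)"] that by (auto simp: S)
    then have "t * x 1 + b x = 0" using b0[of x t] by (simp add: q)
    then show ?thesis using that by (simp add: field_simps add_eq_0_iff)
  qed
  have key: "x 1 ^ D * papply h x = papply g x * nquad r x ^ D" if x: "x 1 \<noteq> 0" "papply g x \<noteq> 0" for x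
  proof -
    have "degree (S x) \<le> D" by (rule degree_le) (simp add: coS)
    moreover have cD: "coeff (S x) D = papply g x" by (simp add: coS g_def D_def)
    ultimately have deg: "degree (S x) = D" using x le_degree[of "S x" D] by simp
    then have S0: "S x \<noteq> 0" and lc: "lead_coeff (S x) = papply g x" using cD x by auto
    have "S x = smult (lead_coeff (S x)) ([:- (- b x / x 1), 1:] ^ degree (S x))"
      using root[of x, OF x(1)] by (intro single_root S0)
    then have "S x = smult (papply g x) ([:- (- b x / x 1), 1:] ^ D)" unfolding lc unfolding deg .
    then have "poly (S x) (x 0) = papply g x * (x 0 + b x / x 1) ^ D" by (simp add: poly_power algebra_simps)
    then have "papply h x = papply g x * (x 0 + b x / x 1) ^ D" by (simp add: S)
    then have "x 1 ^ D * papply h x = papply g x * (x 1 * (x 0 + b x / x 1)) ^ D"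
      by (simp add: power_mult_distrib mult_ac)
    moreover have "x 1 * (x 0 + b x / x 1) = nquad r x" using x by (simp add: q field_simps)
    ultimately show ?thesis by simp
  qed
  \<comment> \<open>\<open>key\<close> is known where \<open>x 1\<close> and \<open>g\<close> do not
    vanish. Multiplication by both makes it an identity everywhere, from which nonzero factors
    cancel in the integral domain.\<close>
  have "pvar 1 * g * (pvar 1 ^ D * h - g * pquad r ^ D) = 0"
  proof (rule pfun_eqI)
    show "papply (pvar 1 * g * (pvar 1 ^ D * h - g * pquad r ^ D)) x = papply 0 x" for x
      using key[of x] by (cases "x 1 = 0 \<or> papply g x = 0") auto
  qed
  moreover have pv: "(pvar 1 :: 'k pfun) \<noteq> 0"
  proof
    assume "(pvar 1 :: 'k pfun) = 0"
    then have "papply (pvar 1 :: 'k pfun) (\<lambda>_. 1) = papply 0 (\<lambda>_. 1)" by simp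
    then show False by simp
  qed
  ultimately have eq: "pvar 1 ^ D * h = g * pquad r ^ D" using g(1) by simp
  have eqx: "x 1 ^ D * papply h x = papply g x * nquad r x ^ D" for x
    using arg_cong[OF eq, of "\<lambda>f. papply f x"] by simp
  \<comment> \<open>For \<open>x 1 \<noteq> 0\<close> the entry \<open>x 0\<close> can be changed so
    that the form takes the value 1; \<open>g\<close> keeps its value because it does not involve
    \<open>x 0\<close>.\<close>
  have gnz: "papply g x \<noteq> 0" if x: "x 1 \<noteq> 0" for x
  proof -
    define t where "t = (1 - b x) / x 1"
    have "nquad r (x(0 := t)) = 1" using x b0[of x t] by (simp add: q t_def)
    then have "papply h (x(0 := t)) \<noteq> 0" using nz[of "x(0 := t)"] by simp
    then have "papply g (x(0 := t)) \<noteq> 0" using eqx[of "x(0 := t)"] x by auto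
    then show ?thesis by (simp add: g)
  qed
  \<comment> \<open>Two points with the same nonzero \<open>x 1\<close> are joined by a line on
    which \<open>g\<close> has no zero, and a polynomial in one variable without roots is
    constant.\<close>
  have gconst: "papply g x = papply g y" if xy: "x 1 = y 1" "x 1 \<noteq> 0" for x y
  proof -
    obtain L where L: "\<And>t. poly L t = papply g (\<lambda>i. x i + t * (y i - x i))"
      using polyfun_line[OF polyfun_papply[of g], of x "\<lambda>i. y i - x i"] by blast
    have "poly L t \<noteq> 0" for t unfolding L using xy by (intro gnz) simp
    then have "degree L = 0" using alg_closed_imp_poly_has_root[of L] by blast
    then obtain c where "L = [:c:]" by (metis degree_eq_zeroE)
    then show ?thesis using L[of 0] L[of 1] by simp
  qed
  obtain L where L: "\<And>t. poly L t = papply g (\<lambda>i. 0 + t * (if i = 1 then 1 else 0))"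
    using polyfun_line[OF polyfun_papply[of g], of "\<lambda>_. 0" "\<lambda>i. if i = 1 then 1 else 0"] by blast
  have Lnz: "poly L t \<noteq> 0" if "t \<noteq> 0" for t unfolding L using that by (intro gnz) simp
  have "L \<noteq> 0"
  proof
    assume "L = 0"
    then show False using Lnz[of 1] by simp
  qed
  then have L': "L = smult (lead_coeff L) ([:-0, 1:] ^ degree L)"
  proof (rule single_root)
    show "t = 0" if "poly L t = 0" for t using Lnz[of t] that by blast
  qed
  define j c where "j = degree L" and "c = lead_coeff L"
  have c: "c \<noteq> 0" using \<open>L \<noteq> 0\<close> by (simp add: c_def)
  have Lt: "poly L t = c * t ^ j" for t
    by (subst L') (simp add: poly_power c_def j_def)
  have gx: "papply g x = c * x 1 ^ j" if "x 1 \<noteq> 0" for x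
    using gconst[of x "\<lambda>i. 0 + x 1 * (if i = 1 then 1 else 0)"] that Lt[of "x 1"] by (simp add: L)
  have "pvar 1 * (pvar 1 ^ D * h - pconst c * pvar 1 ^ j * pquad r ^ D) = 0"
  proof (rule pfun_eqI)
    show "papply (pvar 1 * (pvar 1 ^ D * h - pconst c * pvar 1 ^ j * pquad r ^ D)) x = papply 0 x" for x
      using eqx[of x] gx[of x] by (cases "x 1 = 0") auto
  qed
  then have main: "pvar 1 ^ D * h = pconst c * pvar 1 ^ j * pquad r ^ D" using pv by simp
  \<comment> \<open>At \<open>w\<close> the form is nonzero but \<open>x 1\<close> vanishes, so a
    surplus power of \<open>x 1\<close> on either side gives a contradiction.\<close>
  have "j = D"
  proof (rule ccontr)
    assume "j \<noteq> D"
    then consider "j < D" | "D < j" by linarith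
    then show False
    proof cases
      case 1
      then have "(pvar 1 :: 'k pfun) ^ D = pvar 1 ^ j * pvar 1 ^ (D - j)" by (simp flip: power_add)
      then have "pvar 1 ^ j * (pvar 1 ^ (D - j) * h) = pvar 1 ^ j * (pconst c * pquad r ^ D)"
        using main by (simp add: mult_ac)
      then have "pvar 1 ^ (D - j) * h = pconst c * pquad r ^ D" using pv by simp
      then have "papply (pvar 1 ^ (D - j) * h) w = papply (pconst c * pquad r ^ D) w" by simp
      then show False using w c 1 by (simp add: power_0_left)
    next
      case 2
      then have "(pvar 1 :: 'k pfun) ^ j = pvar 1 ^ D * pvar 1 ^ (j - D)" by (simp flip: power_add)
      then have "pvar 1 ^ D * h = pvar 1 ^ D * (pconst c * pvar 1 ^ (j - D) * pquad r ^ D)"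
        using main by (simp add: mult_ac)
      then have "h = pconst c * pvar 1 ^ (j - D) * pquad r ^ D" using pv by simp
      then have "papply h w = papply (pconst c * pvar 1 ^ (j - D) * pquad r ^ D) w" by simp
      then show False using w nz[OF w(1)] 2 by (simp add: power_0_left)
    qed
  qed
  then have "pvar 1 ^ D * h = pvar 1 ^ D * (pconst c * pquad r ^ D)" using main by (simp add: mult_ac)
  then have "h = pconst c * pquad r ^ D" using pv by simp
  then have "papply h x = c * nquad r x ^ D" for x by simp
  with c show thesis by (rule that)
qed

section \<open>Tuples of polynomial functions up to proportionality\<close>

lemma pvar_nonzero: "(pvar i :: 'k::alg_closed_field pfun) \<noteq> 0"
proof
  assume "(pvar i :: 'k pfun) = 0"
  then have "papply (pvar i :: 'k pfun) (\<lambda>_. 1) = papply 0 (\<lambda>_. 1)" by simp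
  then show False by simp
qed

text \<open>Setting \<open>x 0 = 0\<close> in the relation between the components 0 and 1 shows that
  \<open>x 0\<close> divides \<open>E 0\<close>. The quotient is the common factor of all
  components.\<close>

lemma parallel_to_vars:
  fixes E :: "nat \<Rightarrow> 'k::alg_closed_field pfun"
  assumes N: "N \<ge> 2" and par: "\<And>i j. i < N \<Longrightarrow> j < N \<Longrightarrow> E i * pvar j = E j * pvar i"
  obtains h where "\<And>i. i < N \<Longrightarrow> E i = h * pvar i"
proof -
  obtain P where P: "P \<in> polys (indep 0)" "E 0 = poly P (pvar 0)"
    using adjoin_indep[of "E 0" 0] unfolding adjoin_def by blast
  have c0: "coeff P 0 * pvar 1 = 0"
  proof (rule pfun_eqI)
    fix x :: "nat \<Rightarrow> 'k"
    let ?x = "x(0 := 0)"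
    have "papply (E 0) ?x * x 1 = papply (E 1) ?x * 0"
      using arg_cong[OF par[of 0 1], of "\<lambda>f. papply f ?x"] N by simp
    moreover have "papply (E 0) ?x = papply (coeff P 0) ?x"
      unfolding P(2) by (cases P) simp
    moreover have "papply (coeff P 0) ?x = papply (coeff P 0) x"
      using polys_coeff[OF P(1)] by (simp add: indep_def)
    ultimately show "papply (coeff P 0 * pvar 1) x = papply 0 x" by simp
  qed
  obtain a P' where P': "P = pCons a P'" by (cases P)
  then have "a = 0" using c0 by (simp add: pvar_nonzero)
  define h where "h = poly P' (pvar 0)"
  have E0: "E 0 = pvar 0 * h" using P(2) P' \<open>a = 0\<close> by (simp add: h_def)
  have "E i = h * pvar i" if "i < N" for i
  proof -
    have "E i * pvar 0 = E 0 * pvar i" using par[of i 0] that N by simp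
    then have "pvar 0 * E i = pvar 0 * (h * pvar i)" by (simp add: E0 mult_ac)
    then show ?thesis by (simp add: pvar_nonzero)
  qed
  then show thesis by (rule that)
qed

text \<open>
  Gluing local polynomial representations of a family of lines spanned by \<open>\<phi> x\<close>: any two of them
  are proportional, so by unique factorization the one with the fewest prime factors in a fixed
  component has no zeros.
\<close>

theorem global_representation:
  fixes Q :: "'k::alg_closed_field pfun" and \<phi> :: "(nat \<Rightarrow> 'k) \<Rightarrow> nat \<Rightarrow> 'k"
  assumes Q: "papply Q x\<^sub>0 \<noteq> 0"
    and \<phi>: "\<And>x. papply Q x \<noteq> 0 \<Longrightarrow> \<exists>i<N. \<phi> x i \<noteq> 0"
    and loc: "\<And>y. papply Q y \<noteq> 0 \<Longrightarrow> \<exists>\<Phi> s. papply s y \<noteq> 0 \<and> (\<exists>i<N. papply (\<Phi> i) y \<noteq> 0) \<and>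
      (\<forall>x. papply Q x \<noteq> 0 \<longrightarrow> papply s x \<noteq> 0 \<longrightarrow>
        (\<forall>i<N. \<forall>j<N. papply (\<Phi> i) x * \<phi> x j = papply (\<Phi> j) x * \<phi> x i))"
  obtains F where "\<And>x. papply Q x \<noteq> 0 \<Longrightarrow> \<exists>i<N. papply (F i) x \<noteq> 0"
    "\<And>x i j. papply Q x \<noteq> 0 \<Longrightarrow> i < N \<Longrightarrow> j < N \<Longrightarrow> papply (F i) x * \<phi> x j = papply (F j) x * \<phi> x i"
proof -
  have trans: "a i * c j = a j * c i"
    if ab: "\<And>i j. i < N \<Longrightarrow> j < N \<Longrightarrow> a i * b j = a j * b i"
      and cb: "\<And>i j. i < N \<Longrightarrow> j < N \<Longrightarrow> c i * b j = c j * b i"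
      and ex: "\<exists>k<N. b k \<noteq> 0" and ij: "i < N" "j < N" for a b c :: "nat \<Rightarrow> 'k" and i j
  proof -
    obtain k where k: "k < N" "b k \<noteq> 0" using ex by blast
    have "(b k * b k) * (a i * c j) = (a i * b k) * (c j * b k)" by (simp add: mult_ac)
    also have "\<dots> = (a k * b i) * (c k * b j)" using ab[OF ij(1) k(1)] cb[OF ij(2) k(1)] by simp
    also have "\<dots> = (a k * b j) * (c k * b i)" by (simp add: mult_ac)
    also have "\<dots> = (a j * b k) * (c i * b k)" using ab[OF k(1) ij(2)] cb[OF k(1) ij(1)] by simp
    also have "\<dots> = (b k * b k) * (a j * c i)" by (simp add: mult_ac)
    finally show ?thesis using k by simp
  qed
  define par where "par \<Phi> \<longleftrightarrow> (\<forall>x. papply Q x \<noteq> 0 \<longrightarrow>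
    (\<forall>i<N. \<forall>j<N. papply (\<Phi> i) x * \<phi> x j = papply (\<Phi> j) x * \<phi> x i))" for \<Phi> :: "nat \<Rightarrow> 'k pfun"
  have Q0: "Q \<noteq> 0" using Q by auto
  have glob: "\<exists>\<Phi>. par \<Phi> \<and> (\<exists>i<N. papply (\<Phi> i) y \<noteq> 0)" if y: "papply Q y \<noteq> 0" for y
  proof -
    obtain \<Phi> s where \<Phi>: "papply s y \<noteq> 0" "\<exists>i<N. papply (\<Phi> i) y \<noteq> 0"
      "\<And>x i j. papply Q x \<noteq> 0 \<Longrightarrow> papply s x \<noteq> 0 \<Longrightarrow> i < N \<Longrightarrow> j < N \<Longrightarrow>
        papply (\<Phi> i) x * \<phi> x j = papply (\<Phi> j) x * \<phi> x i"
      using loc[OF y] by blast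
    \<comment> \<open>\<open>\<Phi>\<close> represents the lines wherever \<open>Q\<close> is
      nonzero, not just where \<open>s\<close> is: its minors with a local representation near
      \<open>z\<close> vanish where \<open>s * t * Q\<close> is nonzero, and therefore
      identically.\<close>
    have "par \<Phi>"
      unfolding par_def
    proof (intro allI impI)
      fix z i j assume z: "papply Q z \<noteq> 0" and ij: "i < N" "j < N"
      obtain \<Psi> t where \<Psi>: "papply t z \<noteq> 0" "\<exists>i<N. papply (\<Psi> i) z \<noteq> 0"
        "\<And>x i j. papply Q x \<noteq> 0 \<Longrightarrow> papply t x \<noteq> 0 \<Longrightarrow> i < N \<Longrightarrow> j < N \<Longrightarrow>
          papply (\<Psi> i) x * \<phi> x j = papply (\<Psi> j) x * \<phi> x i"
        using loc[OF z] by blast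
      have eq: "\<Phi> i * \<Psi> j = \<Phi> j * \<Psi> i" if "i < N" "j < N" for i j
      proof -
        have "s * t * Q * (\<Phi> i * \<Psi> j - \<Phi> j * \<Psi> i) = 0"
        proof (rule pfun_eqI)
          fix x
          show "papply (s * t * Q * (\<Phi> i * \<Psi> j - \<Phi> j * \<Psi> i)) x = papply 0 x"
          proof (cases "papply s x = 0 \<or> papply t x = 0 \<or> papply Q x = 0")
            case False
            then have "papply (\<Phi> i) x * papply (\<Psi> j) x = papply (\<Phi> j) x * papply (\<Psi> i) x"
              using \<Phi>(3) \<Psi>(3) \<phi> that
              by (intro trans[of "\<lambda>i. papply (\<Phi> i) x" "\<phi> x" "\<lambda>i. papply (\<Psi> i) x"]) auto
            then show ?thesis by simp
          qed auto
        qed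
        moreover have "s \<noteq> 0" "t \<noteq> 0" using \<Phi>(1) \<Psi>(1) by auto
        ultimately show ?thesis using Q0 by simp
      qed
      have "papply (\<Phi> i) z * papply (\<Psi> j) z = papply (\<Phi> j) z * papply (\<Psi> i) z" if "i < N" "j < N" for i j
        using arg_cong[OF eq[OF that], of "\<lambda>f. papply f z"] by simp
      then show "papply (\<Phi> i) z * \<phi> z j = papply (\<Phi> j) z * \<phi> z i"
        using \<Psi>(3)[OF z \<Psi>(1)] \<Psi>(2) ij
        by (intro trans[of "\<lambda>i. papply (\<Phi> i) z" "\<lambda>i. papply (\<Psi> i) z" "\<phi> z"]) (auto simp: mult.commute)
    qed
    then show ?thesis using \<Phi>(2) by blast
  qed
  have pareq: "\<Phi> i * \<Psi> j = \<Phi> j * \<Psi> i" if "par \<Phi>" "par \<Psi>" "i < N" "j < N" for \<Phi> \<Psi> i j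
  proof -
    have "Q * (\<Phi> i * \<Psi> j - \<Phi> j * \<Psi> i) = 0"
    proof (rule pfun_eqI)
      fix x
      show "papply (Q * (\<Phi> i * \<Psi> j - \<Phi> j * \<Psi> i)) x = papply 0 x"
      proof (cases "papply Q x = 0")
        case False
        then have "papply (\<Phi> i) x * papply (\<Psi> j) x = papply (\<Phi> j) x * papply (\<Psi> i) x"
          using that \<phi> unfolding par_def
          by (intro trans[of "\<lambda>i. papply (\<Phi> i) x" "\<phi> x" "\<lambda>i. papply (\<Psi> i) x"]) auto
        then show ?thesis by simp
      qed auto
    qed
    then show ?thesis using Q0 by simp
  qed
  obtain \<Phi>0 j where \<Phi>0: "par \<Phi>0" "j < N" "papply (\<Phi>0 j) x\<^sub>0 \<noteq> 0" using glob[OF Q] by blast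
  then have "\<Phi>0 j \<noteq> 0" by auto
  then obtain n0 where "prime_product UNIV n0 (\<Phi>0 j)" using pfun_prime_product by blast
  then have ex: "\<exists>n \<Phi>. par \<Phi> \<and> prime_product UNIV n (\<Phi> j)" using \<Phi>0 by blast
  define n where "n = (LEAST n. \<exists>\<Phi>. par \<Phi> \<and> prime_product UNIV n (\<Phi> j))"
  obtain F where F: "par F" "prime_product UNIV n (F j)"
    using LeastI_ex[OF ex] unfolding n_def by blast
  have nmin: "n \<le> m" if "par \<Phi>" "prime_product UNIV m (\<Phi> j)" for \<Phi> m
    unfolding n_def using that by (intro Least_le) blast
  have Fj: "F j \<noteq> 0" by (rule prime_product_nonzero[OF F(2)])
  have "\<exists>i<N. papply (F i) y \<noteq> 0" if y: "papply Q y \<noteq> 0" for y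
  proof (rule ccontr)
    assume "\<not> ?thesis"
    then have Fy: "papply (F i) y = 0" if "i < N" for i using that by blast
    obtain \<Psi> k where \<Psi>: "par \<Psi>" "k < N" "papply (\<Psi> k) y \<noteq> 0" using glob[OF y] by blast
    obtain g a' b' l where gcd: "F j = g * a'" "\<Psi> j = g * b'" "prime_product UNIV l g" "l \<le> n"
      "l = n \<Longrightarrow> a' dvd 1" "\<And>c. a' dvd c * b' \<Longrightarrow> a' dvd c"
      using prime_product_gcd[OF F(2), of "\<Psi> j"] by metis
    have g0: "g \<noteq> 0" "a' \<noteq> 0" using gcd(1) Fj by auto
    have cross: "\<Psi> i * a' = F i * b'" if "i < N" for i
    proof -
      have "F j * \<Psi> i = F i * \<Psi> j" using pareq[OF F(1) \<Psi>(1) \<Phi>0(2) that] .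
      then have "g * (\<Psi> i * a') = g * (F i * b')" by (simp add: gcd(1,2) mult_ac)
      then show ?thesis using g0 by simp
    qed
    \<comment> \<open>\<open>a'\<close> is coprime to \<open>b'\<close> and divides
      \<open>F i * b'\<close>, so it divides every component of \<open>F\<close>. Dividing it out
      leaves \<open>g\<close> as component \<open>j\<close>, which has fewer prime factors unless
      \<open>a'\<close> is a unit.\<close>
    have "\<exists>G. F i = a' * G" if "i < N" for i
      using gcd(6)[of "F i"] cross[OF that] by (metis dvdE dvd_triv_right)
    then obtain G where G: "\<And>i. i < N \<Longrightarrow> F i = a' * G i" by metis
    have "par G"
      unfolding par_def
    proof (intro allI impI)
      fix z i i' assume z: "papply Q z \<noteq> 0" and ij: "i < N" "i' < N"
      obtain \<Theta> where \<Theta>: "par \<Theta>" "\<exists>k<N. papply (\<Theta> k) z \<noteq> 0" using glob[OF z] by blast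
      have "G i * \<Theta> j = G j * \<Theta> i" if "i < N" "j < N" for i j
      proof -
        have "a' * (G i * \<Theta> j) = a' * (G j * \<Theta> i)"
          using pareq[OF F(1) \<Theta>(1) that] G that by (simp add: mult_ac)
        then show ?thesis using g0 by simp
      qed
      then have "papply (G i * \<Theta> j) z = papply (G j * \<Theta> i) z" if "i < N" "j < N" for i j
        using that by metis
      then have "papply (G i) z * papply (\<Theta> j) z = papply (G j) z * papply (\<Theta> i) z" if "i < N" "j < N" for i j
        using that by simp
      then show "papply (G i) z * \<phi> z i' = papply (G i') z * \<phi> z i"
        using \<Theta> z ij unfolding par_def
        by (intro trans[of "\<lambda>i. papply (G i) z" "\<lambda>i. papply (\<Theta> i) z" "\<phi> z"]) (auto simp: mult.commute)
    qed
    moreover have "G j = g"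
    proof -
      have "a' * G j = a' * g" using G[OF \<Phi>0(2)] gcd(1) by (metis mult.commute)
      then show ?thesis using g0 by simp
    qed
    ultimately have "n \<le> l" using nmin gcd(3) by blast
    then have "a' dvd 1" using gcd(4,5) by simp
    then obtain a'' where "1 = a' * a''" by blast
    then have "papply (a' * a'') y = papply 1 y" by simp
    then have "papply a' y \<noteq> 0" by auto
    moreover have "papply (\<Psi> k * a') y = papply (F k * b') y" using cross[OF \<Psi>(2)] by simp
    ultimately show False using Fy[OF \<Psi>(2)] \<Psi>(3) by simp
  qed
  moreover have "papply (F i) x * \<phi> x j = papply (F j) x * \<phi> x i"
    if "papply Q x \<noteq> 0" "i < N" "j < N" for x i j
    using F(1) that unfolding par_def by blast
  ultimately show thesis by (rule that)
qed


section \<open>Coordinates\<close>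

lemma lincomb_cong: "(\<And>i. i < m \<Longrightarrow> x i = y i) \<Longrightarrow> lincomb m b x = lincomb m b y"
  by (simp add: lincomb_def)

lemma lincomb_add: "lincomb m b (\<lambda>i. x i + y i) = lincomb m b x + lincomb m b y"
  and lincomb_scale: "lincomb m b (\<lambda>i. c * x i) = c *s lincomb m b x"
  by (simp_all add: lincomb_def vec.scale_left_distrib sum.distrib vec.scale_sum_right)

lemma frame_inj:
  assumes "frame W m b" "lincomb m b x = lincomb m b y" "i < m"
  shows "x i = y i"
proof -
  have "lincomb m b (\<lambda>i. x i + (-1) * y i) = 0"
    unfolding lincomb_add lincomb_scale assms(2) by (simp add: vec.scale_minus_left)
  then have "x i + (-1) * y i = 0" using assms(1,3) unfolding frame_def by blast
  then show ?thesis by simp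
qed

lemma frame_dim:
  assumes "frame W m b"
  shows "vec.dim W = m"
proof -
  have unit: "lincomb m b (\<lambda>j. if j = i then 1 else 0) = b i" if "i < m" for i
    using that by (simp add: lincomb_def if_distrib[of "\<lambda>c. c *s _"] if_distribR cong: if_cong)
  have inj: "inj_on b {..<m}"
  proof (rule inj_onI)
    fix i j assume ij: "i \<in> {..<m}" "j \<in> {..<m}" "b i = b j"
    then have "lincomb m b (\<lambda>k. if k = i then 1 else 0) = lincomb m b (\<lambda>k. if k = j then 1 else 0)"
      by (simp add: unit)
    from frame_inj[OF assms this, of i] ij show "i = j" by (auto split: if_splits)
  qed
  let ?S = "b ` {..<m}"
  have sum: "(\<Sum>v\<in>?S. u v *s v) = lincomb m b (\<lambda>i. u (b i))" for u
    unfolding lincomb_def by (simp add: sum.reindex[OF inj])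
  have "vec.independent ?S"
  proof (rule vec.independent_if_scalars_zero)
    fix u v assume "(\<Sum>v\<in>?S. u v *s v) = 0" "v \<in> ?S"
    then show "u v = 0" using assms unfolding sum frame_def by auto
  qed simp
  moreover have "?S \<subseteq> W"
    using assms unit unfolding frame_def by (metis image_subsetI lessThan_iff)
  moreover have "W \<subseteq> vec.span ?S"
  proof
    fix w assume "w \<in> W"
    then obtain x where "w = lincomb m b x" using assms unfolding frame_def by blast
    then have "w = (\<Sum>i<m. x i *s b i)" by (simp add: lincomb_def)
    moreover have "(\<Sum>i<m. x i *s b i) \<in> vec.span ?S"
      by (intro vec.span_sum vec.span_scale vec.span_base) simp
    ultimately show "w \<in> vec.span ?S" by simp
  qed
  ultimately have "vec.dim W = card ?S" by (intro vec.dim_eq_card) (auto simp: vec.span_mono vec.span_minimal subset_antisym)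
  then show ?thesis by (simp add: card_image[OF inj])
qed

text \<open>Entries from \<open>m\<close> on are set to 0, because \<open>SOME\<close> leaves them
  undetermined; this makes every coordinate linear in \<open>v\<close>, whatever its index.\<close>

definition coords :: "nat \<Rightarrow> (nat \<Rightarrow> 'k::field ^ 'n) \<Rightarrow> 'k ^ 'n \<Rightarrow> nat \<Rightarrow> 'k" where
  "coords m b v i = (if i < m then (SOME x. v = lincomb m b x) i else 0)"

context
  fixes b :: "nat \<Rightarrow> 'k::field ^ 'n::finite" and m
  assumes b: "frame UNIV m b"
begin

lemma lincomb_coords: "lincomb m b (coords m b v) = v"
proof -
  have "\<exists>x. v = lincomb m b x" using b unfolding frame_def by blast
  from someI_ex[OF this] have "lincomb m b (SOME x. v = lincomb m b x) = v" by simp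
  moreover have "lincomb m b (coords m b v) = lincomb m b (SOME x. v = lincomb m b x)"
    by (rule lincomb_cong) (simp add: coords_def)
  ultimately show ?thesis by simp
qed

lemma coords_lincomb: "i < m \<Longrightarrow> coords m b (lincomb m b x) i = x i"
  by (rule frame_inj[OF b lincomb_coords])

lemma coords_eqI:
  assumes "lincomb m b x = v" "\<And>i. i \<ge> m \<Longrightarrow> x i = 0"
  shows "coords m b v i = x i"
  using coords_lincomb[of i x] assms by (cases "i < m") (auto simp: coords_def)

lemma coords_add: "coords m b (u + v) i = coords m b u i + coords m b v i"
  and coords_scale: "coords m b (c *s v) i = c * coords m b v i"
proof -
  show "coords m b (u + v) i = coords m b u i + coords m b v i"
    by (rule coords_eqI) (simp_all add: lincomb_add lincomb_coords, simp add: coords_def)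
  show "coords m b (c *s v) i = c * coords m b v i"
    by (rule coords_eqI) (simp_all add: lincomb_scale lincomb_coords, simp add: coords_def)
qed

lemma coords_sum: "coords m b (\<Sum>j\<in>J. f j) i = (\<Sum>j\<in>J. coords m b (f j) i)"
proof -
  have "coords m b 0 i = 0" using coords_scale[of 0 0 i] by simp
  then show ?thesis by (induction J rule: infinite_finite_induct) (auto simp: coords_add)
qed

lemma coords_expand: "coords m b v i = (\<Sum>j\<in>UNIV. v $ j * coords m b (axis j 1) i)"
  by (subst basis_expansion[of v, symmetric]) (simp add: coords_sum coords_scale)

lemma coords_nonzero: "v \<noteq> 0 \<Longrightarrow> \<exists>i<m. coords m b v i \<noteq> 0"
proof (rule ccontr)
  assume "v \<noteq> 0" "\<not> (\<exists>i<m. coords m b v i \<noteq> 0)"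
  then have "lincomb m b (coords m b v) = 0" by (simp add: lincomb_def)
  then show False using lincomb_coords \<open>v \<noteq> 0\<close> by simp
qed

end

definition linear_mpoly :: "('n::finite \<Rightarrow> 'k::comm_semiring_1) \<Rightarrow> ('n, 'k) mpoly" where
  "linear_mpoly c = (\<Sum>j\<in>UNIV. Poly_Mapping.single (Poly_Mapping.single j 1) (c j))"

lemma eval_monomial_single: "eval_monomial (Poly_Mapping.single j 1) v = v $ j"
proof -
  have "eval_monomial (Poly_Mapping.single j 1) v = (\<Prod>i\<in>UNIV. if i = j then v $ i else 1)"
    unfolding eval_monomial_def by (rule prod.cong) (auto simp: lookup_single when_def)
  then show ?thesis by simp
qed

lemma eval_linear_mpoly: "eval_mpoly (linear_mpoly c) v = (\<Sum>j\<in>UNIV. c j * v $ j)"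
  unfolding linear_mpoly_def by (simp add: eval_mpoly_sum eval_monomial_single del: One_nat_def)

lemma homogeneous_add: "homogeneous d p \<Longrightarrow> homogeneous d q \<Longrightarrow> homogeneous d (p + q)"
  using subsetD[OF Poly_Mapping.keys_add[of p q]] unfolding homogeneous_def by auto

lemma homogeneous_sum: "(\<And>i. i \<in> I \<Longrightarrow> homogeneous d (p i)) \<Longrightarrow> homogeneous d (\<Sum>i\<in>I. p i)"
  by (induction I rule: infinite_finite_induct) (auto intro: homogeneous_add)

lemma homogeneous_linear: "homogeneous 1 (linear_mpoly c)"
  unfolding linear_mpoly_def
  by (rule homogeneous_sum) (auto simp: homogeneous_def monomial_degree_def lookup_single when_def)

lemma linear_mpoly_not_unit: "\<not> linear_mpoly (c :: 'n::finite \<Rightarrow> 'k::field) dvd 1"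
proof
  assume "linear_mpoly c dvd 1"
  then obtain u where "1 = linear_mpoly c * u" by blast
  then have "eval_mpoly 1 (0 :: 'k ^ 'n) = eval_mpoly (linear_mpoly c * u) 0" by simp
  then show False by (simp add: eval_mpoly_mult eval_linear_mpoly)
qed

text \<open>A form of rank at most 2 is 0, a square or a product of two linear forms. Comparing
  values turns this into \<open>p = 0\<close> or a factorization of \<open>p\<close> into linear
  polynomials, which are not units.\<close>

theorem irreducible_quadric_normal_form:
  fixes p :: "('n::finite, 'k::alg_closed_field) mpoly"
  assumes irr: "irreducible p" and hom: "homogeneous 2 p"
  obtains r b where "frame UNIV CARD('n) b" "3 \<le> r" "r \<le> CARD('n)"
    "\<And>x. eval_mpoly p (lincomb CARD('n) b x) = nquad r x"
proof -
  obtain B where B: "quadratic_form (eval_mpoly p) B" using homogeneous_2_quadratic_form[OF hom] .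
  obtain m r b where mb: "frame UNIV m b" "r \<le> m" "\<And>x. eval_mpoly p (lincomb m b x) = nquad r x"
    using quadratic_form.normal_form[OF B vec.subspace_UNIV] by metis
  have m: "m = CARD('n)" using frame_dim[OF mb(1)] vec_dim_card by metis
  define L where "L i = linear_mpoly (\<lambda>j. coords m b (axis j 1) i)" for i
  have L: "eval_mpoly (L i) v = coords m b v i" for i v
    unfolding L_def eval_linear_mpoly coords_expand[OF mb(1), of v] by (simp add: mult.commute)
  have p: "eval_mpoly p v = nquad r (coords m b v)" for v
    using mb(3)[of "coords m b v"] by (simp add: lincomb_coords[OF mb(1)])
  have nprod: "p \<noteq> L i * L j" for i j
    using irr irreducibleD[of p "L i" "L j"] linear_mpoly_not_unit unfolding L_def by blast
  have "r \<ge> 3"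
  proof (rule ccontr)
    assume "\<not> r \<ge> 3"
    then consider "r = 0" | "r = 1" | "r = 2" by linarith
    then show False
    proof cases
      case 1
      then have "p = 0" by (intro eval_mpoly_eq_imp_eq) (simp add: p)
      then show False using irr by simp
    next
      case 2
      then have "p = L 0 * L 0"
        by (intro eval_mpoly_eq_imp_eq) (simp add: p eval_mpoly_mult L power2_eq_square)
      then show False using nprod by blast
    next
      case 3
      then have "p = L 0 * L 1"
        using nquad_Suc_Suc[of 0 "coords m b _"]
        by (intro eval_mpoly_eq_imp_eq) (simp add: p eval_mpoly_mult L numeral_2_eq_2)
      then show False using nprod by blast
    qed
  qed
  then show thesis using that mb unfolding m by blast
qed


section \<open>Morphisms between complements of quadrics\<close>

lemma eval_mpoly_prod: "eval_mpoly (\<Prod>i\<in>I. p i) x = (\<Prod>i\<in>I. eval_mpoly (p i) x)"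
  by (induction I rule: infinite_finite_induct) (auto simp: eval_mpoly_mult)

lemma span_singleton_eq:
  fixes v w :: "'k::field ^ 'n"
  assumes "w \<in> vec.span {v}" "w \<noteq> 0"
  shows "vec.span {w} = vec.span {v}"
proof -
  obtain c where c: "w = c *s v" using assms(1) by (auto simp: vec.span_singleton)
  then have "c \<noteq> 0" using assms(2) by auto
  then have "v = (1 / c) *s w" by (simp add: c)
  then have "v \<in> vec.span {w}" by (metis vec.span_base vec.span_scale singletonI)
  then show ?thesis using assms(1) by (simp add: vec.span_eq)
qed

lemma proj_space_eq_span:
  assumes "L \<in> proj_space" "v \<in> L" "v \<noteq> 0"
  shows "L = vec.span {v}"
  using assms span_singleton_eq[of v] by (auto simp: proj_space_def)

lemma span_in_proj_space: "v \<noteq> 0 \<Longrightarrow> vec.span {v} \<in> proj_space"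
  by (auto simp: proj_space_def)

text \<open>One of the equations of the closed complement fails on the line; homogeneity transfers
  this to the vector \<open>v\<close>, and wherever this equation fails the point lies in
  \<open>W\<close>.\<close>

lemma zariski_basic_open:
  fixes v :: "'k::field ^ 'n::finite"
  assumes W: "openin zariski W" "vec.span {v} \<in> W"
  obtains s :: "('n, 'k) mpoly" where "eval_mpoly s v \<noteq> 0"
    "\<And>w. w \<noteq> 0 \<Longrightarrow> eval_mpoly s w \<noteq> 0 \<Longrightarrow> vec.span {w} \<in> W"
proof -
  obtain S where S: "\<And>p. p \<in> S \<Longrightarrow> \<exists>d. homogeneous d p" "proj_space - W = zero_locus S" "W \<subseteq> proj_space"
    using W(1) unfolding openin_zariski proj_closed_def by blast
  have "vec.span {v} \<notin> zero_locus S" "vec.span {v} \<in> proj_space" using S W(2) by auto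
  then obtain p w where p: "p \<in> S" "w \<in> vec.span {v}" "eval_mpoly p w \<noteq> 0"
    by (auto simp: zero_locus_def)
  obtain c where c: "w = c *s v" using p(2) by (auto simp: vec.span_singleton)
  obtain d where "homogeneous d p" using S(1) p(1) by blast
  then have "eval_mpoly p w = c ^ d * eval_mpoly p v" unfolding c by (rule eval_mpoly_scale)
  then have "eval_mpoly p v \<noteq> 0" using p(3) by auto
  moreover have "vec.span {u} \<in> W" if u: "u \<noteq> 0" "eval_mpoly p u \<noteq> 0" for u
  proof -
    have "u \<in> vec.span {u}" by (simp add: vec.span_base)
    then have "vec.span {u} \<notin> zero_locus S" using p(1) u(2) by (auto simp: zero_locus_def)
    then show ?thesis using S(2) span_in_proj_space[OF u(1)] by blast
  qed
  ultimately show thesis by (rule that)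
qed

lemma morphism_maps:
  assumes "variety_morphism X Y f" "X \<subseteq> proj_space" "L \<in> X"
  shows "f L \<in> Y"
proof -
  have "f ` topspace (subtopology zariski X) \<subseteq> topspace (subtopology zariski Y)"
    using assms(1) unfolding variety_morphism_def continuous_map_def by auto
  then show ?thesis using assms(2,3) by (auto simp: topspace_zariski)
qed

text \<open>Pull back the quotients of coordinates \<open>y\<^sub>i / y\<^sub>j\<close>, regular where \<open>y\<^sub>j \<noteq> 0\<close>.\<close>

lemma morphism_local_representation:
  fixes f :: "('k::field, 'n::finite) point \<Rightarrow> ('k, 'm::finite) point"
  assumes f: "variety_morphism X Y f" and X: "X \<subseteq> proj_space" and Y: "Y \<subseteq> proj_space"
    and v: "vec.span {v} \<in> X" "v \<noteq> 0"
  obtains \<Phi> :: "'m \<Rightarrow> ('n, 'k) mpoly" and s :: "('n, 'k) mpoly" where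
    "eval_mpoly s v \<noteq> 0" "\<exists>j. eval_mpoly (\<Phi> j) v \<noteq> 0"
    "\<And>w. w \<noteq> 0 \<Longrightarrow> vec.span {w} \<in> X \<Longrightarrow> eval_mpoly s w \<noteq> 0 \<Longrightarrow>
      (\<chi> j. eval_mpoly (\<Phi> j) w) \<in> f (vec.span {w})"
proof -
  define Z where "Z j = (Poly_Mapping.single (Poly_Mapping.single j 1) 1 :: ('m, 'k) mpoly)" for j
  have homZ: "homogeneous 1 (Z j)" for j
    by (auto simp: Z_def homogeneous_def monomial_degree_def lookup_single when_def)
  have evZ: "eval_mpoly (Z j) y = y $ j" for j y
    by (simp add: Z_def eval_monomial_single del: One_nat_def)
  have fY: "f L \<in> proj_space" "f L \<in> Y" if "L \<in> X" for L
    using morphism_maps[OF f X that] Y by auto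
  obtain u where u: "u \<in> f (vec.span {v})" "u \<noteq> 0" using proj_space_nonzero[OF fY(1)[OF v(1)]] .
  then obtain j where j: "u $ j \<noteq> 0" by (auto simp: vec_eq_iff)
  define V where "V = Y \<inter> (proj_space - zero_locus {Z j})"
  have zl: "proj_closed (zero_locus {Z j})"
    unfolding proj_closed_def using homZ by blast
  have "zero_locus {Z j} \<subseteq> proj_space" by (auto simp: zero_locus_def)
  then have "proj_space - (proj_space - zero_locus {Z j}) = zero_locus {Z j}" by blast
  then have "openin zariski (proj_space - zero_locus {Z j})"
    using zl by (simp add: openin_zariski)
  then have openV: "openin (subtopology zariski Y) V"
    unfolding V_def by (rule openin_subtopology_Int2)
  have V: "y $ j \<noteq> 0" if "L \<in> V" "y \<in> L" "y \<noteq> 0" for L y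
  proof
    assume "y $ j = 0"
    have L: "L \<in> proj_space" "L \<notin> zero_locus {Z j}" using that by (auto simp: V_def)
    have "z $ j = 0" if "z \<in> L" for z
    proof -
      obtain c where "z = c *s y" using proj_space_scale[OF L(1) \<open>y \<in> L\<close> \<open>y \<noteq> 0\<close> \<open>z \<in> L\<close>] .
      then show ?thesis using \<open>y $ j = 0\<close> by simp
    qed
    then show False using L by (auto simp: zero_locus_def evZ)
  qed
  have fvV: "f (vec.span {v}) \<in> V"
  proof -
    have "f (vec.span {v}) \<notin> zero_locus {Z j}"
      using u j by (auto simp: zero_locus_def evZ)
    then show ?thesis using fY[OF v(1)] by (simp add: V_def)
  qed
  define \<phi> where "\<phi> i L = (let y = (SOME y. y \<in> L \<and> y \<noteq> 0) in y $ i / y $ j)" for i and L :: "('k, 'm) point"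
  have \<phi>: "\<phi> i L = y $ i / y $ j" if L: "L \<in> V" "y \<in> L" "y \<noteq> 0" for i L y
  proof -
    let ?z = "SOME z. z \<in> L \<and> z \<noteq> 0"
    have z: "?z \<in> L \<and> ?z \<noteq> 0" by (rule someI[of _ y]) (use L in simp)
    have "L \<in> proj_space" using L by (simp add: V_def)
    then obtain c where c: "?z = c *s y" using proj_space_scale[of L y ?z] L z by metis
    then have "c \<noteq> 0" using z by auto
    then show ?thesis using V[OF L] unfolding \<phi>_def Let_def c by simp
  qed
  let ?D = "{L \<in> X. f L \<in> V}"
  have "regular_on V (\<phi> i)" for i
    unfolding regular_on_def
  proof
    fix P assume "P \<in> V"
    show "\<exists>U d g h. openin (subtopology zariski V) U \<and> P \<in> U \<and> homogeneous d g \<and> homogeneous d h \<and>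
      (\<forall>L\<in>U. \<forall>y\<in>L - {0}. eval_mpoly h y \<noteq> 0 \<and> \<phi> i L = eval_mpoly g y / eval_mpoly h y)"
    proof (rule exI[of _ V], rule exI[of _ "1 :: nat"], rule exI[of _ "Z i"], rule exI[of _ "Z j"], intro conjI)
    show "openin (subtopology zariski V) V"
      by (rule openin_subtopology_refl[THEN iffD2]) (auto simp: V_def topspace_zariski)
    show "\<forall>L\<in>V. \<forall>y\<in>L - {0}. eval_mpoly (Z j) y \<noteq> 0 \<and> \<phi> i L = eval_mpoly (Z i) y / eval_mpoly (Z j) y"
      using V \<phi> by (auto simp: evZ)
    qed (fact homZ \<open>P \<in> V\<close>)+
  qed
  then have reg: "regular_on ?D (\<phi> i \<circ> f)" for i
    using f openV unfolding variety_morphism_def by blast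
  have vD: "vec.span {v} \<in> ?D" using v fvV by simp
  have "\<exists>U g h. openin (subtopology zariski ?D) U \<and> vec.span {v} \<in> U \<and>
      (\<forall>L\<in>U. \<forall>w\<in>L - {0}. eval_mpoly h w \<noteq> 0 \<and> \<phi> i (f L) = eval_mpoly g w / eval_mpoly h w)" for i
    using reg[of i] vD unfolding regular_on_def comp_def by meson
  then have "\<forall>i. \<exists>U g h. openin (subtopology zariski ?D) U \<and> vec.span {v} \<in> U \<and>
      (\<forall>L\<in>U. \<forall>w\<in>L - {0}. eval_mpoly h w \<noteq> 0 \<and> \<phi> i (f L) = eval_mpoly g w / eval_mpoly h w)" by blast
  then obtain U g h where U': "\<forall>i. openin (subtopology zariski ?D) (U i) \<and> vec.span {v} \<in> U i \<and>
      (\<forall>L\<in>U i. \<forall>w\<in>L - {0}. eval_mpoly (h i) w \<noteq> 0 \<and> \<phi> i (f L) = eval_mpoly (g i) w / eval_mpoly (h i) w)"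
    unfolding choice_iff by blast
  then have U: "openin (subtopology zariski ?D) (U i)" "vec.span {v} \<in> U i"
    "L \<in> U i \<Longrightarrow> w \<in> L - {0} \<Longrightarrow> eval_mpoly (h i) w \<noteq> 0 \<and> \<phi> i (f L) = eval_mpoly (g i) w / eval_mpoly (h i) w"
    for i L w
    by blast+
  have Xtop: "topspace (subtopology zariski X) = X" using X by (auto simp: topspace_zariski)
  have "openin (subtopology zariski X) ?D"
    using openin_continuous_map_preimage[OF _ openV, of "subtopology zariski X" f] f
    unfolding variety_morphism_def Xtop by blast
  then obtain O2 where O2: "openin zariski O2" "?D = O2 \<inter> X" by (auto simp: openin_subtopology)
  have "\<exists>s. eval_mpoly s v \<noteq> 0 \<and> (\<forall>w. w \<noteq> 0 \<longrightarrow> vec.span {w} \<in> X \<longrightarrow> eval_mpoly s w \<noteq> 0 \<longrightarrow> vec.span {w} \<in> U i)" for i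
  proof -
    obtain O1 where O1: "openin zariski O1" "U i = O1 \<inter> ?D" using U(1)[of i] by (auto simp: openin_subtopology)
    have "openin zariski (O1 \<inter> O2)" "vec.span {v} \<in> O1 \<inter> O2" using O1 O2 U(2)[of i] by auto
    then obtain s where "eval_mpoly s v \<noteq> 0" "\<And>w. w \<noteq> 0 \<Longrightarrow> eval_mpoly s w \<noteq> 0 \<Longrightarrow> vec.span {w} \<in> O1 \<inter> O2"
      using zariski_basic_open by blast
    then show ?thesis using O1 O2 by blast
  qed
  then have "\<forall>i. \<exists>s. eval_mpoly s v \<noteq> 0 \<and>
      (\<forall>w. w \<noteq> 0 \<longrightarrow> vec.span {w} \<in> X \<longrightarrow> eval_mpoly s w \<noteq> 0 \<longrightarrow> vec.span {w} \<in> U i)" by blast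
  then obtain s where "\<forall>i. eval_mpoly (s i) v \<noteq> 0 \<and>
      (\<forall>w. w \<noteq> 0 \<longrightarrow> vec.span {w} \<in> X \<longrightarrow> eval_mpoly (s i) w \<noteq> 0 \<longrightarrow> vec.span {w} \<in> U i)"
    unfolding choice_iff by blast
  then have s: "eval_mpoly (s i) v \<noteq> 0"
    "w \<noteq> 0 \<Longrightarrow> vec.span {w} \<in> X \<Longrightarrow> eval_mpoly (s i) w \<noteq> 0 \<Longrightarrow> vec.span {w} \<in> U i" for i w
    by blast+
  \<comment> \<open>The quotients of \<open>g i\<close> by \<open>h i\<close> are multiplied by the
    product of all denominators. This factor is the same for all components, so the polynomial tuple
    spans the same line.\<close>
  define \<Phi> where "\<Phi> i = g i * (\<Prod>k\<in>UNIV - {i}. h k)" for i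
  have \<Phi>: "(\<chi> i. eval_mpoly (\<Phi> i) w) = ((\<Prod>k\<in>UNIV. eval_mpoly (h k) w) / y $ j) *s y"
    if w: "w \<noteq> 0" "vec.span {w} \<in> X" "\<And>i. vec.span {w} \<in> U i" and y: "y \<in> f (vec.span {w})" "y \<noteq> 0" for w y
  proof -
    have "w \<in> vec.span {w} - {0}" using w(1) by (simp add: vec.span_base)
    then have hg: "eval_mpoly (h i) w \<noteq> 0" "\<phi> i (f (vec.span {w})) = eval_mpoly (g i) w / eval_mpoly (h i) w" for i
      using U(3)[OF w(3)] by blast+
    have "U undefined \<subseteq> ?D" using openin_subset[OF U(1)[of undefined]] by auto
    then have fV: "f (vec.span {w}) \<in> V" using w(3) by blast
    have "eval_mpoly (\<Phi> i) w = (\<Prod>k\<in>UNIV. eval_mpoly (h k) w) * (y $ i / y $ j)" for i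
    proof -
      have "eval_mpoly (g i) w = eval_mpoly (h i) w * (y $ i / y $ j)"
        using hg[of i] \<phi>[OF fV y, of i] by (simp add: field_simps)
      moreover have "(\<Prod>k\<in>UNIV. eval_mpoly (h k) w) = eval_mpoly (h i) w * (\<Prod>k\<in>UNIV - {i}. eval_mpoly (h k) w)"
        by (rule prod.remove) auto
      ultimately show ?thesis by (simp add: \<Phi>_def eval_mpoly_mult eval_mpoly_prod mult_ac)
    qed
    then show ?thesis by (simp add: vec_eq_iff)
  qed
  show thesis
  proof (rule that[of "\<Prod>i\<in>UNIV. s i" \<Phi>])
    show "eval_mpoly (\<Prod>i\<in>UNIV. s i) v \<noteq> 0" using s(1) by (simp add: eval_mpoly_prod)
    have "v \<in> vec.span {v} - {0}" using v by (simp add: vec.span_base)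
    then have "(\<Prod>k\<in>UNIV. eval_mpoly (h k) v) \<noteq> 0" using U(3)[OF U(2)] by simp
    moreover have "eval_mpoly (\<Phi> j) v = (\<Prod>k\<in>UNIV. eval_mpoly (h k) v) / u $ j * u $ j"
      using arg_cong[OF \<Phi>[OF v(2,1) U(2) u], of "\<lambda>z. z $ j"] by simp
    ultimately show "\<exists>j. eval_mpoly (\<Phi> j) v \<noteq> 0" using j by (intro exI[of _ j]) simp
    fix w :: "'k ^ 'n" assume w: "w \<noteq> 0" "vec.span {w} \<in> X" "eval_mpoly (\<Prod>i\<in>UNIV. s i) w \<noteq> 0"
    then have sU: "vec.span {w} \<in> U i" for i by (intro s(2)) (auto simp: eval_mpoly_prod)
    obtain y where y: "y \<in> f (vec.span {w})" "y \<noteq> 0" using proj_space_nonzero[OF fY(1)[OF w(2)]] .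
    obtain z where "f (vec.span {w}) = vec.span {z}" using fY(1)[OF w(2)] by (auto simp: proj_space_def)
    then show "(\<chi> j. eval_mpoly (\<Phi> j) w) \<in> f (vec.span {w})"
      unfolding \<Phi>[OF w(1,2) sU y] using y by (metis vec.span_scale)
  qed
qed

section \<open>Polynomial tuples representing morphisms between complements\<close>

lemma polyfun_eval_mpoly:
  assumes "\<And>j. polyfun (\<lambda>x. g x $ j)"
  shows "polyfun (\<lambda>x. eval_mpoly p (g x))"
  unfolding eval_mpoly_def eval_monomial_def using assms
  by (intro polyfun_sum polyfun_mult polyfun_const polyfun_prod polyfun_power)

lemma polyfun_lincomb: "polyfun (\<lambda>x. lincomb m b x $ j)"
  unfolding lincomb_def by (auto intro!: polyfun_sum polyfun_mult)

locale quadric_frame =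
  fixes p :: "('n::finite, 'k::alg_closed_field) mpoly" and b :: "nat \<Rightarrow> 'k ^ 'n" and r :: nat
  assumes hom: "homogeneous 2 p"
    and frame: "frame UNIV CARD('n) b"
    and r3: "3 \<le> r" and r_le: "r \<le> CARD('n)"
    and eval: "eval_mpoly p (lincomb CARD('n) b x) = nquad r x"
begin

abbreviation vect :: "(nat \<Rightarrow> 'k) \<Rightarrow> 'k ^ 'n" where "vect \<equiv> lincomb CARD('n) b"
abbreviation coord :: "'k ^ 'n \<Rightarrow> nat \<Rightarrow> 'k" where "coord \<equiv> coords CARD('n) b"

definition compl :: "('k, 'n) point set" where "compl = proj_space - zero_locus {p}"

lemma compl_subset: "compl \<subseteq> proj_space" by (auto simp: compl_def)

lemma eval_0: "eval_mpoly p 0 = 0"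
  using eval_mpoly_scale[OF hom, of 0 0] by simp

lemma compl_iff:
  assumes "L \<in> proj_space" "v \<in> L" "v \<noteq> 0"
  shows "L \<in> compl \<longleftrightarrow> eval_mpoly p v \<noteq> 0"
proof -
  have "eval_mpoly p v = 0 \<longleftrightarrow> (\<forall>w\<in>L. eval_mpoly p w = 0)"
  proof
    assume 0: "eval_mpoly p v = 0"
    show "\<forall>w\<in>L. eval_mpoly p w = 0"
    proof
      fix w assume "w \<in> L"
      obtain c where "w = c *s v" using proj_space_scale[OF assms \<open>w \<in> L\<close>] .
      then show "eval_mpoly p w = 0" using eval_mpoly_scale[OF hom] 0 by simp
    qed
  qed (use assms in blast)
  then show ?thesis using assms(1) by (auto simp: compl_def zero_locus_def)
qed

lemma vect_compl:
  assumes "nquad r x \<noteq> 0"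
  shows "vect x \<noteq> 0" "vec.span {vect x} \<in> compl"
proof -
  show "vect x \<noteq> 0" using assms eval[of x] eval_0 by auto
  then show "vec.span {vect x} \<in> compl"
    using assms eval[of x] by (subst compl_iff[of _ "vect x"]) (auto simp: span_in_proj_space vec.span_base)
qed

end

text \<open>The tuple \<open>\<phi>\<close> consists of the coordinates of vectors chosen
  arbitrarily on the image lines. The morphism enters through local polynomial tuples proportional
  to it, and factoriality merges these into one.\<close>

lemma morphism_global_representation:
  fixes p p' :: "('n::finite, 'k::alg_closed_field) mpoly"
  assumes "quadric_frame p b r" "quadric_frame p' b' r'"
    and f: "variety_morphism (quadric_frame.compl p) (quadric_frame.compl p') f"
  obtains F where "\<And>x. nquad r x \<noteq> 0 \<Longrightarrow> \<exists>i<CARD('n). papply (F i) x \<noteq> 0"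
    "\<And>x. nquad r x \<noteq> 0 \<Longrightarrow>
      lincomb CARD('n) b' (\<lambda>i. papply (F i) x) \<in> f (vec.span {lincomb CARD('n) b x})"
proof -
  interpret S: quadric_frame p b r by fact
  interpret T: quadric_frame p' b' r' by fact
  let ?N = "CARD('n)"
  let ?L = "\<lambda>x. f (vec.span {S.vect x})"
  have L: "?L x \<in> proj_space" if "nquad r x \<noteq> 0" for x
    using morphism_maps[OF f S.compl_subset S.vect_compl(2)[OF that]] T.compl_subset by blast
  define y where "y x = (SOME y. y \<in> ?L x \<and> y \<noteq> 0)" for x
  have y: "y x \<in> ?L x" "y x \<noteq> 0" if x: "nquad r x \<noteq> 0" for x
  proof -
    obtain z where "z \<in> ?L x" "z \<noteq> 0" using proj_space_nonzero[OF L[OF x]] .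
    then have "\<exists>z. z \<in> ?L x \<and> z \<noteq> 0" by blast
    from someI_ex[OF this] have "y x \<in> ?L x \<and> y x \<noteq> 0" unfolding y_def .
    then show "y x \<in> ?L x" "y x \<noteq> 0" by auto
  qed
  define \<phi> where "\<phi> x = T.coord (y x)" for x
  obtain F where F: "\<And>x. papply (pquad r) x \<noteq> 0 \<Longrightarrow> \<exists>i<?N. papply (F i) x \<noteq> 0"
    "\<And>x i j. papply (pquad r) x \<noteq> 0 \<Longrightarrow> i < ?N \<Longrightarrow> j < ?N \<Longrightarrow> papply (F i) x * \<phi> x j = papply (F j) x * \<phi> x i"
  proof (rule global_representation[of "pquad r" _ ?N \<phi>])
    show "papply (pquad r) (\<lambda>i. if i = 2 \<or> i = 3 then 1 else 0) \<noteq> (0 :: 'k)"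
      using nquad_witness[OF S.r3, where 'a = 'k] by simp
    show "\<exists>i<?N. \<phi> x i \<noteq> 0" if "papply (pquad r) x \<noteq> 0" for x
      using coords_nonzero[OF T.frame y(2)] that by (simp add: \<phi>_def)
    fix x0 assume "papply (pquad r) x0 \<noteq> (0 :: 'k)"
    then have x0: "nquad r x0 \<noteq> 0" by simp
    obtain \<Phi> s where \<Phi>: "eval_mpoly s (S.vect x0) \<noteq> 0" "\<exists>j. eval_mpoly (\<Phi> j) (S.vect x0) \<noteq> 0"
      "\<And>w. w \<noteq> 0 \<Longrightarrow> vec.span {w} \<in> S.compl \<Longrightarrow> eval_mpoly s w \<noteq> 0 \<Longrightarrow>
        (\<chi> j. eval_mpoly (\<Phi> j) w) \<in> f (vec.span {w})"
      using morphism_local_representation[OF f S.compl_subset T.compl_subset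
          S.vect_compl(2)[OF x0] S.vect_compl(1)[OF x0]] by metis
    let ?v = "\<lambda>x. \<chi> j. eval_mpoly (\<Phi> j) (S.vect x)"
    define \<Psi> where "\<Psi> i = Abs_pfun (\<lambda>x. T.coord (?v x) i)" for i
    define t where "t = Abs_pfun (\<lambda>x. eval_mpoly s (S.vect x))"
    have pf: "polyfun (\<lambda>x. T.coord (?v x) i)" for i
      by (subst coords_expand[OF T.frame])
        (auto intro!: polyfun_sum polyfun_mult polyfun_eval_mpoly polyfun_lincomb)
    have \<Psi>: "papply (\<Psi> i) x = T.coord (?v x) i" for i x by (simp add: \<Psi>_def pf)
    have t: "papply t x = eval_mpoly s (S.vect x)" for x
      by (simp add: t_def polyfun_eval_mpoly polyfun_lincomb)
    show "\<exists>\<Phi> s. papply s x0 \<noteq> 0 \<and> (\<exists>i<?N. papply (\<Phi> i) x0 \<noteq> 0) \<and>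
      (\<forall>x. papply (pquad r) x \<noteq> 0 \<longrightarrow> papply s x \<noteq> 0 \<longrightarrow>
        (\<forall>i<?N. \<forall>j<?N. papply (\<Phi> i) x * \<phi> x j = papply (\<Phi> j) x * \<phi> x i))"
    proof (rule exI[of _ \<Psi>], rule exI[of _ t], intro conjI allI impI)
      show "papply t x0 \<noteq> 0" using \<Phi>(1) by (simp add: t)
      have "?v x0 \<noteq> 0" using \<Phi>(2) by (auto simp: vec_eq_iff)
      then show "\<exists>i<?N. papply (\<Psi> i) x0 \<noteq> 0" unfolding \<Psi> by (rule coords_nonzero[OF T.frame])
      fix x i j assume x: "papply (pquad r) x \<noteq> 0" "papply t x \<noteq> 0" "i < ?N" "j < ?N"
      then have x': "nquad r x \<noteq> 0" by simp
      have "?v x \<in> ?L x" using x(2) by (intro \<Phi>(3) S.vect_compl x') (simp add: t)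
      then obtain c where "?v x = c *s y x" using proj_space_scale[OF L[OF x'] y[OF x']] by metis
      then show "papply (\<Psi> i) x * \<phi> x j = papply (\<Psi> j) x * \<phi> x i"
        unfolding \<Psi> \<phi>_def by (simp add: coords_scale[OF T.frame])
    qed
  qed blast
  show thesis
  proof (rule that)
    fix x :: "nat \<Rightarrow> 'k" assume x: "nquad r x \<noteq> 0"
    then show "\<exists>i<?N. papply (F i) x \<noteq> 0" using F(1)[of x] by simp
    obtain k where k: "k < ?N" "\<phi> x k \<noteq> 0"
      using coords_nonzero[OF T.frame y(2)[OF x]] by (auto simp: \<phi>_def)
    let ?c = "papply (F k) x / \<phi> x k"
    have "papply (F i) x = ?c * \<phi> x i" if "i < ?N" for i
      using F(2)[of x i k] x k that by (simp add: field_simps)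
    then have "T.vect (\<lambda>i. papply (F i) x) = T.vect (\<lambda>i. ?c * \<phi> x i)" by (rule lincomb_cong)
    also have "\<dots> = ?c *s y x" unfolding lincomb_scale by (simp add: \<phi>_def lincomb_coords[OF T.frame])
    finally have eq: "T.vect (\<lambda>i. papply (F i) x) = ?c *s y x" .
    obtain z where "?L x = vec.span {z}" using L[OF x] by (auto simp: proj_space_def)
    then show "T.vect (\<lambda>i. papply (F i) x) \<in> ?L x" unfolding eq using y(1)[OF x] by (metis vec.span_scale)
  qed
qed

text \<open>
  The first identity holds because its left-hand side vanishes nowhere off the quadric, the second
  because the composition with the inverse fixes every line.
\<close>

lemma isomorphism_polynomials:
  fixes p p' :: "('n::finite, 'k::alg_closed_field) mpoly"
  assumes "quadric_frame p b r" "quadric_frame p' b' r'"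
    and f: "variety_morphism (quadric_frame.compl p) (quadric_frame.compl p') f"
    and g: "variety_morphism (quadric_frame.compl p') (quadric_frame.compl p) g"
    and gf: "\<And>L. L \<in> quadric_frame.compl p \<Longrightarrow> g (f L) = L"
  obtains l :: 'k and F :: "nat \<Rightarrow> 'k pexp" and D and G :: "nat \<Rightarrow> 'k pexp" and m where "l \<noteq> 0"
    "\<forall>x. nquad r' (\<lambda>i. peval id (F i) x) = nquad r x ^ D"
    "\<forall>i<CARD('n). \<forall>x. peval id (G i) (\<lambda>i. peval id (F i) x) = l * nquad r x ^ m * x i"
    "\<forall>i\<ge>CARD('n). F i = Const 0"
proof -
  interpret S: quadric_frame p b r by fact
  interpret T: quadric_frame p' b' r' by fact
  let ?N = "CARD('n)"
  obtain F where F: "\<And>x. nquad r x \<noteq> 0 \<Longrightarrow> \<exists>i<?N. papply (F i) x \<noteq> 0"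
    "\<And>x. nquad r x \<noteq> 0 \<Longrightarrow> T.vect (\<lambda>i. papply (F i) x) \<in> f (vec.span {S.vect x})"
    using morphism_global_representation[OF assms(1,2) f] by metis
  obtain G where G: "\<And>x. nquad r' x \<noteq> 0 \<Longrightarrow> \<exists>i<?N. papply (G i) x \<noteq> 0"
    "\<And>x. nquad r' x \<noteq> 0 \<Longrightarrow> S.vect (\<lambda>i. papply (G i) x) \<in> g (vec.span {T.vect x})"
    using morphism_global_representation[OF assms(2,1) g] by metis
  \<comment> \<open>\<open>G\<close> may depend on all entries of a sequence, so those from
    \<open>?N\<close> on are fixed to be 0; the same convention governs the lists in the point
    counts.\<close>
  define F' where "F' x i = (if i < ?N then papply (F i) x else 0)" for x i
  have F'vect: "T.vect (F' x) = T.vect (\<lambda>i. papply (F i) x)" for x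
    by (rule lincomb_cong) (simp add: F'_def)
  have pfF: "polyfun (\<lambda>x. F' x i)" for i by (cases "i < ?N") (auto simp: F'_def)
  have frame0: "v \<noteq> 0" if "frame UNIV ?N c" "v = lincomb ?N c z" "i < ?N" "z i \<noteq> 0"
    for v :: "'k ^ 'n" and c z i
    using that(1,3,4) unfolding that(2) frame_def by blast
  have F0: "T.vect (F' x) \<noteq> 0" if x: "nquad r x \<noteq> 0" for x
    using F(1)[OF x] frame0[OF T.frame refl] by (metis F'vect)
  have fL: "f (vec.span {S.vect x}) = vec.span {T.vect (F' x)}" "nquad r' (F' x) \<noteq> 0"
    if x: "nquad r x \<noteq> 0" for x
  proof -
    have *: "f (vec.span {S.vect x}) \<in> T.compl" by (rule morphism_maps[OF f S.compl_subset S.vect_compl(2)[OF x]])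
    then have ps: "f (vec.span {S.vect x}) \<in> proj_space" using T.compl_subset by blast
    show "f (vec.span {S.vect x}) = vec.span {T.vect (F' x)}"
      using F(2)[OF x] F0[OF x] by (intro proj_space_eq_span ps) (simp_all add: F'vect)
    show "nquad r' (F' x) \<noteq> 0"
      using T.compl_iff[OF ps F(2)[OF x, folded F'vect] F0[OF x]] * by (simp only: T.eval simp_thms)
  qed
  obtain c D where c: "c \<noteq> 0" "\<And>x. nquad r' (F' x) = c * nquad r x ^ D"
  proof -
    have pf: "polyfun (\<lambda>x. nquad r' (F' x))" by (rule polyfun_nquad[OF pfF])
    obtain c D where "c \<noteq> 0" "\<And>x. papply (Abs_pfun (\<lambda>x. nquad r' (F' x))) x = c * nquad r x ^ D"
      using nonvanishing_off_quadric[OF S.r3, of "Abs_pfun (\<lambda>x. nquad r' (F' x))"] fL(2) pf by auto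
    then show thesis using that pf by simp
  qed
  define E where "E i = Abs_pfun (\<lambda>x. papply (G i) (F' x))" for i
  have pfE: "polyfun (\<lambda>x. papply (G i) (F' x))" for i by (rule polyfun_comp[OF polyfun_papply pfF])
  have E: "papply (E i) x = papply (G i) (F' x)" for i x by (simp add: E_def pfE)
  have Ex: "\<exists>c. c \<noteq> 0 \<and> (\<forall>i<?N. papply (E i) x = c * x i)" if x: "nquad r x \<noteq> 0" for x
  proof -
    have "S.vect (\<lambda>i. papply (G i) (F' x)) \<in> g (vec.span {T.vect (F' x)})" by (rule G(2)[OF fL(2)[OF x]])
    also have "g (vec.span {T.vect (F' x)}) = vec.span {S.vect x}"
      using gf[OF S.vect_compl(2)[OF x]] fL(1)[OF x] by simp
    finally obtain c where c: "S.vect (\<lambda>i. papply (G i) (F' x)) = c *s S.vect x"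
      by (auto simp: vec.span_singleton)
    then have "S.vect (\<lambda>i. papply (G i) (F' x)) = S.vect (\<lambda>i. c * x i)" by (simp add: lincomb_scale)
    then have "\<forall>i<?N. papply (E i) x = c * x i" using frame_inj[OF S.frame] unfolding E by blast
    moreover have "c \<noteq> 0"
    proof
      assume "c = 0"
      then have "\<forall>i<?N. papply (E i) x = 0" using calculation by simp
      then show False using G(1)[OF fL(2)[OF x]] by (auto simp: E)
    qed
    ultimately show ?thesis by blast
  qed
  have q0: "pquad r \<noteq> (0 :: 'k pfun)"
  proof
    assume "pquad r = (0 :: 'k pfun)"
    then have "papply (pquad r :: 'k pfun) (\<lambda>i. if i = 2 \<or> i = 3 then 1 else 0) = 0" by simp
    then show False using nquad_witness[OF S.r3, where 'a = 'k] by simp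
  qed
  have "E i * pvar j = E j * pvar i" if "i < ?N" "j < ?N" for i j
  proof -
    \<comment> \<open>The relation is known off the quadric only; multiplication by the form extends
      it to all points, and the form is cancelled.\<close>
    have "pquad r * (E i * pvar j - E j * pvar i) = 0"
    proof (rule pfun_eqI)
      fix x
      show "papply (pquad r * (E i * pvar j - E j * pvar i)) x = papply 0 x"
        using Ex[of x] that by (cases "nquad r x = 0") auto
    qed
    then show ?thesis using q0 by simp
  qed
  moreover have "?N \<ge> 2" using S.r3 S.r_le by simp
  ultimately obtain h where h: "\<And>i. i < ?N \<Longrightarrow> E i = h * pvar i" using parallel_to_vars by metis
  have "papply h x \<noteq> 0" if x: "nquad r x \<noteq> 0" for x
  proof
    assume "papply h x = 0"
    then have "\<forall>i<?N. papply (E i) x = 0" using h by simp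
    then show False using G(1)[OF fL(2)[OF x]] by (auto simp: E)
  qed
  then obtain l m where l: "l \<noteq> 0" "\<And>x. papply h x = l * nquad r x ^ m"
    using nonvanishing_off_quadric[OF S.r3] by metis
  have GF: "papply (G i) (F' x) = l * nquad r x ^ m * x i" if "i < ?N" for i x
    using E[of i x] h[OF that] l(2)[of x] by simp
  \<comment> \<open>The factor \<open>c\<close> in the first identity is removed by dividing
    \<open>F\<close> by a square root of \<open>c\<close>; \<open>G\<close> compensates by scaling
    its arguments with the same number.\<close>
  obtain a where a: "a ^ 2 = c" using nth_root_exists[of 2 c] by auto
  then have a0: "a \<noteq> 0" using c(1) by auto
  have nq: "nquad r' (\<lambda>i. t * z i) = t ^ 2 * nquad r' z" for t and z :: "nat \<Rightarrow> 'k"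
    by (simp add: nquad_def sum_distrib_left power_mult_distrib algebra_simps power2_eq_square)
  have "\<exists>e. peval id e = (\<lambda>x. (1 / a) * F' x i) \<and> (i \<ge> ?N \<longrightarrow> e = Const 0)" for i
  proof (cases "i < ?N")
    case True
    have "polyfun (\<lambda>x. (1 / a) * F' x i)" by (intro polyfun_mult polyfun_const pfF)
    then show ?thesis using True unfolding polyfun_def by (metis leD)
  next
    case False
    then show ?thesis by (intro exI[of _ "Const 0"]) (auto simp: F'_def)
  qed
  then obtain F'' where F'': "\<And>i. peval id (F'' i) = (\<lambda>x. (1 / a) * F' x i)" "\<And>i. i \<ge> ?N \<Longrightarrow> F'' i = Const 0"
    by metis
  have "\<exists>e. peval id e = (\<lambda>y. papply (G i) (\<lambda>j. a * y j))" for i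
  proof -
    have "polyfun (\<lambda>y. papply (G i) (\<lambda>j. a * y j))"
      by (rule polyfun_comp[OF polyfun_papply]) (intro polyfun_mult polyfun_const polyfun_var)
    then obtain e where "(\<lambda>y. papply (G i) (\<lambda>j. a * y j)) = peval id e" unfolding polyfun_def ..
    then show ?thesis by (intro exI[of _ e]) (rule sym)
  qed
  then obtain G'' where G'': "\<And>i. peval id (G'' i) = (\<lambda>y. papply (G i) (\<lambda>j. a * y j))" by metis
  have id1: "nquad r' (\<lambda>i. peval id (F'' i) x) = nquad r x ^ D" for x
    unfolding F'' nq c(2) using a0 by (simp add: a power_one_over field_simps) (simp add: a c(1))
  have id2: "peval id (G'' i) (\<lambda>i. peval id (F'' i) x) = l * nquad r x ^ m * x i" if "i < ?N" for x i
    unfolding F'' G'' using a0 GF[OF that, of x] by simp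
  show thesis
    by (rule that[of l F'' D G'' m]) (use l(1) id1 id2 F''(2) in auto)
qed


section \<open>Counting points over finite residue fields\<close>

text \<open>One representative in \<open>R\<close> for each coset. Points over the quotient ring
  thereby become tuples of elements of \<open>R\<close>, to which identities over the ambient ring
  apply.\<close>

definition transversal :: "'a::comm_ring_1 set \<Rightarrow> 'a set \<Rightarrow> 'a set \<Rightarrow> bool" where
  "transversal R I T \<longleftrightarrow> finite T \<and> T \<subseteq> R \<and> (\<forall>x\<in>R. \<exists>!t. t \<in> T \<and> x - t \<in> I)"

lemma transversal_exists:
  assumes I: "ideal_in R I" and "finite_index R I"
  obtains T where "transversal R I T"
proof -
  obtain T0 where T0: "finite T0" "T0 \<subseteq> R" "\<And>x. x \<in> R \<Longrightarrow> \<exists>t\<in>T0. x - t \<in> I"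
    using assms(2) unfolding finite_index_def by blast
  \<comment> \<open>The chosen representative depends only on the coset, since congruent elements
    satisfy the same predicate; hence the image of \<open>R\<close> under \<open>\<rho>\<close>
    meets each coset once.\<close>
  define \<rho> where "\<rho> x = (SOME t. t \<in> T0 \<and> x - t \<in> I)" for x
  have \<rho>: "\<rho> x \<in> T0 \<and> x - \<rho> x \<in> I" if x: "x \<in> R" for x
  proof -
    have "\<exists>t. t \<in> T0 \<and> x - t \<in> I" using T0(3)[OF x] by blast
    from someI_ex[OF this] show ?thesis unfolding \<rho>_def .
  qed
  have \<rho>_eq: "\<rho> x = \<rho> y" if "x - y \<in> I" for x y
  proof -
    have "x - t \<in> I \<longleftrightarrow> y - t \<in> I" for t
    proof
      assume "x - t \<in> I"
      then have "(x - t) - (x - y) \<in> I" by (rule ideal_inD(3)[OF I _ that])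
      then show "y - t \<in> I" by simp
    next
      assume "y - t \<in> I"
      then have "(y - t) + (x - y) \<in> I" by (rule ideal_inD(7)[OF I _ that])
      then show "x - t \<in> I" by simp
    qed
    then show ?thesis unfolding \<rho>_def by simp
  qed
  have "transversal R I (\<rho> ` R)"
    unfolding transversal_def
  proof (intro conjI ballI)
    have sub: "\<rho> ` R \<subseteq> T0" using \<rho> by blast
    then show "finite (\<rho> ` R)" using T0(1) finite_subset by blast
    show "\<rho> ` R \<subseteq> R" using sub T0(2) by blast
    fix x assume x: "x \<in> R"
    show "\<exists>!t. t \<in> \<rho> ` R \<and> x - t \<in> I"
    proof (rule ex1I[of _ "\<rho> x"])
      show "\<rho> x \<in> \<rho> ` R \<and> x - \<rho> x \<in> I" using \<rho>[OF x] x by blast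
      fix t assume t: "t \<in> \<rho> ` R \<and> x - t \<in> I"
      then obtain y where y: "y \<in> R" "t = \<rho> y" by blast
      have "(x - t) - (y - \<rho> y) \<in> I"
        by (rule ideal_inD(3)[OF I conjunct2[OF t] conjunct2[OF \<rho>[OF y(1)]]])
      then have "x - y \<in> I" by (simp add: y)
      then show "t = \<rho> x" using \<rho>_eq y by simp
    qed
  qed
  then show thesis by (rule that)
qed

locale quotient_ring =
  fixes R I T :: "'a::comm_ring_1 set"
  assumes R: "ring_set R" and I: "ideal_in R I" and T: "transversal R I T"
begin

definition eqv :: "'a \<Rightarrow> 'a \<Rightarrow> bool" where "eqv x y \<longleftrightarrow> x - y \<in> I"

definition rep :: "'a \<Rightarrow> 'a" where "rep x = (THE t. t \<in> T \<and> x - t \<in> I)"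

lemma eqv_refl [simp]: "eqv x x" using ideal_inD(2)[OF I] by (simp add: eqv_def)

lemma eqv_sym: "eqv x y \<Longrightarrow> eqv y x" using ideal_inD(6)[OF I, of "x - y"] by (simp add: eqv_def)

lemma eqv_trans: "eqv x y \<Longrightarrow> eqv y z \<Longrightarrow> eqv x z"
  using ideal_inD(7)[OF I, of "x - y" "y - z"] by (simp add: eqv_def)

lemma eqv_add: "eqv x y \<Longrightarrow> eqv x' y' \<Longrightarrow> eqv (x + x') (y + y')"
  using ideal_inD(7)[OF I, of "x - y" "x' - y'"] by (simp add: eqv_def algebra_simps)

lemma eqv_mult:
  assumes "eqv x y" "eqv x' y'" "y \<in> R" "x' \<in> R"
  shows "eqv (x * x') (y * y')"
proof -
  have "(x - y) * x' + y * (x' - y') \<in> I"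
    using assms by (intro ideal_inD(4,5,7)[OF I]) (auto simp: eqv_def)
  then show ?thesis by (simp add: eqv_def algebra_simps)
qed

lemma eqv_power: "eqv x 1 \<Longrightarrow> x \<in> R \<Longrightarrow> eqv (x ^ n) 1"
proof (induction n)
  case (Suc n)
  then have "eqv (x * x ^ n) (1 * 1)"
    by (intro eqv_mult ring_set_power[OF R] ring_setD(2)[OF R]) auto
  then show ?case by simp
qed simp

lemma T_R: "t \<in> T \<Longrightarrow> t \<in> R" and T_fin: "finite T"
  using T by (auto simp: transversal_def)

lemma rep: "x \<in> R \<Longrightarrow> rep x \<in> T" "x \<in> R \<Longrightarrow> eqv x (rep x)"
proof -
  assume "x \<in> R"
  then have "\<exists>!t. t \<in> T \<and> x - t \<in> I" using T by (simp add: transversal_def)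
  from theI'[OF this] show "rep x \<in> T" "eqv x (rep x)" by (simp_all add: rep_def eqv_def)
qed

lemma T_unique: "s \<in> T \<Longrightarrow> t \<in> T \<Longrightarrow> eqv s t \<Longrightarrow> s = t"
  using T ideal_inD(2)[OF I] unfolding transversal_def eqv_def by (metis (no_types) T_R diff_self)

lemma peval_eqv:
  assumes "\<And>c. c \<in> set_pexp e \<Longrightarrow> h c \<in> R" "\<And>i. x i \<in> R" "\<And>i. y i \<in> R" "\<And>i. eqv (x i) (y i)"
  shows "peval h e x \<in> R" "peval h e y \<in> R" "eqv (peval h e x) (peval h e y)"
proof -
  have "peval h e x \<in> R \<and> peval h e y \<in> R \<and> eqv (peval h e x) (peval h e y)"
    using assms(1) by (induction e) (auto simp: assms(2-4) intro: ring_setD[OF R] eqv_add eqv_mult)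
  then show "peval h e x \<in> R" "peval h e y \<in> R" "eqv (peval h e x) (peval h e y)" by auto
qed

lemma nquad_in: "(\<And>i. x i \<in> R) \<Longrightarrow> nquad r x \<in> R"
  unfolding nquad_def
  by (auto intro!: ring_setD(4,6)[OF R] ring_set_sum[OF R] ring_set_power[OF R] ring_setD(1)[OF R])

lemma nquad_eqv:
  assumes "\<And>i. x i \<in> R" "\<And>i. y i \<in> R" "\<And>i. eqv (x i) (y i)"
  shows "eqv (nquad r x) (nquad r y)"
proof -
  have "eqv (\<Sum>i\<in>A. x (2 * i) * x (2 * i + 1)) (\<Sum>i\<in>A. y (2 * i) * y (2 * i + 1))" for A
    by (induction A rule: infinite_finite_induct) (auto intro!: eqv_add eqv_mult assms)
  then show ?thesis
    unfolding nquad_def by (intro eqv_add) (auto simp: power2_eq_square intro!: eqv_mult assms)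
qed

definition points :: "nat \<Rightarrow> 'a list set" where
  "points N = {xs. set xs \<subseteq> T \<and> length xs = N}"

text \<open>The affine quadric over the quotient ring, in a space of dimension \<open>N\<close>.
  Lists are continued by zeros, since forms and expressions take infinite sequences.\<close>

definition quadric_points :: "nat \<Rightarrow> nat \<Rightarrow> 'a list set" where
  "quadric_points N r = {xs \<in> points N. eqv (nquad r (nth_default 0 xs)) 1}"

lemma finite_points: "finite (points N)" and card_points: "card (points N) = card T ^ N"
  using finite_lists_length_eq[OF T_fin, of N] card_lists_length_eq[OF T_fin, of N]
  by (simp_all add: points_def)

lemma points_R: "xs \<in> points N \<Longrightarrow> nth_default 0 xs i \<in> R"
  using ring_setD(1)[OF R] by (auto simp: points_def nth_default_def intro!: T_R)

text \<open>The maps given by \<open>F\<close> and \<open>G\<close> are mutually inverse on the points with \<open>q = 1\<close>, up to the unit \<open>h l\<close>.\<close>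

lemma card_quadric_points_le:
  assumes F: "\<And>i c. c \<in> set_pexp (F i) \<Longrightarrow> h c \<in> R" and G: "\<And>i c. i < N \<Longrightarrow> c \<in> set_pexp (G i) \<Longrightarrow> h c \<in> R"
    and F0: "\<And>i. i \<ge> N \<Longrightarrow> F i = Const 0" "h 0 = 0"
    and id1: "\<And>x. nquad s (\<lambda>i. peval h (F i) x) = nquad r x ^ D"
    and id2: "\<And>x i. i < N \<Longrightarrow> peval h (G i) (\<lambda>i. peval h (F i) x) = h l * nquad r x ^ m * x i"
    and l: "h l \<in> R" "u \<in> R" "eqv (u * h l) 1"
  shows "card (quadric_points N r) \<le> card (quadric_points N s)"
proof -
  let ?e = "nth_default 0"
  define y where "y xs i = peval h (F i) (?e xs)" for xs i
  define f where "f xs = map (\<lambda>i. rep (y xs i)) [0..<N]" for xs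
  have yR: "y xs i \<in> R" if "xs \<in> points N" for xs i
    unfolding y_def by (rule peval_eqv(1)[of _ _ _ "?e xs"]) (auto intro: F points_R that)
  have fy: "eqv (y xs i) (?e (f xs) i)" if "xs \<in> points N" for xs i
  proof (cases "i < N")
    case True
    then show ?thesis using rep(2)[OF yR[OF that, of i]] by (simp add: f_def nth_default_def)
  next
    case False
    then show ?thesis using F0 by (simp add: f_def nth_default_def y_def)
  qed
  have fpts: "f xs \<in> points N" if "xs \<in> points N" for xs
    using rep(1)[OF yR[OF that]] by (auto simp: points_def f_def)
  have "f ` quadric_points N r \<subseteq> quadric_points N s"
  proof
    fix zs assume "zs \<in> f ` quadric_points N r"
    then obtain xs where xs: "zs = f xs" "xs \<in> points N" "eqv (nquad r (?e xs)) 1"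
      by (auto simp: quadric_points_def)
    have "eqv (nquad s (?e (f xs))) (nquad s (y xs))"
      using eqv_sym[OF fy[OF xs(2)]] points_R[OF fpts[OF xs(2)]] yR[OF xs(2)] by (intro nquad_eqv)
    moreover have "nquad s (y xs) = nquad r (?e xs) ^ D" using id1 by (simp add: y_def[abs_def])
    moreover have "eqv (nquad r (?e xs) ^ D) 1"
      by (intro eqv_power xs nquad_in points_R[OF xs(2)])
    ultimately have "eqv (nquad s (?e (f xs))) 1" using eqv_trans by metis
    then show "zs \<in> quadric_points N s" using fpts[OF xs(2)] xs(1) by (simp add: quadric_points_def)
  qed
  moreover have "inj_on f (quadric_points N r)"
  proof (rule inj_onI)
    \<comment> \<open>On the quadric the power of the form is congruent to 1, and \<open>u\<close>
      is an inverse of \<open>h l\<close>; so \<open>G\<close> followed by multiplication by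
      \<open>u\<close> returns the point.\<close>
    have recover: "eqv (u * peval h (G i) (y xs)) (xs ! i)" if xs: "xs \<in> quadric_points N r" and i: "i < N" for xs i
    proof -
      have p: "xs \<in> points N" "eqv (nquad r (?e xs)) 1" using xs by (auto simp: quadric_points_def)
      have xi: "?e xs i = xs ! i" using p(1) i by (simp add: points_def nth_default_def)
      have nR: "nquad r (?e xs) ^ m \<in> R" by (intro ring_set_power[OF R] nquad_in points_R[OF p(1)])
      have "u * peval h (G i) (y xs) = (u * h l) * (nquad r (?e xs) ^ m * xs ! i)"
        using id2[OF i, of "?e xs"] xi by (simp add: y_def[abs_def] mult_ac)
      moreover have "eqv ((u * h l) * (nquad r (?e xs) ^ m * xs ! i)) (1 * (1 * xs ! i))"
        using points_R[OF p(1), of i] xi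
        by (intro eqv_mult l eqv_power p nquad_in points_R[OF p(1)] eqv_refl ring_setD(2)[OF R] ring_setD(4)[OF R] nR) simp_all
      ultimately show ?thesis by simp
    qed
    fix xs ys assume xs: "xs \<in> quadric_points N r" and ys: "ys \<in> quadric_points N r" and eq: "f xs = f ys"
    have p: "xs \<in> points N" "ys \<in> points N" using xs ys by (auto simp: quadric_points_def)
    show "xs = ys"
    proof (rule nth_equalityI)
      show "length xs = length ys" using p by (simp add: points_def)
      fix i assume "i < length xs"
      then have i: "i < N" using p by (simp add: points_def)
      have "eqv (y xs j) (y ys j)" for j
        using fy[OF p(1), of j] eqv_sym[OF fy[OF p(2), of j]] eq eqv_trans by metis
      then have c: "peval h (G i) (y xs) \<in> R" "eqv (peval h (G i) (y xs)) (peval h (G i) (y ys))"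
        using peval_eqv[of "G i" h "y xs" "y ys"] G[OF i] yR p by blast+
      then have "eqv (u * peval h (G i) (y xs)) (u * peval h (G i) (y ys))"
        by (intro eqv_mult l) auto
      then have "eqv (xs ! i) (ys ! i)"
        using recover[OF xs i] recover[OF ys i] eqv_trans eqv_sym by metis
      moreover have "xs ! i \<in> T" "ys ! i \<in> T" using p i by (auto simp: points_def)
      ultimately show "xs ! i = ys ! i" using T_unique by blast
    qed
  qed
  moreover have "finite (quadric_points N s)"
    unfolding quadric_points_def using finite_points by simp
  ultimately show ?thesis by (intro card_inj_on_le)
qed

lemma card_points_Suc:
  "card {xs \<in> points (Suc N). P (hd xs) (tl xs)} = (\<Sum>l\<in>points N. card {x \<in> T. P x l})"
proof -
  have "bij_betw (\<lambda>(l, x). x # l) (SIGMA l:points N. {x \<in> T. P x l}) {xs \<in> points (Suc N). P (hd xs) (tl xs)}"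
    by (rule bij_betwI[where g = "\<lambda>xs. (tl xs, hd xs)"])
      (auto simp: points_def length_Suc_conv)
  then have "card {xs \<in> points (Suc N). P (hd xs) (tl xs)} = card (SIGMA l:points N. {x \<in> T. P x l})"
    by (rule bij_betw_same_card[symmetric])
  also have "\<dots> = (\<Sum>l\<in>points N. card {x \<in> T. P x l})"
    using finite_points T_fin by (subst card_SigmaI) auto
  finally show ?thesis .
qed

lemma nth_default_Cons_Suc2: "(\<lambda>i. nth_default 0 (x # y # l) (i + 2)) = nth_default 0 l"
  by (auto simp: nth_default_def)

lemma card_nquad_1:
  "card {xs \<in> points (Suc N). P (nquad (Suc 0) (nth_default 0 xs))} = card {x \<in> T. P (x ^ 2)} * card T ^ N"
proof -
  have "{xs \<in> points (Suc N). P (nquad (Suc 0) (nth_default 0 xs))} = {xs \<in> points (Suc N). P (hd xs ^ 2)}"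
    by (auto simp: points_def length_Suc_conv)
  then show ?thesis
    using card_points_Suc[of N "\<lambda>x l. P (x ^ 2)"] by (simp add: card_points)
qed

text \<open>The count is fibred over all but the two leading coordinates. The condition
  \<open>P\<close> is arbitrary because, over dual numbers, the recursion serves the equation itself
  as well as its reduction modulo the nilpotent element.\<close>

lemma card_nquad_Suc_Suc:
  "card {xs \<in> points (Suc (Suc N)). P (nquad (Suc (Suc r)) (nth_default 0 xs))} =
    (\<Sum>l\<in>points N. card {xy \<in> T \<times> T. P (fst xy * snd xy + nquad r (nth_default 0 l))})"
proof -
  let ?S = "SIGMA l:points N. {xy \<in> T \<times> T. P (fst xy * snd xy + nquad r (nth_default 0 l))}"
  let ?X = "{xs \<in> points (Suc (Suc N)). P (nquad (Suc (Suc r)) (nth_default 0 xs))}"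
  have nq: "nquad (Suc (Suc r)) (nth_default 0 (x # y # l)) = x * y + nquad r (nth_default 0 l)" for x y l
    using nth_default_Cons_Suc2[of x y l] by (simp add: nquad_Suc_Suc)
  have "bij_betw (\<lambda>(l, (x, y)). x # y # l) ?S ?X"
    by (rule bij_betwI[where g = "\<lambda>xs. (tl (tl xs), (hd xs, hd (tl xs)))"])
      (auto simp: points_def length_Suc_conv nq)
  then have "card ?X = card ?S" by (rule bij_betw_same_card[symmetric])
  also have "\<dots> = (\<Sum>l\<in>points N. card {xy \<in> T \<times> T. P (fst xy * snd xy + nquad r (nth_default 0 l))})"
    using finite_points T_fin by (subst card_SigmaI) auto
  finally show ?thesis .
qed

end

section \<open>Points over the finite residue field\<close>

locale residue_field = quotient_ring R I T for R I T :: "'a::comm_ring_1 set" +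
  assumes field: "finite_residue_field R I"
begin

abbreviation "Q \<equiv> card T"

lemma inverse: "x \<in> R \<Longrightarrow> \<not> eqv x 0 \<Longrightarrow> \<exists>y\<in>R. eqv (x * y) 1"
  using field unfolding finite_residue_field_def eqv_def by simp

lemma one_nz: "\<not> eqv 1 0"
  using field unfolding finite_residue_field_def eqv_def by simp

lemma prime: "x \<in> R \<Longrightarrow> y \<in> R \<Longrightarrow> eqv (x * y) 0 \<Longrightarrow> eqv x 0 \<or> eqv y 0"
  using finite_residue_field_prime[OF R field, of x y] unfolding eqv_def by auto

lemma eqv_diff0: "eqv (x - y) 0 \<longleftrightarrow> eqv x y" by (simp add: eqv_def)

lemma card_eqv: "d \<in> R \<Longrightarrow> card {y \<in> T. eqv y d} = 1"
proof -
  assume d: "d \<in> R"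
  have "{y \<in> T. eqv y d} = {rep d}"
    using rep[OF d] T_unique eqv_trans eqv_sym by blast
  then show ?thesis by simp
qed

lemma card_linear:
  assumes "a \<in> R" "d \<in> R"
  shows "card {y \<in> T. eqv (a * y) d} = (if eqv a 0 then if eqv d 0 then Q else 0 else 1)"
proof (cases "eqv a 0")
  case True
  then have "eqv (a * y) 0" if "y \<in> T" for y
    using eqv_mult[of a 0 y y] T_R[OF that] ring_setD(1)[OF R] by simp
  then have "eqv (a * y) d \<longleftrightarrow> eqv d 0" if "y \<in> T" for y
    using that eqv_trans eqv_sym by blast
  then have "{y \<in> T. eqv (a * y) d} = (if eqv d 0 then T else {})" by auto
  then show ?thesis using True by simp
next
  case False
  obtain b where b: "b \<in> R" "eqv (a * b) 1" using inverse[OF assms(1) False] by blast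
  have "eqv (a * y) d \<longleftrightarrow> eqv y (b * d)" if "y \<in> T" for y
  proof
    have y: "y \<in> R" using T_R that .
    have "eqv ((a * b) * y) (1 * y)" using b y by (intro eqv_mult ring_setD(2)[OF R]) auto
    then have 1: "eqv (b * (a * y)) y" by (simp add: mult_ac)
    assume "eqv (a * y) d"
    then have "eqv (b * (a * y)) (b * d)" using b y assms by (intro eqv_mult ring_setD(4)[OF R]) auto
    then show "eqv y (b * d)" using 1 eqv_trans eqv_sym by blast
  next
    assume "eqv y (b * d)"
    then have "eqv (a * y) (a * (b * d))" using assms T_R[OF that] by (intro eqv_mult) auto
    moreover have "eqv ((a * b) * d) (1 * d)" using b assms by (intro eqv_mult ring_setD(2)[OF R]) auto
    ultimately show "eqv (a * y) d" using eqv_trans by (simp add: mult.assoc)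
  qed
  then have "{y \<in> T. eqv (a * y) d} = {y \<in> T. eqv y (b * d)}" by blast
  then show ?thesis using False card_eqv ring_setD(4)[OF R b(1) assms(2)] by simp
qed

lemma card_zero: "card {x \<in> T. eqv x 0} = 1" and card_nonzero: "card {x \<in> T. \<not> eqv x 0} = Q - 1"
  and Q2: "Q \<ge> 2"
proof -
  show z: "card {x \<in> T. eqv x 0} = 1" using card_eqv[OF ring_setD(1)[OF R]] .
  have "Q = card {x \<in> T. eqv x 0} + card {x \<in> T. \<not> eqv x 0}"
    using T_fin by (subst card_Un_disjoint[symmetric]) (auto intro: arg_cong[of _ _ card])
  then show "card {x \<in> T. \<not> eqv x 0} = Q - 1" using z by simp
  have 0: "0 \<in> R" and 1: "1 \<in> R" using ring_setD(1,2)[OF R] by auto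
  have "rep 0 \<noteq> rep 1" using rep(2)[OF 0] rep(2)[OF 1] one_nz eqv_trans eqv_sym by metis
  then have "card {rep 0, rep 1} = 2" by simp
  moreover have "{rep 0, rep 1} \<subseteq> T" using rep(1)[OF 0] rep(1)[OF 1] by simp
  ultimately show "Q \<ge> 2" using card_mono[OF T_fin] by metis
qed

text \<open>Each nonzero \<open>x\<close> has exactly one partner; the class of 0 contributes
  \<open>Q\<close> more solutions if \<open>d\<close> is congruent to 0 and none otherwise.\<close>

lemma card_hyperbola:
  assumes d: "d \<in> R"
  shows "card {xy \<in> T \<times> T. eqv (fst xy * snd xy) d} = (Q - 1) + (if eqv d 0 then Q else 0)"
proof -
  have "{xy \<in> T \<times> T. eqv (fst xy * snd xy) d} = (SIGMA x:T. {y \<in> T. eqv (x * y) d})" by auto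
  then have "card {xy \<in> T \<times> T. eqv (fst xy * snd xy) d} = (\<Sum>x\<in>T. card {y \<in> T. eqv (x * y) d})"
    using T_fin by simp
  also have "\<dots> = (\<Sum>x\<in>T. if eqv x 0 then if eqv d 0 then Q else 0 else 1)"
    using card_linear[OF T_R d] by (intro sum.cong) auto
  also have "\<dots> = (\<Sum>x\<in>T \<inter> {x. eqv x 0}. if eqv d 0 then Q else 0) + (\<Sum>x\<in>T \<inter> - {x. eqv x 0}. 1)"
    using T_fin by (rule sum.If_cases)
  also have "T \<inter> {x. eqv x 0} = {x \<in> T. eqv x 0}" by blast
  also have "T \<inter> - {x. eqv x 0} = {x \<in> T. \<not> eqv x 0}" by blast
  finally show ?thesis using card_zero card_nonzero by simp
qed

definition roots1 :: nat where "roots1 = card {x \<in> T. eqv (x ^ 2) 1}"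

lemma roots1: "roots1 = (if eqv 2 0 then 1 else 2)"
proof -
  have 1: "1 \<in> R" "- 1 \<in> R" using ring_setD(2)[OF R] ring_setD(5)[OF R] by auto
  have "eqv (x ^ 2) 1 \<longleftrightarrow> eqv x 1 \<or> eqv x (- 1)" if "x \<in> T" for x
  proof
    assume "eqv (x ^ 2) 1"
    then have "eqv ((x - 1) * (x - (- 1))) 0" by (simp add: eqv_def algebra_simps power2_eq_square)
    then show "eqv x 1 \<or> eqv x (- 1)"
      using prime[of "x - 1" "x - (- 1)"] ring_setD(3)[OF R T_R[OF that]] 1 eqv_diff0 by blast
  next
    assume "eqv x 1 \<or> eqv x (- 1)"
    then show "eqv (x ^ 2) 1"
      using eqv_mult[of x 1 x 1] eqv_mult[of x "- 1" x "- 1"] T_R[OF that] 1 by (auto simp: power2_eq_square)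
  qed
  then have set: "{x \<in> T. eqv (x ^ 2) 1} = {rep 1, rep (- 1)}"
    using rep[OF 1(1)] rep[OF 1(2)] T_unique eqv_trans eqv_sym by blast
  have "rep 1 = rep (- 1) \<longleftrightarrow> eqv 2 0"
  proof -
    have "rep 1 = rep (- 1) \<longleftrightarrow> eqv 1 (- 1)"
      using rep[OF 1(1)] rep[OF 1(2)] T_unique eqv_trans eqv_sym by metis
    then show ?thesis by (simp add: eqv_def)
  qed
  then show ?thesis unfolding roots1_def set by auto
qed

lemma card_quadric_0: "card (quadric_points N 0) = 0"
proof -
  have "\<not> eqv 0 1" using one_nz eqv_sym by blast
  then show ?thesis by (simp add: quadric_points_def)
qed

lemma card_quadric_1: "card (quadric_points (Suc N) (Suc 0)) = roots1 * Q ^ N"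
  using card_nquad_1[of N "\<lambda>z. eqv z 1"] by (simp add: quadric_points_def roots1_def)

text \<open>A tail on which the form has the value \<open>z\<close> leaves the equation
  \<open>x * y = 1 - z\<close>, with \<open>Q - 1\<close> solutions, and \<open>Q\<close> more when
  \<open>z\<close> is congruent to 1.\<close>

lemma card_quadric_Suc_Suc:
  "card (quadric_points (Suc (Suc N)) (Suc (Suc r))) = (Q - 1) * Q ^ N + Q * card (quadric_points N r)"
proof -
  let ?n = "\<lambda>l. nquad r (nth_default 0 l)"
  have "card {xy \<in> T \<times> T. eqv (fst xy * snd xy + ?n l) 1} = (Q - 1) + (if eqv (?n l) 1 then Q else 0)"
    if l: "l \<in> points N" for l
  proof -
    have "eqv (z + ?n l) 1 \<longleftrightarrow> eqv z (1 - ?n l)" for z by (simp add: eqv_def algebra_simps)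
    moreover have "1 - ?n l \<in> R" by (intro ring_setD(2,3)[OF R] nquad_in points_R[OF l])
    moreover have "eqv (1 - ?n l) 0 \<longleftrightarrow> eqv (?n l) 1" using eqv_diff0 eqv_sym by blast
    ultimately show ?thesis using card_hyperbola by simp
  qed
  then have "card (quadric_points (Suc (Suc N)) (Suc (Suc r))) =
      (\<Sum>l\<in>points N. (Q - 1) + (if eqv (?n l) 1 then Q else 0))"
    using card_nquad_Suc_Suc[of N "\<lambda>z. eqv z 1" r] by (simp add: quadric_points_def)
  also have "\<dots> = (Q - 1) * Q ^ N + (\<Sum>l\<in>points N. if eqv (?n l) 1 then Q else 0)"
    by (simp add: sum.distrib card_points)
  also have "(\<Sum>l\<in>points N. if eqv (?n l) 1 then Q else 0) = Q * card (quadric_points N r)"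
    using finite_points by (simp add: quadric_points_def flip: sum.inter_filter)
  finally show ?thesis .
qed

text \<open>The deviation from \<open>Q ^ (N - 1)\<close>, the size of a hyperplane, is multiplied
  by \<open>Q\<close> whenever \<open>N\<close> and \<open>r\<close> increase by 2. It starts with
  rank 0, where there are no solutions, and with rank 1, where the solutions are the square roots of
  1 with the other coordinates free.\<close>

theorem card_quadric_points:
  assumes "r \<le> N"
  shows "int (card (quadric_points N r)) =
    int Q ^ (N - 1) + (if even r then - 1 else int roots1 - 1) * int Q ^ (N - 1 - r div 2)"
  using assms
proof (induction r arbitrary: N rule: less_induct)
  case (less r)
  consider "r = 0" | "r = Suc 0" | r' where "r = Suc (Suc r')" by (metis not0_implies_Suc)
  then show ?case
  proof cases
    case 1
    then show ?thesis by (simp add: card_quadric_0)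
  next
    case 2
    then obtain N' where "N = Suc N'" using less.prems by (cases N) auto
    then show ?thesis using 2 by (simp add: card_quadric_1 algebra_simps)
  next
    case 3
    then obtain N' where N': "N = Suc (Suc N')" "r' \<le> N'" using less.prems by (metis Suc_le_D Suc_le_mono)
    let ?e = "if even r' then - 1 else int roots1 - 1"
    have IH: "int (card (quadric_points N' r')) = int Q ^ (N' - 1) + ?e * int Q ^ (N' - 1 - r' div 2)"
      using less.IH[of r' N'] 3 N' by simp
    have Q1: "int (Q - 1) = int Q - 1" using Q2 by simp
    have eq: "int (card (quadric_points N r)) =
        (int Q - 1) * int Q ^ N' + int Q * (int Q ^ (N' - 1) + ?e * int Q ^ (N' - 1 - r' div 2))"
      unfolding N' 3 card_quadric_Suc_Suc using IH Q1 by simp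
    show ?thesis
    proof (cases N')
      \<comment> \<open>Truncated subtraction makes \<open>N' - 1\<close> equal to 0 here, so this
        case is computed by itself.\<close>
      case 0
      then show ?thesis using eq N' 3 by simp
    next
      case (Suc M)
      then have "r' div 2 \<le> M" using N' by simp
      then have "Suc M - r' div 2 = Suc (M - r' div 2)" by simp
      then show ?thesis using eq N' 3 Suc by (simp add: algebra_simps)
    qed
  qed
qed

end

text \<open>Dual numbers over the residue field, as a quotient of a polynomial ring.\<close>

definition dual_ideal :: "'a::comm_ring_1 set \<Rightarrow> 'a set \<Rightarrow> 'a poly set" where
  "dual_ideal R M = {p \<in> polys R. coeff p 0 \<in> M \<and> coeff p 1 \<in> M}"

definition dual_reps :: "'a::comm_ring_1 set \<Rightarrow> 'a poly set" where
  "dual_reps T = (\<lambda>(a, b). [:a, b:]) ` (T \<times> T)"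

context residue_field
begin

lemma dual_quotient_ring: "quotient_ring (polys R) (dual_ideal R I) (dual_reps T)"
proof
  note pR = ring_set_polys[OF R]
  show "ring_set (polys R)" by (rule pR)
  show "ideal_in (polys R) (dual_ideal R I)"
    unfolding ideal_in_def dual_ideal_def
    by (auto intro!: ring_setD[OF pR] ideal_inD(2,3)[OF I] ideal_inD(7)[OF I]
        intro: ideal_inD(4)[OF I] polys_coeff simp: coeff_mult)
  show "transversal (polys R) (dual_ideal R I) (dual_reps T)"
    unfolding transversal_def
  proof (intro conjI ballI)
    show "finite (dual_reps T)" using T_fin by (simp add: dual_reps_def)
    show sub: "dual_reps T \<subseteq> polys R" using T_R by (auto simp: dual_reps_def zero_polys[OF R])
    fix p assume p: "p \<in> polys R"
    have mem: "p - [:a, b:] \<in> dual_ideal R I \<longleftrightarrow> eqv (coeff p 0) a \<and> eqv (coeff p 1) b" if "a \<in> T" "b \<in> T" for a b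
    proof -
      have "[:a, b:] \<in> polys R" using sub that by (auto simp: dual_reps_def)
      then show ?thesis using ring_setD(3)[OF pR p] by (simp add: dual_ideal_def eqv_def)
    qed
    show "\<exists>!t. t \<in> dual_reps T \<and> p - t \<in> dual_ideal R I"
    proof (rule ex1I[of _ "[:rep (coeff p 0), rep (coeff p 1):]"])
      show "[:rep (coeff p 0), rep (coeff p 1):] \<in> dual_reps T \<and>
          p - [:rep (coeff p 0), rep (coeff p 1):] \<in> dual_ideal R I"
        using rep[OF polys_coeff[OF p]] mem by (auto simp: dual_reps_def)
      fix t assume t: "t \<in> dual_reps T \<and> p - t \<in> dual_ideal R I"
      then obtain a b where ab: "a \<in> T" "b \<in> T" "t = [:a, b:]" by (auto simp: dual_reps_def)
      then have "eqv (coeff p 0) a" "eqv (coeff p 1) b" using mem t by auto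
      then show "t = [:rep (coeff p 0), rep (coeff p 1):]"
        using ab rep[OF polys_coeff[OF p]] T_unique eqv_trans eqv_sym by (metis (no_types))
    qed
  qed
qed

end


section \<open>Counting points over dual numbers\<close>

context residue_field
begin

interpretation D: quotient_ring "polys R" "dual_ideal R I" "dual_reps T"
  by (rule dual_quotient_ring)

lemma D_eqv:
  assumes "p \<in> polys R" "q \<in> polys R"
  shows "D.eqv p q \<longleftrightarrow> eqv (coeff p 0) (coeff q 0) \<and> eqv (coeff p 1) (coeff q 1)"
  using ring_setD(3)[OF D.R assms] unfolding D.eqv_def eqv_def by (simp add: dual_ideal_def)

lemma card_dual_reps_Collect:
  "card {x \<in> dual_reps T. P (coeff x 0) (coeff x 1)} = card {ab \<in> T \<times> T. P (fst ab) (snd ab)}"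
proof -
  have "bij_betw (\<lambda>(a, b). [:a, b:]) {ab \<in> T \<times> T. P (fst ab) (snd ab)} {x \<in> dual_reps T. P (coeff x 0) (coeff x 1)}"
    by (rule bij_betwI[where g = "\<lambda>x. (coeff x 0, coeff x 1)"]) (auto simp: dual_reps_def)
  then show ?thesis by (rule bij_betw_same_card[symmetric])
qed

lemma card_dual_reps: "card (dual_reps T) = Q ^ 2"
  using card_dual_reps_Collect[of "\<lambda>_ _. True"] T_fin by (simp add: card_cartesian_product power2_eq_square)

lemma card_affine:
  assumes "a \<in> R" "e \<in> R" "d \<in> R"
  shows "card {xy \<in> T \<times> T. eqv (a * snd xy + e * fst xy) d} =
    (if eqv a 0 \<and> eqv e 0 then if eqv d 0 then Q ^ 2 else 0 else Q)"
proof -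
  have sub: "eqv (x + y) z \<longleftrightarrow> eqv x (z - y)" for x y z by (simp add: eqv_def algebra_simps)
  have sub': "eqv (x + y) z \<longleftrightarrow> eqv y (z - x)" for x y z by (simp add: eqv_def algebra_simps)
  have dR: "d - a * y \<in> R" "d - e * y \<in> R" if "y \<in> T" for y
    using assms T_R[OF that] by (auto intro!: ring_setD(3,4)[OF R])
  have z: "eqv (d - c * y) 0 \<longleftrightarrow> eqv d 0" if "eqv c 0" "y \<in> T" for c y
  proof -
    have "eqv (c * y) (0 * y)" using that T_R ring_setD(1)[OF R] by (intro eqv_mult) auto
    then have "eqv (c * y) 0" by simp
    then show ?thesis using eqv_diff0 eqv_trans eqv_sym by blast
  qed
  have 1: "card {xy \<in> T \<times> T. eqv (a * snd xy + e * fst xy) d} = (\<Sum>x\<in>T. card {y \<in> T. eqv (a * y) (d - e * x)})"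
  proof -
    have "{xy \<in> T \<times> T. eqv (a * snd xy + e * fst xy) d} = (SIGMA x:T. {y \<in> T. eqv (a * y) (d - e * x)})"
      by (auto simp: sub)
    then show ?thesis using T_fin by simp
  qed
  have 2: "card {xy \<in> T \<times> T. eqv (a * snd xy + e * fst xy) d} = (\<Sum>y\<in>T. card {x \<in> T. eqv (e * x) (d - a * y)})"
  proof -
    have "bij_betw prod.swap {xy \<in> T \<times> T. eqv (a * snd xy + e * fst xy) d} (SIGMA y:T. {x \<in> T. eqv (e * x) (d - a * y)})"
      by (rule bij_betwI[where g = prod.swap]) (auto simp: sub')
    then show ?thesis using T_fin by (simp add: bij_betw_same_card)
  qed
  show ?thesis
  proof (cases "eqv a 0")
    case False
    then show ?thesis unfolding 1 using card_linear[OF assms(1) dR(2)] by simp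
  next
    case True
    then show ?thesis unfolding 2 using card_linear[OF assms(2) dR(1)] z[OF True]
      by (simp add: power2_eq_square)
  qed
qed

text \<open>Write the factors as \<open>a + x * eps\<close> and \<open>e + y * eps\<close>. The pair
  of \<open>a\<close> and \<open>e\<close> solves a hyperbola equation over the residue field, and
  \<open>x\<close>, \<open>y\<close> solve a linear equation, which is degenerate only at
  \<open>a = e = 0\<close>, the singular point of \<open>a * e = 0\<close>.\<close>

lemma card_dual_pairs:
  assumes d: "d \<in> polys R"
  shows "card {xy \<in> dual_reps T \<times> dual_reps T. D.eqv (fst xy * snd xy) d} =
    Q * (Q - 1) + (if eqv (coeff d 0) 0 then Q * (Q - 1) else 0) + (if D.eqv d 0 then Q ^ 2 else 0)"
proof -
  let ?S = "{ae \<in> T \<times> T. eqv (fst ae * snd ae) (coeff d 0)}"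
  let ?A = "\<lambda>ae. {xy \<in> T \<times> T. eqv (fst ae * snd xy + snd ae * fst xy) (coeff d 1)}"
  let ?z = "\<lambda>ae. eqv (fst ae) 0 \<and> eqv (snd ae) 0"
  have dR: "coeff d i \<in> R" for i by (rule polys_coeff[OF d])
  have reps: "dual_reps T \<subseteq> polys R" using D.T_R by blast
  have mult: "D.eqv ([:a, x:] * [:e, y:]) d \<longleftrightarrow> eqv (a * e) (coeff d 0) \<and> eqv (a * y + e * x) (coeff d 1)"
    if "a \<in> T" "x \<in> T" "e \<in> T" "y \<in> T" for a x e y
  proof -
    have "[:a, x:] \<in> polys R" "[:e, y:] \<in> polys R" using reps that by (auto simp: dual_reps_def)
    then have "[:a, x:] * [:e, y:] \<in> polys R" by (rule ring_setD(4)[OF D.R])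
    from D_eqv[OF this d] show ?thesis by (simp add: add.commute mult.commute)
  qed
  have "bij_betw (\<lambda>((a, e), (x, y)). ([:a, x:], [:e, y:])) (SIGMA ae:?S. ?A ae)
      {xy \<in> dual_reps T \<times> dual_reps T. D.eqv (fst xy * snd xy) d}"
    by (rule bij_betwI[where g = "\<lambda>(p, q). ((coeff p 0, coeff q 0), (coeff p 1, coeff q 1))"])
      (auto simp: dual_reps_def mult simp del: mult_pCons_left mult_pCons_right)
  then have "card {xy \<in> dual_reps T \<times> dual_reps T. D.eqv (fst xy * snd xy) d} = card (SIGMA ae:?S. ?A ae)"
    by (rule bij_betw_same_card[symmetric])
  also have "\<dots> = (\<Sum>ae\<in>?S. card (?A ae))" using T_fin by (subst card_SigmaI) auto
  also have "\<dots> = (\<Sum>ae\<in>?S. if ?z ae then if eqv (coeff d 1) 0 then Q ^ 2 else 0 else Q)"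
    using card_affine[OF T_R T_R dR] by (intro sum.cong) auto
  also have "\<dots> = (\<Sum>ae\<in>?S \<inter> {ae. ?z ae}. if eqv (coeff d 1) 0 then Q ^ 2 else 0) + (\<Sum>ae\<in>?S \<inter> - {ae. ?z ae}. Q)"
    using T_fin by (subst sum.If_cases) auto
  also have "\<dots> = card (?S \<inter> {ae. ?z ae}) * (if eqv (coeff d 1) 0 then Q ^ 2 else 0) + Q * card (?S \<inter> - {ae. ?z ae})"
    by simp
  also have "card (?S \<inter> {ae. ?z ae}) = (if eqv (coeff d 0) 0 then 1 else 0)"
  proof -
    have "eqv (a * e) 0" if "eqv a 0" "e \<in> T" for a e
      using eqv_mult[of a 0 e e] that T_R ring_setD(1)[OF R] by simp
    then have "eqv (a * e) (coeff d 0) \<longleftrightarrow> eqv (coeff d 0) 0" if "eqv a 0" "e \<in> T" for a e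
      using that eqv_trans eqv_sym by blast
    then have "?S \<inter> {ae. ?z ae} = (if eqv (coeff d 0) 0 then {x \<in> T. eqv x 0} \<times> {x \<in> T. eqv x 0} else {})"
      by auto
    then show ?thesis using card_zero by (simp add: card_cartesian_product)
  qed
  also have "card (?S \<inter> - {ae. ?z ae}) = card ?S - card (?S \<inter> {ae. ?z ae})"
    using T_fin by (subst card_Diff_subset_Int[symmetric]) (auto simp: Diff_eq)
  also have "card (?S \<inter> {ae. ?z ae}) = (if eqv (coeff d 0) 0 then 1 else 0)" by fact
  also have "card ?S = (Q - 1) + (if eqv (coeff d 0) 0 then Q else 0)" by (rule card_hyperbola[OF dR])
  finally show ?thesis using D_eqv[OF d ring_setD(1)[OF D.R]] Q2 by (simp add: algebra_simps)
qed

text \<open>Solutions of the equation modulo the nilpotent element, with arbitrary tangent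
  components. They enter the recursion because the number of factorizations of \<open>d\<close> over
  dual numbers depends on whether its constant coefficient vanishes.\<close>

definition weak_points :: "nat \<Rightarrow> nat \<Rightarrow> 'a poly list set" where
  "weak_points N r = {xs \<in> D.points N. eqv (coeff (nquad r (nth_default 0 xs)) 0) 1}"

lemma card_weak_1: "card (weak_points (Suc N) (Suc 0)) = roots1 * Q * (Q ^ 2) ^ N"
proof -
  have "{x \<in> dual_reps T. eqv (coeff (x ^ 2) 0) 1} = {x \<in> dual_reps T. eqv (coeff x 0 ^ 2) 1}"
    by (simp add: power2_eq_square coeff_mult)
  moreover have "{ab \<in> T \<times> T. eqv (fst ab ^ 2) 1} = {x \<in> T. eqv (x ^ 2) 1} \<times> T" by auto
  ultimately have "card {x \<in> dual_reps T. eqv (coeff (x ^ 2) 0) 1} = roots1 * Q"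
    using card_dual_reps_Collect[of "\<lambda>a b. eqv (a ^ 2) 1"] by (simp add: card_cartesian_product roots1_def)
  then show ?thesis
    using D.card_nquad_1[of N "\<lambda>z. eqv (coeff z 0) 1"] by (simp add: weak_points_def card_dual_reps)
qed

text \<open>In characteristic 2 squaring kills the nilpotent part, so every solution modulo the
  nilpotent element is a solution.\<close>

lemma card_dual_1:
  assumes "eqv 2 0"
  shows "card (D.quadric_points (Suc N) (Suc 0)) = roots1 * Q * (Q ^ 2) ^ N"
proof -
  have "D.eqv (x ^ 2) 1 \<longleftrightarrow> eqv (coeff (x ^ 2) 0) 1" if x: "x \<in> dual_reps T" for x
  proof -
    have xR: "x \<in> polys R" by (rule D.T_R[OF x])
    have "eqv (2 * (coeff x 0 * coeff x 1)) (0 * (coeff x 0 * coeff x 1))"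
      using assms polys_coeff[OF xR] ring_setD(1,4)[OF R] by (intro eqv_mult) auto
    moreover have "coeff (x ^ 2) 1 = 2 * (coeff x 0 * coeff x 1)"
      by (simp add: power2_eq_square coeff_mult)
    ultimately have "eqv (coeff (x ^ 2) 1) 0" by simp
    then show ?thesis
      using D_eqv[OF ring_set_power[OF D.R xR] ring_setD(2)[OF D.R], of 2] by simp
  qed
  then have "{x \<in> dual_reps T. D.eqv (x ^ 2) 1} = {x \<in> dual_reps T. eqv (coeff (x ^ 2) 0) 1}" by blast
  then show ?thesis
    using D.card_nquad_1[of N "\<lambda>z. D.eqv z 1"] card_weak_1[of N]
      D.card_nquad_1[of N "\<lambda>z. eqv (coeff z 0) 1"]
    by (simp add: D.quadric_points_def weak_points_def)
qed

lemma card_weak_Suc_Suc: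
  "card (weak_points (Suc (Suc N)) (Suc (Suc r))) =
    Q ^ 2 * ((Q - 1) * (Q ^ 2) ^ N + Q * card (weak_points N r))"
proof -
  let ?n = "\<lambda>l. nquad r (nth_default 0 l)"
  have "card {xy \<in> dual_reps T \<times> dual_reps T. eqv (coeff (fst xy * snd xy + ?n l) 0) 1} =
      Q ^ 2 * ((Q - 1) + (if eqv (coeff (?n l) 0) 1 then Q else 0))"
    if l: "l \<in> D.points N" for l
  proof -
    let ?d = "1 - coeff (?n l) 0"
    have nR: "?n l \<in> polys R" by (intro D.nquad_in D.points_R[OF l])
    have eq: "eqv (z + coeff (?n l) 0) 1 \<longleftrightarrow> eqv z ?d" for z by (simp add: eqv_def algebra_simps)
    have "bij_betw (\<lambda>((a, e), (x, y)). ([:a, x:], [:e, y:])) ({ae \<in> T \<times> T. eqv (fst ae * snd ae) ?d} \<times> (T \<times> T))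
        {xy \<in> dual_reps T \<times> dual_reps T. eqv (coeff (fst xy * snd xy + ?n l) 0) 1}"
      by (rule bij_betwI[where g = "\<lambda>(p, q). ((coeff p 0, coeff q 0), (coeff p 1, coeff q 1))"])
        (auto simp: dual_reps_def eq mult.commute)
    then have "card {xy \<in> dual_reps T \<times> dual_reps T. eqv (coeff (fst xy * snd xy + ?n l) 0) 1} =
        card {ae \<in> T \<times> T. eqv (fst ae * snd ae) ?d} * Q ^ 2"
      by (simp add: bij_betw_same_card[symmetric] card_cartesian_product power2_eq_square)
    moreover have "?d \<in> R" by (intro ring_setD(2,3)[OF R] polys_coeff[OF nR])
    moreover have "eqv ?d 0 \<longleftrightarrow> eqv (coeff (?n l) 0) 1" using eqv_diff0 eqv_sym by blast
    ultimately show ?thesis using card_hyperbola by simp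
  qed
  then have "card (weak_points (Suc (Suc N)) (Suc (Suc r))) =
      (\<Sum>l\<in>D.points N. Q ^ 2 * ((Q - 1) + (if eqv (coeff (?n l) 0) 1 then Q else 0)))"
    using D.card_nquad_Suc_Suc[of N "\<lambda>z. eqv (coeff z 0) 1" r] by (simp add: weak_points_def)
  also have "\<dots> = Q ^ 2 * ((Q - 1) * (Q ^ 2) ^ N + (\<Sum>l\<in>D.points N. if eqv (coeff (?n l) 0) 1 then Q else 0))"
    by (simp add: sum.distrib D.card_points card_dual_reps flip: sum_distrib_left)
  also have "(\<Sum>l\<in>D.points N. if eqv (coeff (?n l) 0) 1 then Q else 0) = Q * card (weak_points N r)"
    using D.finite_points by (simp add: weak_points_def flip: sum.inter_filter)
  finally show ?thesis .
qed

lemma card_dual_Suc_Suc: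
  "card (D.quadric_points (Suc (Suc N)) (Suc (Suc r))) =
    Q * (Q - 1) * (Q ^ 2) ^ N + Q * (Q - 1) * card (weak_points N r) + Q ^ 2 * card (D.quadric_points N r)"
proof -
  let ?n = "\<lambda>l. nquad r (nth_default 0 l)"
  have "card {xy \<in> dual_reps T \<times> dual_reps T. D.eqv (fst xy * snd xy + ?n l) 1} =
      Q * (Q - 1) + (if eqv (coeff (?n l) 0) 1 then Q * (Q - 1) else 0) + (if D.eqv (?n l) 1 then Q ^ 2 else 0)"
    if l: "l \<in> D.points N" for l
  proof -
    have nR: "?n l \<in> polys R" by (intro D.nquad_in D.points_R[OF l])
    have "D.eqv (z + ?n l) 1 \<longleftrightarrow> D.eqv z (1 - ?n l)" for z by (simp add: D.eqv_def algebra_simps)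
    moreover have "1 - ?n l \<in> polys R" by (intro ring_setD(2,3)[OF D.R] nR)
    moreover have "D.eqv (1 - ?n l) 0 \<longleftrightarrow> D.eqv (?n l) 1"
      using D.eqv_sym[of 1 "?n l"] D.eqv_sym[of "?n l" 1] by (auto simp: D.eqv_def)
    moreover have "eqv (coeff (1 - ?n l) 0) 0 \<longleftrightarrow> eqv (coeff (?n l) 0) 1"
      using eqv_diff0[of 1 "coeff (?n l) 0"] eqv_sym[of 1] eqv_sym[of _ 1] by auto
    ultimately show ?thesis using card_dual_pairs by simp
  qed
  then have "card (D.quadric_points (Suc (Suc N)) (Suc (Suc r))) = (\<Sum>l\<in>D.points N.
      Q * (Q - 1) + (if eqv (coeff (?n l) 0) 1 then Q * (Q - 1) else 0) + (if D.eqv (?n l) 1 then Q ^ 2 else 0))"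
    using D.card_nquad_Suc_Suc[of N "\<lambda>z. D.eqv z 1" r] by (simp add: D.quadric_points_def)
  also have "\<dots> = Q * (Q - 1) * (Q ^ 2) ^ N + (\<Sum>l\<in>D.points N. if eqv (coeff (?n l) 0) 1 then Q * (Q - 1) else 0)
      + (\<Sum>l\<in>D.points N. if D.eqv (?n l) 1 then Q ^ 2 else 0)"
    by (simp add: sum.distrib D.card_points card_dual_reps)
  also have "(\<Sum>l\<in>D.points N. if eqv (coeff (?n l) 0) 1 then Q * (Q - 1) else 0) = Q * (Q - 1) * card (weak_points N r)"
    using D.finite_points by (simp add: weak_points_def flip: sum.inter_filter)
  also have "(\<Sum>l\<in>D.points N. if D.eqv (?n l) 1 then Q ^ 2 else 0) = Q ^ 2 * card (D.quadric_points N r)"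
    using D.finite_points by (simp add: D.quadric_points_def flip: sum.inter_filter)
  finally show ?thesis .
qed

text \<open>Over the residue field \<open>q = 1\<close> has \<open>Q ^ (N - 1)\<close> solutions.
  The tangent vectors at each of them form a hyperplane, except at the singular points, where all
  \<open>Q ^ N\<close> vectors are tangent. As the square has derivative 0, the singular points are
  the solutions whose first \<open>2 * k\<close> coordinates vanish; there are
  \<open>Q ^ (N - 1 - 2 * k)\<close> of them, which explains the second summand. The proof runs
  through the recursions instead.\<close>

lemma card_dual_quadric_points:
  assumes char: "eqv 2 0" and "2 * k + 1 \<le> N"
  shows "card (weak_points N (2 * k + 1)) = Q ^ (2 * N - 1)"
    and "card (quotient_ring.quadric_points (dual_ideal R I) (dual_reps T) N (2 * k + 1)) =
      Q ^ (2 * N - 2) + (Q - 1) * Q ^ (2 * N - 2 - 2 * k)"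
proof -
  have "card (weak_points N (2 * k + 1)) = Q ^ (2 * N - 1) \<and>
      card (D.quadric_points N (2 * k + 1)) = Q ^ (2 * N - 2) + (Q - 1) * Q ^ (2 * N - 2 - 2 * k)"
    using assms(2)
  proof (induction k arbitrary: N)
    case 0
    then obtain M where M: "N = Suc M" by (cases N) auto
    have "Q ^ (2 * M) + (Q - 1) * Q ^ (2 * M) = Q * Q ^ (2 * M)"
      using Q2 by (simp add: algebra_simps)
    then show ?case
      using card_weak_1[of M] card_dual_1[OF char, of M] roots1 char M by (simp add: power_mult)
  next
    case (Suc k)
    then have "N = Suc (Suc (N - 2))" "2 * k + 1 \<le> N - 2" by auto
    then obtain M where M: "N = Suc (Suc M)" "2 * k + 1 \<le> M" by blast
    obtain L where L: "M = Suc L" using M(2) by (cases M) auto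
    have kL: "2 * k \<le> L" using M(2) L by simp
    define c where "c = Q ^ (2 * L + 1)"
    have IH: "card (weak_points M (2 * k + 1)) = c"
      "card (D.quadric_points M (2 * k + 1)) = Q ^ (2 * L) + (Q - 1) * Q ^ (2 * L - 2 * k)"
      using Suc.IH[OF M(2)] by (simp_all add: L c_def)
    have r: "2 * Suc k + 1 = Suc (Suc (2 * k + 1))" by simp
    have sq: "(Q ^ 2) ^ M = Q * c" unfolding power_mult[symmetric] by (simp add: c_def L power2_eq_square)
    have abs: "(Q - 1) * x + x = Q * x" for x using Q2 by (cases Q) auto
    have exp: "2 * N - 1 = 2 * L + 1 + 4" "2 * N - 2 = 2 * L + 1 + 3" "2 * L + 1 + 3 - 2 * Suc k = 2 + (2 * L - 2 * k)"
      using M L kL by simp_all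
    have "card (weak_points N (2 * Suc k + 1)) = Q ^ 2 * ((Q - 1) * (Q * c) + Q * c)"
      unfolding r M(1) card_weak_Suc_Suc IH sq ..
    also have "\<dots> = Q ^ (2 * N - 1)"
      unfolding abs exp power_add c_def by (simp add: eval_nat_numeral)
    finally have w: "card (weak_points N (2 * Suc k + 1)) = Q ^ (2 * N - 1)" .
    have "card (D.quadric_points N (2 * Suc k + 1)) =
        Q * (Q - 1) * (Q * c) + Q * (Q - 1) * c + Q ^ 2 * (Q ^ (2 * L) + (Q - 1) * Q ^ (2 * L - 2 * k))"
      unfolding r M(1) card_dual_Suc_Suc IH sq ..
    also have "Q * q * (Q * c) + Q * q * c + Q ^ 2 * (Q ^ (2 * L) + q * Q ^ (2 * L - 2 * k)) =
        Q ^ 2 * (q * c) + Q * (q * c + c) + q * Q ^ (2 + (2 * L - 2 * k))" for q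
      by (simp add: c_def power2_eq_square algebra_simps)
    also have "Q ^ 2 * ((Q - 1) * c) + Q * ((Q - 1) * c + c) = Q ^ 2 * ((Q - 1) * c + c)"
      unfolding abs by (simp add: power2_eq_square algebra_simps)
    also have "\<dots> = Q ^ (2 * N - 2)"
      unfolding abs exp power_add c_def by (simp add: eval_nat_numeral)
    finally have "card (D.quadric_points N (2 * Suc k + 1)) =
        Q ^ (2 * N - 2) + (Q - 1) * Q ^ (2 * N - 2 - 2 * Suc k)"
      unfolding exp .
    with w show ?case by blast
  qed
  then show "card (weak_points N (2 * k + 1)) = Q ^ (2 * N - 1)"
    "card (quotient_ring.quadric_points (dual_ideal R I) (dual_reps T) N (2 * k + 1)) =
      Q ^ (2 * N - 2) + (Q - 1) * Q ^ (2 * N - 2 - 2 * k)" by auto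
qed

text \<open>The deviation from \<open>Q ^ (N - 1)\<close> is negative for even rank and nonnegative
  for odd rank, so the parities agree. Its exponent then gives the rank; the bounds on
  \<open>r\<close> and \<open>s\<close> keep the truncated subtraction injective. For odd rank with
  \<open>eqv 2 0\<close> the deviation vanishes, and the excess over dual numbers replaces
  it.\<close>

theorem card_quadric_points_inj:
  assumes r: "3 \<le> r" "r \<le> N" and s: "3 \<le> s" "s \<le> N"
    and eq: "card (quadric_points N r) = card (quadric_points N s)"
    and dual: "eqv 2 0 \<Longrightarrow> card (quotient_ring.quadric_points (dual_ideal R I) (dual_reps T) N r) =
      card (quotient_ring.quadric_points (dual_ideal R I) (dual_reps T) N s)"
  shows "r = s"
proof -
  let ?e = "\<lambda>r. if even r then - 1 else int roots1 - 1"
  have Q0: "int Q > 1" using Q2 by simp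
  have e: "?e r * int Q ^ (N - 1 - r div 2) = ?e s * int Q ^ (N - 1 - s div 2)"
    using card_quadric_points[OF r(2)] card_quadric_points[OF s(2)] eq by simp
  have div_eq: "r div 2 = s div 2" if "N - 1 - r div 2 = N - 1 - s div 2"
  proof -
    have "r div 2 \<le> N - 1" "s div 2 \<le> N - 1" using r s by auto
    then show ?thesis using that by linarith
  qed
  have pos: "int Q ^ n > 0" for n using Q0 by simp
  have pow: "N - 1 - r div 2 = N - 1 - s div 2" if "int Q ^ (N - 1 - r div 2) = int Q ^ (N - 1 - s div 2)"
    using that Q0 by (simp add: power_inject_exp)
  consider "even r" "even s" | "even r" "odd s" | "odd r" "even s" | "odd r" "odd s" by blast
  then show ?thesis
  proof cases
    case 1
    then have "r div 2 = s div 2" using e pow div_eq by simp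
    then show ?thesis using 1 by (metis dvd_mult_div_cancel)
  next
    case 2
    then have "- (int Q ^ (N - 1 - r div 2)) = (int roots1 - 1) * int Q ^ (N - 1 - s div 2)" using e by simp
    moreover have "(int roots1 - 1) * int Q ^ (N - 1 - s div 2) \<ge> 0"
      using roots1 pos by (intro mult_nonneg_nonneg) auto
    ultimately show ?thesis using pos[of "N - 1 - r div 2"] by linarith
  next
    case 3
    then have "- (int Q ^ (N - 1 - s div 2)) = (int roots1 - 1) * int Q ^ (N - 1 - r div 2)" using e by simp
    moreover have "(int roots1 - 1) * int Q ^ (N - 1 - r div 2) \<ge> 0"
      using roots1 pos by (intro mult_nonneg_nonneg) auto
    ultimately show ?thesis using pos[of "N - 1 - s div 2"] by linarith
  next
    case 4
    have "r div 2 = s div 2"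
    proof (cases "eqv 2 0")
      case False
      then show ?thesis using e 4 roots1 pow div_eq by simp
    next
      case True
      obtain k l where kl: "r = 2 * k + 1" "s = 2 * l + 1" using 4 by (metis oddE)
      have "(Q - 1) * Q ^ (2 * N - 2 - 2 * k) = (Q - 1) * Q ^ (2 * N - 2 - 2 * l)"
        using dual[OF True] card_dual_quadric_points(2)[OF True, of k N]
          card_dual_quadric_points(2)[OF True, of l N] r s unfolding kl by simp
      then have "Q ^ (2 * N - 2 - 2 * k) = Q ^ (2 * N - 2 - 2 * l)" using Q2 by simp
      then have "2 * N - 2 - 2 * k = 2 * N - 2 - 2 * l" using Q2 by (simp add: power_inject_exp)
      then show ?thesis using kl r s by linarith
    qed
    then show ?thesis using 4 by (metis odd_two_times_div_two_succ)
  qed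
qed

end


section \<open>Linear automorphisms and the main theorem\<close>

lemma homogeneous_power:
  "homogeneous d p \<Longrightarrow> homogeneous (n * d) ((p :: ('n::finite, 'k::comm_ring_1) mpoly) ^ n)"
  by (induction n) (auto intro: homogeneous_mult)

lemma homogeneous_prod:
  assumes "\<And>i. i \<in> I \<Longrightarrow> homogeneous (d i) (p i :: ('n::finite, 'k::comm_ring_1) mpoly)"
  shows "homogeneous (\<Sum>i\<in>I. d i) (\<Prod>i\<in>I. p i)"
  using assms by (induction I rule: infinite_finite_induct) (auto intro: homogeneous_mult)

lemma eval_mpoly_power: "eval_mpoly (p ^ n) x = eval_mpoly p x ^ n"
  by (induction n) (auto simp: eval_mpoly_mult)

section \<open>Linear automorphisms of projective space\<close>

locale linear_iso =
  fixes A A' :: "'k::field ^ 'n::finite \<Rightarrow> 'k ^ 'n"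
  assumes add: "A (u + v) = A u + A v" and scale: "A (c *s v) = c *s A v"
    and inv: "A' (A v) = v" "A (A' v) = v"
begin

lemma inverse: "linear_iso A' A"
proof
  show "A' (u + v) = A' u + A' v" for u v using add[of "A' u" "A' v"] inv by metis
  show "A' (c *s v) = c *s A' v" for c v using scale[of c "A' v"] inv by metis
qed (fact inv)+

lemma zero_iff: "A v = 0 \<longleftrightarrow> v = 0"
  using scale[of 0 v] inv(1)[of v] scale[of 0 0] inv(1)[of 0] by (metis vec.scale_zero_left)

lemma image_span: "A ` vec.span {v} = vec.span {A v}"
  by (auto simp: vec.span_singleton scale image_iff)

lemma image_proj_space: "L \<in> proj_space \<Longrightarrow> A ` L \<in> proj_space"
proof -
  assume "L \<in> proj_space"
  then obtain v where "v \<noteq> 0" "L = vec.span {v}" by (auto simp: proj_space_def)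
  then show ?thesis using span_in_proj_space[of "A v"] by (simp add: image_span zero_iff)
qed

lemma component: "A v $ i = (\<Sum>j\<in>UNIV. A (axis j 1) $ i * v $ j)"
proof -
  have A0: "A 0 = 0" by (simp add: zero_iff)
  have sum: "A (\<Sum>j\<in>J. f j) = (\<Sum>j\<in>J. A (f j))" for J :: "'n set" and f
    by (induction J rule: infinite_finite_induct) (auto simp: A0 add)
  show ?thesis by (subst basis_expansion[of v, symmetric]) (simp add: sum scale mult.commute)
qed

text \<open>Composition with \<open>A\<close> at the level of formal polynomials, in terms of which
  closed sets and regular functions are defined.\<close>

definition subst :: "('n, 'k) mpoly \<Rightarrow> ('n, 'k) mpoly" where
  "subst p = (\<Sum>m\<in>Poly_Mapping.keys p. Poly_Mapping.single 0 (Poly_Mapping.lookup p m) *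
    (\<Prod>i\<in>UNIV. linear_mpoly (\<lambda>j. A (axis j 1) $ i) ^ Poly_Mapping.lookup m i))"

lemma eval_subst: "eval_mpoly (subst p) v = eval_mpoly p (A v)"
proof -
  have "eval_mpoly (linear_mpoly (\<lambda>j. A (axis j 1) $ i)) v = A v $ i" for i
    by (simp add: eval_linear_mpoly component[of v])
  moreover have "eval_monomial 0 v = 1" by (simp add: eval_monomial_def)
  ultimately show ?thesis
    unfolding subst_def eval_mpoly_def[of p] eval_monomial_def[of _ "A v"]
    by (simp add: eval_mpoly_sum eval_mpoly_mult eval_mpoly_prod eval_mpoly_power)
qed

lemma homogeneous_subst:
  assumes "homogeneous d p"
  shows "homogeneous d (subst p)"
  unfolding subst_def
proof (rule homogeneous_sum)
  fix m assume "m \<in> Poly_Mapping.keys p"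
  then have d: "(\<Sum>i\<in>UNIV. Poly_Mapping.lookup m i * 1) = d"
    using assms by (simp add: homogeneous_def monomial_degree_def)
  have "homogeneous 0 (Poly_Mapping.single 0 (Poly_Mapping.lookup p m) :: ('n, 'k) mpoly)"
    by (auto simp: homogeneous_def monomial_degree_def)
  moreover have "homogeneous (\<Sum>i\<in>UNIV. Poly_Mapping.lookup m i * 1)
      (\<Prod>i\<in>UNIV. linear_mpoly (\<lambda>j. A (axis j 1) $ i) ^ Poly_Mapping.lookup m i)"
    by (intro homogeneous_prod homogeneous_power homogeneous_linear)
  ultimately have "homogeneous (0 + d) (Poly_Mapping.single 0 (Poly_Mapping.lookup p m) *
      (\<Prod>i\<in>UNIV. linear_mpoly (\<lambda>j. A (axis j 1) $ i) ^ Poly_Mapping.lookup m i))"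
    unfolding d by (rule homogeneous_mult)
  then show "homogeneous d (Poly_Mapping.single 0 (Poly_Mapping.lookup p m) *
      (\<Prod>i\<in>UNIV. linear_mpoly (\<lambda>j. A (axis j 1) $ i) ^ Poly_Mapping.lookup m i))" by simp
qed

lemma zero_locus_subst:
  assumes "L \<in> proj_space"
  shows "L \<in> zero_locus (subst ` S) \<longleftrightarrow> A ` L \<in> zero_locus S"
  using assms image_proj_space by (auto simp: zero_locus_def eval_subst)

lemma continuous: "continuous_map zariski zariski ((`) A)"
  unfolding continuous_map_closedin
proof (intro conjI allI impI)
  show "(`) A \<in> topspace zariski \<rightarrow> topspace zariski"
    using image_proj_space by (auto simp: topspace_zariski)
  fix C :: "('k, 'n) point set" assume "closedin zariski C"
  then obtain S where S: "\<forall>p\<in>S. \<exists>d. homogeneous d p" "C = zero_locus S"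
    unfolding closedin_zariski proj_closed_def by blast
  have "{L \<in> topspace zariski. A ` L \<in> C} = zero_locus (subst ` S)"
    using zero_locus_subst[of _ S] by (auto simp: topspace_zariski S(2)) (auto simp: zero_locus_def)
  moreover have "\<forall>p\<in>subst ` S. \<exists>d. homogeneous d p" using S(1) homogeneous_subst by blast
  ultimately show "closedin zariski {L \<in> topspace zariski. A ` L \<in> C}"
    unfolding closedin_zariski proj_closed_def by blast
qed

lemma morphism: "variety_morphism proj_space proj_space ((`) A)"
  unfolding variety_morphism_def
proof (intro conjI allI impI)
  have "subtopology zariski proj_space = (zariski :: ('k, 'n) point topology)"
    using subtopology_topspace[of "zariski :: ('k, 'n) point topology"] by (simp add: topspace_zariski)
  then show "continuous_map (subtopology zariski proj_space) (subtopology zariski proj_space) ((`) A)"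
    using continuous by simp
  fix V :: "('k, 'n) point set" and \<phi> :: "('k, 'n) point \<Rightarrow> 'k"
  assume "openin (subtopology zariski proj_space) V \<and> regular_on V \<phi>"
  then have reg: "regular_on V \<phi>" by blast
  let ?D = "{x \<in> proj_space. A ` x \<in> V}"
  show "regular_on ?D (\<phi> \<circ> (`) A)"
    unfolding regular_on_def
  proof
    fix P assume P: "P \<in> ?D"
    then have "A ` P \<in> V" by blast
    from bspec[OF reg[unfolded regular_on_def] this] obtain U d g h where U: "openin (subtopology zariski V) U" "A ` P \<in> U" "homogeneous d g" "homogeneous d h"
      "\<forall>L\<in>U. \<forall>v\<in>L - {0}. eval_mpoly h v \<noteq> 0 \<and> \<phi> L = eval_mpoly g v / eval_mpoly h v"
      by (elim exE conjE) (rule that)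
    obtain W where W: "openin zariski W" "U = W \<inter> V" using U(1) by (auto simp: openin_subtopology)
    let ?W = "{L \<in> topspace zariski. A ` L \<in> W}"
    have "openin zariski ?W" by (rule openin_continuous_map_preimage[OF continuous W(1)])
    then have "openin (subtopology zariski ?D) (?W \<inter> ?D)" by (auto simp: openin_subtopology)
    moreover have "P \<in> ?W \<inter> ?D" using P U(2) W(2) by (auto simp: topspace_zariski)
    moreover have "eval_mpoly (subst h) v \<noteq> 0 \<and> (\<phi> \<circ> (`) A) L = eval_mpoly (subst g) v / eval_mpoly (subst h) v"
      if "L \<in> ?W \<inter> ?D" "v \<in> L - {0}" for L v
    proof -
      have "A ` L \<in> U" "A v \<in> A ` L - {0}" using that W(2) by (auto simp: zero_iff)
      then show ?thesis using U(5) by (simp add: eval_subst)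
    qed
    ultimately show "\<exists>U d g h. openin (subtopology zariski ?D) U \<and> P \<in> U \<and> homogeneous d g \<and> homogeneous d h \<and>
        (\<forall>L\<in>U. \<forall>v\<in>L - {0}. eval_mpoly h v \<noteq> 0 \<and> (\<phi> \<circ> (`) A) L = eval_mpoly g v / eval_mpoly h v)"
      using homogeneous_subst[OF U(3)] homogeneous_subst[OF U(4)] by meson
  qed
qed

lemma isomorphism: "variety_isomorphism proj_space proj_space ((`) A)"
proof -
  interpret I: linear_iso A' A by (rule inverse)
  have "A' ` A ` L = L" "A ` A' ` L = L" for L by (auto simp: image_image inv)
  then show ?thesis unfolding variety_isomorphism_def using morphism I.morphism by blast
qed

end

section \<open>Equality of the ranks\<close>

lemma finite_set_pexp: "finite (set_pexp e)"
  by (induction e) auto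

text \<open>Evaluation at \<open>t\<close> commutes with evaluation of expressions, so identities
  between values over \<open>k\<close> become identities over \<open>k[X]\<close>.\<close>

lemma poly_peval: "poly (peval (\<lambda>c. [:c:]) e x) t = peval id e (\<lambda>i. poly (x i) t)"
  by (induction e) auto

lemma poly_nquad: "poly (nquad r x) t = nquad r (\<lambda>i. poly (x i) t)"
  by (simp add: nquad_def poly_sum poly_power)

lemma poly_eqI_alg_closed:
  fixes P P' :: "'k::alg_closed_field poly"
  assumes "\<And>t. poly P t = poly P' t"
  shows "P = P'"
  using poly_eq_0_alg_closed[of "P - P'"] assms by simp

text \<open>The bound on the number of points is applied twice with the same expressions: with
  representatives in \<open>R\<close> and constants unchanged, and with representatives in
  \<open>R[X]\<close> and constants regarded as constant polynomials. An inverse of \<open>l\<close>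
  modulo \<open>M\<close> serves for both.\<close>

lemma card_quadric_points_mono:
  fixes F G :: "nat \<Rightarrow> 'k::alg_closed_field pexp"
  assumes "residue_field R M T"
    and F: "\<And>i c. i < N \<Longrightarrow> c \<in> set_pexp (F i) \<Longrightarrow> c \<in> R"
    and G: "\<And>i c. i < N \<Longrightarrow> c \<in> set_pexp (G i) \<Longrightarrow> c \<in> R"
    and F0: "\<And>i. i \<ge> N \<Longrightarrow> F i = Const 0"
    and id1: "\<And>x. nquad s (\<lambda>i. peval id (F i) x) = nquad r x ^ D"
    and id2: "\<And>x i. i < N \<Longrightarrow> peval id (G i) (\<lambda>i. peval id (F i) x) = l * nquad r x ^ m * x i"
    and l: "l \<in> R" "l \<notin> M"
  shows "card (quotient_ring.quadric_points M T N r) \<le> card (quotient_ring.quadric_points M T N s)"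
    and "card (quotient_ring.quadric_points (dual_ideal R M) (dual_reps T) N r) \<le>
      card (quotient_ring.quadric_points (dual_ideal R M) (dual_reps T) N s)"
proof -
  interpret residue_field R M T by fact
  interpret D: quotient_ring "polys R" "dual_ideal R M" "dual_reps T" by (rule dual_quotient_ring)
  have "\<not> eqv l 0" using l by (simp add: eqv_def)
  then obtain u where u: "u \<in> R" "eqv (u * l) 1" using inverse[OF l(1)] by (auto simp: mult.commute)
  have F': "c \<in> R" if "c \<in> set_pexp (F i)" for i c
    using F[of i c] F0[of i] that ring_setD(1)[OF R] by (cases "i < N") auto
  show "card (quadric_points N r) \<le> card (quadric_points N s)"
    by (rule card_quadric_points_le[of F id N G s r D l m u]) (use F' G F0 id1 id2 l u in auto)
  let ?h = "\<lambda>c :: 'k. [:c:]"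
  show "card (D.quadric_points N r) \<le> card (D.quadric_points N s)"
  proof (rule D.card_quadric_points_le[of F ?h N G s r D l m "[:u:]"])
    show "nquad s (\<lambda>i. peval ?h (F i) x) = nquad r x ^ D" for x
      by (rule poly_eqI_alg_closed) (simp add: poly_nquad poly_peval poly_power id1)
    show "peval ?h (G i) (\<lambda>i. peval ?h (F i) x) = ?h l * nquad r x ^ m * x i" if "i < N" for x i
      by (rule poly_eqI_alg_closed) (simp add: poly_nquad poly_peval poly_power id2[OF that])
    have eq: "[:u:] * ?h l - 1 = [:u * l - 1:]" by (simp add: one_pCons)
    show "D.eqv ([:u:] * ?h l) 1"
      using u(2) ideal_inD(1)[OF I] ideal_inD(2)[OF I] unfolding D.eqv_def eq eqv_def
      by (simp add: dual_ideal_def zero_polys[OF R])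
  qed (use F' G F0 l u in \<open>auto simp: zero_polys[OF R]\<close>)
qed

lemma isomorphic_complements_rank:
  fixes p p' :: "('n::finite, 'k::alg_closed_field) mpoly"
  assumes q: "quadric_frame p b r" "quadric_frame p' b' r'"
    and iso: "isomorphic_varieties (quadric_frame.compl p) (quadric_frame.compl p')"
  shows "r = r'"
proof -
  interpret S: quadric_frame p b r by fact
  interpret T: quadric_frame p' b' r' by fact
  let ?N = "CARD('n)"
  obtain f where "variety_isomorphism S.compl T.compl f"
    using iso unfolding isomorphic_varieties_def ..
  then obtain g where g: "variety_morphism S.compl T.compl f" "variety_morphism T.compl S.compl g"
    "\<forall>L\<in>S.compl. g (f L) = L" "\<forall>L\<in>T.compl. f (g L) = L"
    unfolding variety_isomorphism_def by (elim conjE exE) (rule that)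
  note fg = g(1,2) g(3)[rule_format] g(4)[rule_format]
  obtain l :: 'k and F :: "nat \<Rightarrow> 'k pexp" and D and G :: "nat \<Rightarrow> 'k pexp" and m where 1: "l \<noteq> 0"
    "\<forall>x. nquad r' (\<lambda>i. peval id (F i) x) = nquad r x ^ D"
    "\<forall>i<?N. \<forall>x. peval id (G i) (\<lambda>i. peval id (F i) x) = l * nquad r x ^ m * x i"
    "\<forall>i\<ge>?N. F i = Const 0"
    using isomorphism_polynomials[OF q fg(1,2,3)] .
  obtain l' :: 'k and F' :: "nat \<Rightarrow> 'k pexp" and D' and G' :: "nat \<Rightarrow> 'k pexp" and m' where 2: "l' \<noteq> 0"
    "\<forall>x. nquad r (\<lambda>i. peval id (F' i) x) = nquad r' x ^ D'"
    "\<forall>i<?N. \<forall>x. peval id (G' i) (\<lambda>i. peval id (F' i) x) = l' * nquad r' x ^ m' * x i"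
    "\<forall>i\<ge>?N. F' i = Const 0"
    using isomorphism_polynomials[OF q(2,1) fg(2,1,4)] .
  \<comment> \<open>A single residue field must serve both directions; keeping the product
    \<open>l * l'\<close> outside \<open>M\<close> keeps both scalars invertible.\<close>
  let ?C = "\<Union>i<?N. set_pexp (F i) \<union> set_pexp (G i) \<union> set_pexp (F' i) \<union> set_pexp (G' i)"
  have fin: "finite (insert (l * l') (insert l (insert l' ?C)))" by (simp add: finite_set_pexp)
  obtain R M where RM: "ring_set R" "insert (l * l') (insert l (insert l' ?C)) \<subseteq> R"
    "finite_residue_field R M" "l * l' \<notin> M"
    by (rule finite_specialization[OF fin, of "l * l'"]) (use 1(1) 2(1) in auto)
  have M: "ideal_in R M" "finite_index R M" using RM(3) by (auto simp: finite_residue_field_def)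
  obtain T where "transversal R M T" using transversal_exists[OF M] .
  then have rf: "residue_field R M T"
    by unfold_locales (use RM M in auto)
  interpret residue_field R M T by (rule rf)
  have l: "l \<in> R" "l' \<in> R" "l \<notin> M" "l' \<notin> M" using RM ideal_inD(4,5)[OF M(1)] by auto
  have C: "c \<in> R" if "i < ?N" "c \<in> set_pexp (F i) \<union> set_pexp (G i) \<union> set_pexp (F' i) \<union> set_pexp (G' i)" for i c
    using that RM(2) by blast
  note le = card_quadric_points_mono[OF rf, where N = ?N and F = F and G = G and r = r and s = r',
      OF _ _ 1(4,2,3)[rule_format] l(1,3)]
  note ge = card_quadric_points_mono[OF rf, where N = ?N and F = F' and G = G' and r = r' and s = r,
      OF _ _ 2(4,2,3)[rule_format] l(2,4)]
  show ?thesis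
  proof (rule card_quadric_points_inj[OF S.r3 S.r_le T.r3 T.r_le])
    show "card (quadric_points ?N r) = card (quadric_points ?N r')"
      by (rule antisym[OF le(1) ge(1)]) (use C in auto)
    show "card (quotient_ring.quadric_points (dual_ideal R M) (dual_reps T) ?N r) =
      card (quotient_ring.quadric_points (dual_ideal R M) (dual_reps T) ?N r')"
      by (rule antisym[OF le(2) ge(2)]) (use C in auto)
  qed
qed

theorem theorem2:
  fixes n :: nat
    and H H' :: "('k::alg_closed_field, 'n::finite) point set"
  assumes "n \<ge> 2" and "CARD('n) = n + 1"
    and "irreducible_quadric H" and "irreducible_quadric H'"
    and "isomorphic_varieties (proj_space - H) (proj_space - H')"
  shows "\<exists>f :: ('k, 'n) point \<Rightarrow> ('k, 'n) point.
           variety_isomorphism proj_space proj_space f \<and> f ` H = H'"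
proof -
  let ?N = "CARD('n)"
  obtain p p' :: "('n, 'k) mpoly" where p: "irreducible p" "homogeneous 2 p" "H = zero_locus {p}"
    and p': "irreducible p'" "homogeneous 2 p'" "H' = zero_locus {p'}"
    using assms(3,4) unfolding irreducible_quadric_def by blast
  obtain r b where rb: "frame UNIV ?N b" "3 \<le> r" "r \<le> ?N" "\<And>x. eval_mpoly p (lincomb ?N b x) = nquad r x"
    using irreducible_quadric_normal_form[OF p(1,2)] by metis
  obtain r' b' where rb': "frame UNIV ?N b'" "3 \<le> r'" "r' \<le> ?N"
    "\<And>x. eval_mpoly p' (lincomb ?N b' x) = nquad r' x"
    using irreducible_quadric_normal_form[OF p'(1,2)] by metis
  interpret S: quadric_frame p b r by unfold_locales (fact p(2) rb)+
  interpret T: quadric_frame p' b' r' by unfold_locales (fact p'(2) rb')+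
  have "isomorphic_varieties S.compl T.compl"
    using assms(5) by (simp add: S.compl_def T.compl_def p(3) p'(3))
  then have r: "r = r'"
    by (rule isomorphic_complements_rank[OF S.quadric_frame_axioms T.quadric_frame_axioms])
  \<comment> \<open>The linear map that keeps the coordinates and changes the frame. As both forms
    have the same rank, it carries the values of \<open>p\<close> to those of
    \<open>p'\<close>.\<close>
  define A where "A v = T.vect (S.coord v)" for v
  define A' where "A' v = S.vect (T.coord v)" for v
  interpret A: linear_iso A A'
  proof
    show "A (u + v) = A u + A v" for u v
      unfolding A_def lincomb_add[symmetric] by (rule lincomb_cong) (rule coords_add[OF S.frame])
    show "A (c *s v) = c *s A v" for c v
      unfolding A_def lincomb_scale[symmetric] by (rule lincomb_cong) (rule coords_scale[OF S.frame])
    show "A' (A v) = v" for v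
    proof -
      have "A' (A v) = S.vect (S.coord v)"
        unfolding A_def A'_def by (rule lincomb_cong) (rule coords_lincomb[OF T.frame])
      then show ?thesis by (simp add: lincomb_coords[OF S.frame])
    qed
    show "A (A' v) = v" for v
    proof -
      have "A (A' v) = T.vect (T.coord v)"
        unfolding A_def A'_def by (rule lincomb_cong) (rule coords_lincomb[OF S.frame])
      then show ?thesis by (simp add: lincomb_coords[OF T.frame])
    qed
  qed
  have pA: "eval_mpoly p' (A v) = eval_mpoly p v" for v
    using S.eval[of "S.coord v"] T.eval[of "S.coord v"] r by (simp add: A_def lincomb_coords[OF S.frame])
  have "(`) A ` H = H'"
  proof (intro equalityI subsetI)
    fix L assume "L \<in> (`) A ` H"
    then show "L \<in> H'" using A.image_proj_space by (auto simp: p(3) p'(3) zero_locus_def pA)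
  next
    fix L assume L: "L \<in> H'"
    interpret I: linear_iso A' A by (rule A.inverse)
    have AL: "L = A ` (A' ` L)" by (simp add: image_image A.inv)
    have "eval_mpoly p v = 0" if "v \<in> A' ` L" for v
      using that L pA[of v] A.inv by (auto simp: p'(3) zero_locus_def)
    then have "A' ` L \<in> H" using L I.image_proj_space by (auto simp: p(3) p'(3) zero_locus_def)
    then show "L \<in> (`) A ` H" using AL by blast
  qed
  then show ?thesis using A.isomorphism by blast
qed

end
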